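(* Work in the proportional block dependent linear model described in the context, where the design $\mathcal{X}=X\Lambda^{1/2}$ satisfies Assumption 1 and $\beta_0$ satisfies Assumption 2, and let $\mathcal{G}=G\Lambda^{1/2}$, where $G\in\mathbb{R}^{n\times p}$ has i.i.d. standard Gaussian entries. Let $\psi:\mathbb{R}\to\mathbb{R}$ be a bounded differentiable function with bounded Lipschitz derivative. Let $\mathcal{T}_n=\{\varphi\in\mathbb{R}^p:\|\varphi\|_\infty\le C\sqrt{d\log n/n},\ \|\varphi\|\le C\}$ for a constant $C>0$ not depending on $n$. (Ridge) There is a sequence $\gamma_n=o(1)$ such that for any subset $\mathcal{S}_n\subset\mathbb{R}^p$, $$\Big|E\,\psi\Big(\min_{\varphi\in\mathcal{S}_n\cap\mathcal{T}_n}R^{R}(\varphi,\mathcal{X})\Big)-E\,\psi\Big(\min_{\varphi\in\mathcal{S}_n\cap\mathcal{T}_n}R^{R}(\varphi,\mathcal{G})\Big)\Big|\le\gamma_n .$$ (Lasso) If in addition Assumption 3 holds, then likewise, for any subset $\mathcal{S}_n\subset\mathbb{R}^p$, $$\Big|E\,\psi\Big(\min_{\varphi\in\mathcal{S}_n\cap\mathcal{T}_n}R^{L}(\varphi,\mathcal{X})\Big)-E\,\psi\Big(\min_{\varphi\in\mathcal{S}_n\cap\mathcal{T}_n}R^{L}(\varphi,\mathcal{G})\Big)\Big|\le\gamma_n .$$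
   Context: Model. For each $n$ there is $p=p(n)$ with $p/n\to\kappa\in(0,\infty)$, a deterministic signal $\beta_0=\beta_0(n)\in\mathbb{R}^p$, a random design $\mathcal{X}\in\mathbb{R}^{n\times p}$ and a noise vector $\xi\in\mathbb{R}^n$ with independent, centered, uniformly sub-Gaussian entries of variance $\sigma^2$ (not necessarily identically distributed), independent of the design; $Y=\mathcal{X}\beta_0+\xi$. When $\mathcal{X}$ is replaced by $\mathcal{G}$, the response is $\mathcal{G}\beta_0+\xi$, with $\xi$ independent of $\mathcal{G}$. The tuning parameter $\lambda>0$ does not depend on $n$. Constants in the assumptions do not depend on $n$. $\|\cdot\|$ is the Euclidean norm; minima over sets are read as infima. Block dependence. A $p$-dimensional random vector $W$ is block dependent with dependence parameter $d$ if there is a partition $S_1,\dots,S_{k_p}$ of $\{1,\dots,p\}$ with $|S_j|\le d$ for all $j$ such that $W_l$ and $W_k$ are independent whenever $l\in S_i$, $k\in S_j$, $i\ne j$ (that is, the blocks of coordinates are independent). Assumption 1. The rows of $\mathcal{X}$ are i.i.d. and each is block dependent with dependence parameter $d$, where $d=o((n/\log n)^{1/5})$. Moreover $\mathcal{X}=X\Lambda^{1/2}$, where the rows $X_i$ of $X$ satisfy $E[X_i]=0$, $E[X_{ij}X_{ik}]=\delta_{jk}$, $E|X_{ij}|^4\le K$, and are sub-Gaussian random vectors (with sub-Gaussian norm bounded uniformly in $n$). $\Lambda=\mathrm{diag}(\lambda_1,\dots,\lambda_p)$ with $c\le\lambda_i\le C'$ for positive constants $c,C'$. Assumption 2. $\beta_0^T\Lambda\beta_0\le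 C'$; with $v_i=\sqrt{n\lambda_i}\,\beta_{0,i}$, the empirical measures $\frac1p\sum_{i=1}^p\delta_{(\lambda_i,v_i)}$ converge in Wasserstein-2 distance to a measure $\mu$ on $\mathbb{R}^{\ge0}\times\mathbb{R}$; and $\|v\|_\infty\le C'$. Assumption 3. $\lambda\ge\lambda_0$, where $\lambda_0$ is a sufficiently large constant (not depending on $n$). Risks. With $\varphi=\beta-\beta_0$, for a design $\mathcal{A}\in\{\mathcal{X},\mathcal{G}\}$, $$R^K(\varphi,\mathcal{A})=\frac1{2n}\|\mathcal{A}\varphi-\xi\|^2+\lambda f_K(\varphi+\beta_0),\qquad f_R(\beta)=\tfrac12\|\beta\|_2^2\ (\text{ridge}),\quad f_L(\beta)=\tfrac1{\sqrt n}\|\beta\|_1\ (\text{Lasso}).$$ *)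

theory Defs
  imports "HOL-Probability.Probability" "HOL-Library.Landau_Symbols"
begin

text \<open>
  The dimension \<open>p = p(n)\<close> varies with \<open>n\<close>. A vector in \<open>\<real>\<^sup>p\<close> is a function on \<open>nat\<close> that is
  extensional on \<open>{..<p}\<close>, as in \<^const>\<open>PiM\<close>. A random matrix \<open>A\<close> is the family of its entries:
  \<open>A i j\<close> is a random variable, with row \<open>i < n\<close> and column \<open>j < p\<close>.
\<close>

definition Rvec :: "nat \<Rightarrow> (nat \<Rightarrow> real) set" where
  "Rvec p = {..<p} \<rightarrow>\<^sub>E UNIV"

definition rand_vec :: "'i set \<Rightarrow> ('i \<Rightarrow> 'w \<Rightarrow> real) \<Rightarrow> 'w \<Rightarrow> 'i \<Rightarrow> real" where
  "rand_vec I W \<omega> = (\<lambda>j\<in>I. W j \<omega>)"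

abbreviation vec_space :: "'i set \<Rightarrow> ('i \<Rightarrow> real) measure" where
  "vec_space I \<equiv> PiM I (\<lambda>_. borel)"

definition rand_mat :: "nat \<Rightarrow> nat \<Rightarrow> (nat \<Rightarrow> nat \<Rightarrow> 'w \<Rightarrow> real) \<Rightarrow> 'w \<Rightarrow> nat \<Rightarrow> nat \<Rightarrow> real" where
  "rand_mat n p A \<omega> = (\<lambda>i\<in>{..<n}. rand_vec {..<p} (A i) \<omega>)"

abbreviation mat_space :: "nat \<Rightarrow> nat \<Rightarrow> (nat \<Rightarrow> nat \<Rightarrow> real) measure" where
  "mat_space n p \<equiv> PiM {..<n} (\<lambda>_. vec_space {..<p})"

text \<open>\<open>A \<Lambda>\<^sup>1\<^sup>/\<^sup>2\<close> with \<open>\<Lambda> = diag(l\<^sub>0, \<dots>, l\<^sub>p\<^sub>-\<^sub>1)\<close>.\<close>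

definition col_scale :: "(nat \<Rightarrow> real) \<Rightarrow> (nat \<Rightarrow> nat \<Rightarrow> 'w \<Rightarrow> real) \<Rightarrow> nat \<Rightarrow> nat \<Rightarrow> 'w \<Rightarrow> real" where
  "col_scale l A i j \<omega> = A i j \<omega> * sqrt (l j)"


subsection \<open>Sub-Gaussian norms\<close>

text \<open>The Orlicz norm for \<open>exp(x\<^sup>2) - 1\<close>; it is infinite if the variable is not sub-Gaussian.\<close>

definition subgaussian_norm :: "'w measure \<Rightarrow> ('w \<Rightarrow> real) \<Rightarrow> ennreal" where
  "subgaussian_norm M Z =
     Inf {ennreal t | t. 0 < t \<and> (\<integral>\<^sup>+\<omega>. ennreal (exp ((Z \<omega>)\<^sup>2 / t\<^sup>2)) \<partial>M) \<le> 2}"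

definition subgaussian_vec_norm :: "'w measure \<Rightarrow> nat \<Rightarrow> (nat \<Rightarrow> 'w \<Rightarrow> real) \<Rightarrow> ennreal" where
  "subgaussian_vec_norm M p W =
     (SUP u \<in> {u \<in> Rvec p. L2_set u {..<p} = 1}. subgaussian_norm M (\<lambda>\<omega>. \<Sum>j<p. u j * W j \<omega>))"


subsection \<open>Wasserstein-2 distance\<close>

definition couplings ::
  "('a::{metric_space, second_countable_topology}) measure \<Rightarrow> 'a measure \<Rightarrow> ('a \<times> 'a) measure set" where
  "couplings \<mu> \<nu> =
     {\<pi>. sets \<pi> = sets (borel \<Otimes>\<^sub>M borel) \<and> distr \<pi> borel fst = \<mu> \<and> distr \<pi> borel snd = \<nu>}"

definition wasserstein2 ::
  "('a::{metric_space, second_countable_topology}) measure \<Rightarrow> 'a measure \<Rightarrow> ennreal" where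
  "wasserstein2 \<mu> \<nu> =
     (let I = (INF \<pi> \<in> couplings \<mu> \<nu>. \<integral>\<^sup>+z. ennreal ((dist (fst z) (snd z))\<^sup>2) \<partial>\<pi>)
      in if I = \<infinity> then \<infinity> else ennreal (sqrt (enn2real I)))"

definition empirical_measure :: "nat \<Rightarrow> (nat \<Rightarrow> 'a::topological_space) \<Rightarrow> 'a measure" where
  "empirical_measure p x = distr (uniform_count_measure {..<p}) borel x"


subsection \<open>The model\<close>

text \<open>Independence across blocks means that the blocks, as random vectors, are mutually independent.\<close>

definition block_dependent :: "'w measure \<Rightarrow> nat \<Rightarrow> nat \<Rightarrow> (nat \<Rightarrow> 'w \<Rightarrow> real) \<Rightarrow> bool" where
  "block_dependent M p d W \<longleftrightarrow>
     (\<exists>P. partition_on {..<p} P \<and> (\<forall>B\<in>P. card B \<le> d) \<and>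
          prob_space.indep_vars M (\<lambda>B. vec_space B) (\<lambda>B. rand_vec B W) P)"

definition iid_rows :: "'w measure \<Rightarrow> nat \<Rightarrow> nat \<Rightarrow> (nat \<Rightarrow> nat \<Rightarrow> 'w \<Rightarrow> real) \<Rightarrow> bool" where
  "iid_rows M n p A \<longleftrightarrow>
     prob_space.indep_vars M (\<lambda>_. vec_space {..<p}) (\<lambda>i. rand_vec {..<p} (A i)) {..<n} \<and>
     (\<forall>i<n. \<forall>i'<n. distr M (vec_space {..<p}) (rand_vec {..<p} (A i)) =
                      distr M (vec_space {..<p}) (rand_vec {..<p} (A i')))"

text \<open>
  Throughout, the sequence index is \<open>n \<ge> 1\<close>. \<open>X n\<close> is the normalised design, \<open>l n\<close> the diagonal
  of \<open>\<Lambda>\<close>; the actual design is \<open>col_scale (l n) (X n)\<close>.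
\<close>

definition assumption1 ::
  "real \<Rightarrow> real \<Rightarrow> real \<Rightarrow> real \<Rightarrow> (nat \<Rightarrow> 'w measure) \<Rightarrow> (nat \<Rightarrow> nat) \<Rightarrow> (nat \<Rightarrow> nat) \<Rightarrow>
   (nat \<Rightarrow> nat \<Rightarrow> real) \<Rightarrow> (nat \<Rightarrow> nat \<Rightarrow> nat \<Rightarrow> 'w \<Rightarrow> real) \<Rightarrow> bool" where
  "assumption1 K L c C' M p d l X \<longleftrightarrow>
     (\<lambda>n. real (d n)) \<in> o(\<lambda>n. (real n / ln (real n)) powr (1/5)) \<and>
     (\<forall>n\<ge>1.
        iid_rows (M n) n (p n) (col_scale (l n) (X n)) \<and>
        (\<forall>i<n. block_dependent (M n) (p n) (d n) (col_scale (l n) (X n) i)) \<and>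
        (\<forall>i<n. \<forall>j<p n. X n i j \<in> borel_measurable (M n) \<and>
           (\<integral>\<omega>. X n i j \<omega> \<partial>M n) = 0 \<and>
           (\<integral>\<^sup>+\<omega>. ennreal (\<bar>X n i j \<omega>\<bar> ^ 4) \<partial>M n) \<le> ennreal K) \<and>
        (\<forall>i<n. \<forall>j<p n. \<forall>k<p n. (\<integral>\<omega>. X n i j \<omega> * X n i k \<omega> \<partial>M n) = (if j = k then 1 else 0)) \<and>
        (\<forall>i<n. subgaussian_vec_norm (M n) (p n) (X n i) \<le> ennreal L) \<and>
        (\<forall>j<p n. c \<le> l n j \<and> l n j \<le> C'))"

definition assumption2 ::
  "real \<Rightarrow> (nat \<Rightarrow> nat) \<Rightarrow> (nat \<Rightarrow> nat \<Rightarrow> real) \<Rightarrow> (nat \<Rightarrow> nat \<Rightarrow> real) \<Rightarrow> (real \<times> real) measure \<Rightarrow> bool" where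
  "assumption2 C' p l \<beta>0 \<mu> \<longleftrightarrow>
     (let v = (\<lambda>n i. sqrt (real n * l n i) * \<beta>0 n i) in
       (\<forall>n\<ge>1. (\<Sum>i<p n. l n i * (\<beta>0 n i)\<^sup>2) \<le> C') \<and>
       prob_space \<mu> \<and> sets \<mu> = sets borel \<and> (AE x in \<mu>. 0 \<le> fst x) \<and>
       (\<lambda>n. wasserstein2 (empirical_measure (p n) (\<lambda>i. (l n i, v n i))) \<mu>) \<longlonglongrightarrow> 0 \<and>
       (\<forall>n\<ge>1. \<forall>i<p n. \<bar>v n i\<bar> \<le> C'))"

definition noise_assumption ::
  "real \<Rightarrow> real \<Rightarrow> (nat \<Rightarrow> 'w measure) \<Rightarrow> (nat \<Rightarrow> nat \<Rightarrow> 'w \<Rightarrow> real) \<Rightarrow> bool" where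
  "noise_assumption \<sigma> L M \<xi> \<longleftrightarrow>
     (\<forall>n\<ge>1.
        prob_space.indep_vars (M n) (\<lambda>_. borel) (\<xi> n) {..<n} \<and>
        (\<forall>i<n. (\<integral>\<omega>. \<xi> n i \<omega> \<partial>M n) = 0 \<and>
               (\<integral>\<omega>. (\<xi> n i \<omega>)\<^sup>2 \<partial>M n) = \<sigma>\<^sup>2 \<and>
               subgaussian_norm (M n) (\<xi> n i) \<le> ennreal L))"

text \<open>
  \<^const>\<open>prob_space.indep_var\<close> needs a common value type, so independence of a matrix and a vector
  is independence of the generated sigma-algebras.
\<close>

definition indep_of_noise ::
  "(nat \<Rightarrow> 'w measure) \<Rightarrow> (nat \<Rightarrow> nat) \<Rightarrow> (nat \<Rightarrow> nat \<Rightarrow> nat \<Rightarrow> 'w \<Rightarrow> real) \<Rightarrow>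
   (nat \<Rightarrow> nat \<Rightarrow> 'w \<Rightarrow> real) \<Rightarrow> bool" where
  "indep_of_noise M p A \<xi> \<longleftrightarrow>
     (\<forall>n\<ge>1. prob_space.indep_set (M n)
        (sets (vimage_algebra (space (M n)) (rand_mat n (p n) (A n)) (mat_space n (p n))))
        (sets (vimage_algebra (space (M n)) (rand_vec {..<n} (\<xi> n)) (vec_space {..<n}))))"

definition std_gaussian_design ::
  "(nat \<Rightarrow> 'w measure) \<Rightarrow> (nat \<Rightarrow> nat) \<Rightarrow> (nat \<Rightarrow> nat \<Rightarrow> nat \<Rightarrow> 'w \<Rightarrow> real) \<Rightarrow> bool" where
  "std_gaussian_design M p G \<longleftrightarrow>
     (\<forall>n\<ge>1.
        prob_space.indep_vars (M n) (\<lambda>_. borel) (\<lambda>(i, j). G n i j) ({..<n} \<times> {..<p n}) \<and>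
        (\<forall>i<n. \<forall>j<p n. distributed (M n) lborel (G n i j) (\<lambda>x. ennreal (std_normal_density x))))"

text \<open>
  Both designs and the noise live on \<open>M n\<close>. No joint law of \<open>X n\<close> and \<open>G n\<close> is prescribed: each
  is only required to be independent of the noise.
\<close>

definition block_dependent_linear_model ::
  "real \<Rightarrow> real \<Rightarrow> real \<Rightarrow> real \<Rightarrow> real \<Rightarrow> real \<Rightarrow> real \<Rightarrow>
   (nat \<Rightarrow> 'w measure) \<Rightarrow> (nat \<Rightarrow> nat) \<Rightarrow> (nat \<Rightarrow> nat) \<Rightarrow> (nat \<Rightarrow> nat \<Rightarrow> real) \<Rightarrow>
   (nat \<Rightarrow> nat \<Rightarrow> real) \<Rightarrow> (real \<times> real) measure \<Rightarrow>
   (nat \<Rightarrow> nat \<Rightarrow> nat \<Rightarrow> 'w \<Rightarrow> real) \<Rightarrow> (nat \<Rightarrow> nat \<Rightarrow> nat \<Rightarrow> 'w \<Rightarrow> real) \<Rightarrow>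
   (nat \<Rightarrow> nat \<Rightarrow> 'w \<Rightarrow> real) \<Rightarrow> bool" where
  "block_dependent_linear_model \<kappa> \<sigma> K L L\<^sub>\<xi> c C' M p d l \<beta>0 \<mu> X G \<xi> \<longleftrightarrow>
     (\<forall>n\<ge>1. prob_space (M n)) \<and>
     (\<lambda>n. real (p n) / real n) \<longlonglongrightarrow> \<kappa> \<and>
     noise_assumption \<sigma> L\<^sub>\<xi> M \<xi> \<and>
     assumption1 K L c C' M p d l X \<and>
     assumption2 C' p l \<beta>0 \<mu> \<and>
     indep_of_noise M p (\<lambda>n. col_scale (l n) (X n)) \<xi> \<and>
     std_gaussian_design M p G \<and>
     indep_of_noise M p (\<lambda>n. col_scale (l n) (G n)) \<xi>"


subsection \<open>Risks\<close>

definition ridge_penalty :: "nat \<Rightarrow> nat \<Rightarrow> (nat \<Rightarrow> real) \<Rightarrow> real" where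
  "ridge_penalty n p \<beta> = (1/2) * (L2_set \<beta> {..<p})\<^sup>2"

definition lasso_penalty :: "nat \<Rightarrow> nat \<Rightarrow> (nat \<Rightarrow> real) \<Rightarrow> real" where
  "lasso_penalty n p \<beta> = (1 / sqrt (real n)) * (\<Sum>j<p. \<bar>\<beta> j\<bar>)"

definition risk ::
  "(nat \<Rightarrow> nat \<Rightarrow> (nat \<Rightarrow> real) \<Rightarrow> real) \<Rightarrow> real \<Rightarrow> nat \<Rightarrow> nat \<Rightarrow> (nat \<Rightarrow> real) \<Rightarrow> (nat \<Rightarrow> 'w \<Rightarrow> real) \<Rightarrow>
   (nat \<Rightarrow> real) \<Rightarrow> (nat \<Rightarrow> nat \<Rightarrow> 'w \<Rightarrow> real) \<Rightarrow> 'w \<Rightarrow> real" where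
  "risk f lam n p \<beta>0 \<xi> \<phi> A \<omega> =
     1 / (2 * real n) * (L2_set (\<lambda>i. (\<Sum>j<p. A i j \<omega> * \<phi> j) - \<xi> i \<omega>) {..<n})\<^sup>2
     + lam * f n p (\<lambda>j. \<phi> j + \<beta>0 j)"

definition T_set :: "real \<Rightarrow> nat \<Rightarrow> nat \<Rightarrow> nat \<Rightarrow> (nat \<Rightarrow> real) set" where
  "T_set C d n p =
     {\<phi> \<in> Rvec p. (\<forall>j<p. \<bar>\<phi> j\<bar> \<le> C * sqrt (real d * ln (real n) / real n)) \<and> L2_set \<phi> {..<p} \<le> C}"

definition test_function :: "(real \<Rightarrow> real) \<Rightarrow> bool" where
  "test_function \<psi> \<longleftrightarrow>
     bounded (range \<psi>) \<and> \<psi> differentiable_on UNIV \<and>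
     bounded (range (deriv \<psi>)) \<and> (\<exists>B. B-lipschitz_on UNIV (deriv \<psi>))"

text \<open>
  The risk is non-negative, so the real-valued \<^const>\<open>Inf\<close> below is the true infimum whenever
  \<open>S \<inter> T_set C d n p\<close> is nonempty; for an empty set both expectations are of the same constant
  and the bound carries no content.
\<close>

definition universality ::
  "(nat \<Rightarrow> nat \<Rightarrow> (nat \<Rightarrow> real) \<Rightarrow> real) \<Rightarrow> real \<Rightarrow> (real \<Rightarrow> real) \<Rightarrow> real \<Rightarrow>
   (nat \<Rightarrow> 'w measure) \<Rightarrow> (nat \<Rightarrow> nat) \<Rightarrow> (nat \<Rightarrow> nat) \<Rightarrow> (nat \<Rightarrow> nat \<Rightarrow> real) \<Rightarrow>
   (nat \<Rightarrow> nat \<Rightarrow> 'w \<Rightarrow> real) \<Rightarrow>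
   (nat \<Rightarrow> nat \<Rightarrow> nat \<Rightarrow> 'w \<Rightarrow> real) \<Rightarrow> (nat \<Rightarrow> nat \<Rightarrow> nat \<Rightarrow> 'w \<Rightarrow> real) \<Rightarrow> bool" where
  "universality f lam \<psi> C M p d \<beta>0 \<xi> A B \<longleftrightarrow>
     (\<exists>\<gamma> :: nat \<Rightarrow> real. \<gamma> \<longlonglongrightarrow> 0 \<and>
        (\<forall>n\<ge>1. \<forall>S \<subseteq> Rvec (p n).
           \<bar>(\<integral>\<omega>. \<psi> (INF \<phi> \<in> S \<inter> T_set C (d n) n (p n). risk f lam n (p n) (\<beta>0 n) (\<xi> n) \<phi> (A n) \<omega>) \<partial>M n)
          - (\<integral>\<omega>. \<psi> (INF \<phi> \<in> S \<inter> T_set C (d n) n (p n). risk f lam n (p n) (\<beta>0 n) (\<xi> n) \<phi> (B n) \<omega>) \<partial>M n)\<bar>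
           \<le> \<gamma> n))"

end

theory Submission
  imports Defs "HOL-Real_Asymp.Real_Asymp"
begin

text \<open>
  Why the theorem holds. It is a Lindeberg argument, carried out on a smoothed minimum.

  \<^emph>\<open>Smoothing.\<close> On the sup-norm bounded set \<open>T\<close> the risk is Lipschitz in \<open>\<phi>\<close>, with a random constant whose
  expectation is polynomial in \<open>n\<close>: it is bounded by second moments of the entries. So the infimum may be taken
  over an \<open>n\<^sup>-\<^sup>3\<close>-net of \<open>S \<inter> T\<close>, whose log-cardinality is of order \<open>p ln n\<close>. The minimum over the net is
  replaced by the soft minimum \<open>- ln (\<Sum> exp (- \<beta> R(\<phi>))) / \<beta>\<close> with \<open>\<beta> = 2 n b\<close>, \<open>b = (ln n)\<^sup>2\<close>; the error
  \<open>p ln n / \<beta>\<close> vanishes. With this \<open>\<beta>\<close> the weight \<open>exp (- \<beta> R(\<phi>))\<close> is the penalty factor times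
  \<open>\<Prod>\<^sub>i exp (- b r\<^sub>i\<^sup>2)\<close>, where \<open>r\<^sub>i\<close> is the residual of row \<open>i\<close>, so that it is a product over the rows. The noise
  is independent of the design and is held fixed; it enters the error through \<open>E exp (3 c \<xi>\<^sub>i\<^sup>2)\<close>.

  \<^emph>\<open>Exchange.\<close> The rows of the design are replaced one after the other, and inside a row its independent
  blocks. Let \<open>a\<close> be the residual of the row without the block \<open>B\<close> and \<open>t = \<Sum>\<^sub>j\<^sub>\<in>\<^sub>B x\<^sub>j \<phi>\<^sub>j\<close>. Up to the factor
  \<open>\<beta>\<close>, inserting the block changes the soft minimum by \<open>- ln\<langle>exp (- u)\<rangle>\<close> with \<open>u = b (2 a t + t\<^sup>2)\<close>, where
  \<open>\<langle>_\<rangle>\<close> is the Gibbs average without the block, hence independent of it. To third order this is a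
  polynomial of degree two in the block, whose mean depends only on the mean and the covariance of the
  block: these agree for the two designs. If \<open>\<eta>\<close> bounds the norm of every \<open>\<phi>\<close> on \<open>B\<close>, then
  \<open>|u| \<le> s (a\<^sup>2 + 2 (t/\<eta>)\<^sup>2)\<close> with \<open>s = b \<eta>\<close>, and the cubic remainder is at most a multiple of
  \<open>s\<^sup>3 \<langle>exp (c (a\<^sup>2 + 2 (t/\<eta>)\<^sup>2))\<rangle>\<close> (\<open>gibbs_expansion\<close>).

  \<^emph>\<open>The remainder has bounded mean.\<close> The block is integrated out by sub-Gaussianity. What is left is
  \<open>\<langle>exp (c a\<^sup>2)\<rangle>\<close>, and here the Gibbs average depends on the same row as \<open>a\<close>. But the row enters the Gibbs
  weights through the factor \<open>exp (- b a\<^sup>2)\<close>, which is decreasing in \<open>a\<^sup>2\<close> while \<open>exp (c a\<^sup>2)\<close> is increasing.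
  By Chebyshev's association inequality (\<open>avg_antitone_reweight\<close>), deleting this factor can only increase
  the average, and after that the weights are independent of the row. Then \<open>a\<close> is sub-Gaussian for every
  fixed \<open>\<phi>\<close>, whatever mixture of the two designs the row consists of.

  \<^emph>\<open>Counting.\<close> A block has \<open>\<eta> = \<surd>|B| h\<close> with \<open>h = C \<surd>(d ln n / n)\<close>. As
  \<open>\<Sum>\<^sub>B |B|\<^sup>3\<^sup>/\<^sup>2 \<le> \<surd>d p\<close>, all exchanges together cost a multiple of \<open>n \<sqdot> b\<^sup>3 h\<^sup>3 \<surd>d p / \<beta>\<close>, which is of order
  \<open>b\<^sup>2 n (ln n / n)\<^sup>3\<^sup>/\<^sup>2 d\<^sup>2\<close>. For \<open>d = o((n / ln n)\<^sup>1\<^sup>/\<^sup>5)\<close> this is \<open>n\<^sup>-\<^sup>1\<^sup>/\<^sup>1\<^sup>0\<close> up to logarithms. The test function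
  is expanded to first order only: the square of the change of the soft minimum, summed over all
  exchanges, is of order \<open>h\<^sup>2 p / n\<close>.
\<close>

section \<open>Finite averages and third-order expansion of their log-Laplace transform\<close>

definition avg :: "'i set \<Rightarrow> ('i \<Rightarrow> real) \<Rightarrow> ('i \<Rightarrow> real) \<Rightarrow> real" where
  "avg I \<pi> f = (\<Sum>i\<in>I. \<pi> i * f i)"

definition weights :: "'i set \<Rightarrow> ('i \<Rightarrow> real) \<Rightarrow> bool" where
  "weights I \<pi> \<longleftrightarrow> finite I \<and> (\<forall>i\<in>I. 0 \<le> \<pi> i) \<and> sum \<pi> I = 1"

lemma avg_add: "avg I \<pi> (\<lambda>i. f i + g i) = avg I \<pi> f + avg I \<pi> g"
  by (simp add: avg_def distrib_left sum.distrib)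

lemma avg_diff: "avg I \<pi> (\<lambda>i. f i - g i) = avg I \<pi> f - avg I \<pi> g"
  by (simp add: avg_def right_diff_distrib sum_subtractf)

lemma avg_cmult: "avg I \<pi> (\<lambda>i. c * f i) = c * avg I \<pi> f"
  by (simp add: avg_def sum_distrib_left algebra_simps)

lemma avg_const: "weights I \<pi> \<Longrightarrow> avg I \<pi> (\<lambda>_. c) = c"
  by (simp add: avg_def weights_def flip: sum_distrib_right)

lemma avg_mono: "weights I \<pi> \<Longrightarrow> (\<And>i. i \<in> I \<Longrightarrow> f i \<le> g i) \<Longrightarrow> avg I \<pi> f \<le> avg I \<pi> g"
  by (auto simp: avg_def weights_def intro!: sum_mono mult_left_mono)

lemma avg_nonneg: "weights I \<pi> \<Longrightarrow> (\<And>i. i \<in> I \<Longrightarrow> 0 \<le> f i) \<Longrightarrow> 0 \<le> avg I \<pi> f"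
  by (auto simp: avg_def weights_def intro!: sum_nonneg)

lemma avg_abs: 
  assumes "weights I \<pi>" "\<And>i. i \<in> I \<Longrightarrow> \<bar>f i\<bar> \<le> g i"
  shows "\<bar>avg I \<pi> f\<bar> \<le> avg I \<pi> g"
proof -
  have "avg I \<pi> f \<le> avg I \<pi> g" using assms by (intro avg_mono) force+
  moreover have "avg I \<pi> (\<lambda>i. (-1) * f i) \<le> avg I \<pi> g" using assms by (intro avg_mono) force+
  ultimately show ?thesis unfolding avg_cmult by linarith
qed

lemma avg_square_le:
  assumes "weights I \<pi>"
  shows "(avg I \<pi> f)\<^sup>2 \<le> avg I \<pi> (\<lambda>i. (f i)\<^sup>2)"
proof -
  let ?m = "avg I \<pi> f"
  have "0 \<le> avg I \<pi> (\<lambda>i. (f i - ?m)\<^sup>2)" using assms by (intro avg_nonneg) auto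
  also have "(\<lambda>i. (f i - ?m)\<^sup>2) = (\<lambda>i. (f i)\<^sup>2 + ((- 2 * ?m) * f i + ?m\<^sup>2))"
    by (auto simp: power2_eq_square algebra_simps)
  also have "avg I \<pi> \<dots> = avg I \<pi> (\<lambda>i. (f i)\<^sup>2) - ?m\<^sup>2"
    using assms unfolding avg_add avg_cmult by (simp add: avg_const power2_eq_square)
  finally show ?thesis by simp
qed

lemma cube_young: 
  fixes a y :: real assumes "0 \<le> a" "0 \<le> y"
  shows "3 * (a * y\<^sup>2) \<le> a^3 + 2 * y^3" "3 * (a\<^sup>2 * y) \<le> 2 * a^3 + y^3"
proof -
  have "a^3 + 2 * y^3 - 3 * (a * y\<^sup>2) = (a - y)\<^sup>2 * (a + 2 * y)"
    "2 * a^3 + y^3 - 3 * (a\<^sup>2 * y) = (a - y)\<^sup>2 * (2 * a + y)"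
    by (simp_all add: power2_eq_square power3_eq_cube algebra_simps)
  moreover have "0 \<le> (a - y)\<^sup>2 * (a + 2 * y)" "0 \<le> (a - y)\<^sup>2 * (2 * a + y)" using assms by auto
  ultimately show "3 * (a * y\<^sup>2) \<le> a^3 + 2 * y^3" "3 * (a\<^sup>2 * y) \<le> 2 * a^3 + y^3" by linarith+
qed

lemma avg_cube_le:
  assumes w: "weights I \<pi>" and f: "\<And>i. i \<in> I \<Longrightarrow> 0 \<le> f i"
  shows "(avg I \<pi> f)^3 \<le> avg I \<pi> (\<lambda>i. f i^3)"
proof -
  let ?m = "avg I \<pi> f"
  have m: "0 \<le> ?m" using assms by (intro avg_nonneg)
  have "avg I \<pi> (\<lambda>i. 3 * ?m\<^sup>2 * f i) \<le> avg I \<pi> (\<lambda>i. 2 * ?m^3 + f i^3)"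
    using cube_young(2)[OF m f] by (intro avg_mono w) (auto simp: mult.assoc)
  then show ?thesis unfolding avg_add avg_cmult avg_const[OF w]
    by (simp add: power2_eq_square power3_eq_cube)
qed

text \<open>
  Taylor with the Lagrange remainder; the factor \<open>exp |u|\<close> makes the bounds valid for unbounded \<open>u\<close>.
\<close>

lemma exp_taylor_bounds:
  fixes u :: real
  shows "\<bar>1 - exp (-u)\<bar> \<le> \<bar>u\<bar> * exp \<bar>u\<bar>"
    "\<bar>1 - exp (-u) - u\<bar> \<le> u\<^sup>2 * exp \<bar>u\<bar>"
    "\<bar>1 - exp (-u) - u + u\<^sup>2 / 2\<bar> \<le> \<bar>u\<bar>^3 * exp \<bar>u\<bar>"
proof -
  have *: "\<bar>exp (-u) - (\<Sum>m<n. (-u)^m / fact m)\<bar> \<le> exp \<bar>u\<bar> * \<bar>u\<bar>^n" for n :: nat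
  proof -
    obtain t where t: "\<bar>t\<bar> \<le> \<bar>-u\<bar>" "exp (-u) = (\<Sum>m<n. (-u)^m / fact m) + exp t / fact n * (-u)^n"
      using Maclaurin_exp_le[of "-u" n] by blast
    have "\<bar>exp (-u) - (\<Sum>m<n. (-u)^m / fact m)\<bar> = (exp t / fact n) * \<bar>u\<bar>^n"
      unfolding t(2) by (simp add: abs_mult power_abs)
    also have "\<dots> \<le> exp \<bar>u\<bar> * \<bar>u\<bar>^n"
    proof (intro mult_right_mono)
      have "exp t / fact n \<le> exp t / 1" by (intro divide_left_mono) (auto simp: fact_ge_1)
      also have "\<dots> \<le> exp \<bar>u\<bar>" using t(1) by simp
      finally show "exp t / fact n \<le> exp \<bar>u\<bar>" .
    qed auto
    finally show ?thesis .
  qed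
  show "\<bar>1 - exp (-u)\<bar> \<le> \<bar>u\<bar> * exp \<bar>u\<bar>"
    using *[of 1] by (simp add: abs_minus_commute mult.commute)
  have "\<bar>1 - exp (-u) - u\<bar> = \<bar>exp (-u) - (\<Sum>m<2. (-u)^m / fact m)\<bar>"
    by (simp add: numeral_2_eq_2)
  then show "\<bar>1 - exp (-u) - u\<bar> \<le> u\<^sup>2 * exp \<bar>u\<bar>"
    using *[of 2] by (simp add: mult.commute)
  have "\<bar>1 - exp (-u) - u + u\<^sup>2 / 2\<bar> = \<bar>exp (-u) - (\<Sum>m<3. (-u)^m / fact m)\<bar>"
    by (simp add: numeral_3_eq_3 power2_eq_square)
  then show "\<bar>1 - exp (-u) - u + u\<^sup>2 / 2\<bar> \<le> \<bar>u\<bar>^3 * exp \<bar>u\<bar>"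
    using *[of 3] by (simp add: mult.commute)
qed

lemma ln_one_minus_cubic:
  fixes m :: real assumes "\<bar>m\<bar> \<le> 1/2"
  shows "\<bar>- ln (1 - m) - m - m\<^sup>2 / 2\<bar> \<le> \<bar>m\<bar>^3"
proof -
  let ?g = "\<lambda>x::real. - ln (1 - x) - x - x\<^sup>2 / 2"
  have d: "(?g has_real_derivative x\<^sup>2 / (1 - x)) (at x)" if "\<bar>x\<bar> \<le> 1/2" for x
  proof -
    have x: "1 - x > 0" using that by linarith
    have "(?g has_real_derivative (- ((- 1) / (1 - x)) - 1 - (2 * x) / 2)) (at x)"
      using x by (auto intro!: derivative_eq_intros)
    moreover have "- ((- 1) / (1 - x)) - 1 - (2 * x) / 2 = x\<^sup>2 / (1 - x)"
      using x by (simp add: field_simps power2_eq_square)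
    ultimately show ?thesis by simp
  qed
  have b: "0 \<le> x\<^sup>2 / (1 - x)" "x\<^sup>2 / (1 - x) \<le> 3 * x\<^sup>2" if "\<bar>x\<bar> \<le> 1/2" for x :: real
  proof -
    have "1 / (1 - x) \<le> 3" using that by (auto simp: field_simps)
    then have "x\<^sup>2 * (1 / (1 - x)) \<le> x\<^sup>2 * 3" by (intro mult_left_mono) auto
    then show "x\<^sup>2 / (1 - x) \<le> 3 * x\<^sup>2" by (simp add: mult.commute)
    show "0 \<le> x\<^sup>2 / (1 - x)" using that by auto
  qed
  show ?thesis
  proof (cases "0 \<le> m")
    case True
    have "?g 0 \<le> ?g m"
    proof (rule DERIV_nonneg_imp_nondecreasing[OF True])
      fix x assume "0 \<le> x" "x \<le> m"
      then have x: "\<bar>x\<bar> \<le> 1/2" using assms by simp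
      show "\<exists>y. (?g has_real_derivative y) (at x) \<and> 0 \<le> y" using d[OF x] b(1)[OF x] by blast
    qed
    moreover have "(\<lambda>x. ?g x - x^3) m \<le> (\<lambda>x. ?g x - x^3) 0"
    proof (rule DERIV_nonpos_imp_nonincreasing[OF True])
      fix x assume x: "0 \<le> x" "x \<le> m"
      then have x': "\<bar>x\<bar> \<le> 1/2" using assms by simp
      have cube: "((\<lambda>x. x^3) has_real_derivative 3 * x\<^sup>2) (at x)"
        using DERIV_pow[of 3 x UNIV] by simp
      show "\<exists>y. ((\<lambda>x. ?g x - x^3) has_real_derivative y) (at x) \<and> y \<le> 0"
      proof (intro exI conjI)
        show "((\<lambda>x. ?g x - x^3) has_real_derivative (x\<^sup>2 / (1 - x) - 3 * x\<^sup>2)) (at x)"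
          by (rule DERIV_diff[OF d[OF x'] cube])
        show "x\<^sup>2 / (1 - x) - 3 * x\<^sup>2 \<le> 0" using b(2)[OF x'] by linarith
      qed
    qed
    ultimately have "0 \<le> ?g m" "?g m \<le> m^3" by (simp_all only: diff_0_right ln_one) auto
    then show ?thesis unfolding abs_of_nonneg[OF True] abs_le_iff by linarith
  next
    case False
    then have m0: "m \<le> 0" by simp
    have "?g m \<le> ?g 0"
    proof (rule DERIV_nonneg_imp_nondecreasing[OF m0])
      fix x assume "m \<le> x" "x \<le> 0"
      then have x: "\<bar>x\<bar> \<le> 1/2" using assms by simp
      show "\<exists>y. (?g has_real_derivative y) (at x) \<and> 0 \<le> y" using d[OF x] b(1)[OF x] by blast
    qed
    moreover have "(\<lambda>x. ?g x - x^3) 0 \<le> (\<lambda>x. ?g x - x^3) m"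
    proof (rule DERIV_nonpos_imp_nonincreasing[OF m0])
      fix x assume x: "m \<le> x" "x \<le> 0"
      then have x': "\<bar>x\<bar> \<le> 1/2" using assms by simp
      have cube: "((\<lambda>x. x^3) has_real_derivative 3 * x\<^sup>2) (at x)"
        using DERIV_pow[of 3 x UNIV] by simp
      show "\<exists>y. ((\<lambda>x. ?g x - x^3) has_real_derivative y) (at x) \<and> y \<le> 0"
      proof (intro exI conjI)
        show "((\<lambda>x. ?g x - x^3) has_real_derivative (x\<^sup>2 / (1 - x) - 3 * x\<^sup>2)) (at x)"
          by (rule DERIV_diff[OF d[OF x'] cube])
        show "x\<^sup>2 / (1 - x) - 3 * x\<^sup>2 \<le> 0" using b(2)[OF x'] by linarith
      qed
    qed
    ultimately have "?g m \<le> 0" "m^3 \<le> ?g m" by (simp_all only: diff_0_right ln_one) auto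
    moreover have "\<bar>m\<bar>^3 = - (m^3)" using False by (simp add: power3_eq_cube)
    ultimately show ?thesis unfolding abs_le_iff by linarith
  qed
qed

lemma neg_log_avg_exp_abs:
  assumes w: "weights I \<pi>"
  shows "\<bar>- ln (avg I \<pi> (\<lambda>i. exp (- u i)))\<bar> \<le> avg I \<pi> (\<lambda>i. \<bar>u i\<bar> * exp \<bar>u i\<bar>)"
proof -
  let ?Z = "avg I \<pi> (\<lambda>i. exp (- u i))"
  have "exp (- avg I \<pi> u) \<le> ?Z"
  proof -
    let ?m = "avg I \<pi> u"
    have "avg I \<pi> (\<lambda>i. exp (- ?m) * (1 - (u i - ?m))) \<le> ?Z"
    proof (intro avg_mono w)
      fix i
      have "1 + - (u i - ?m) \<le> exp (- (u i - ?m))" by (rule exp_ge_add_one_self)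
      then have *: "1 - (u i - ?m) \<le> exp (- (u i - ?m))" by linarith
      have "exp (- ?m) * (1 - (u i - ?m)) \<le> exp (- ?m) * exp (- (u i - ?m))"
        by (intro mult_left_mono *) auto
      also have "\<dots> = exp (- u i)" by (simp flip: exp_add)
      finally show "exp (- ?m) * (1 - (u i - ?m)) \<le> exp (- u i)" .
    qed
    then show ?thesis unfolding avg_cmult avg_diff avg_const[OF w] by simp
  qed
  then have Zpos: "?Z > 0" and up: "- ln ?Z \<le> avg I \<pi> u"
    using exp_gt_zero[of "- avg I \<pi> u"] ln_ge_iff[of ?Z "- avg I \<pi> u"] by linarith+
  have "ln ?Z \<le> ?Z - 1" using Zpos by (rule ln_le_minus_one)
  also have "?Z - 1 = - avg I \<pi> (\<lambda>i. 1 - exp (- u i))" unfolding avg_diff avg_const[OF w] by simp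
  also have "\<dots> \<le> avg I \<pi> (\<lambda>i. \<bar>u i\<bar> * exp \<bar>u i\<bar>)"
    using avg_abs[OF w exp_taylor_bounds(1), of u] by linarith
  finally have 1: "ln ?Z \<le> avg I \<pi> (\<lambda>i. \<bar>u i\<bar> * exp \<bar>u i\<bar>)" .
  have "\<bar>v\<bar> \<le> \<bar>v\<bar> * exp \<bar>v\<bar>" for v :: real
    using mult_left_mono[of 1 "exp \<bar>v\<bar>" "\<bar>v\<bar>"] by simp
  then have "u i \<le> \<bar>u i\<bar> * exp \<bar>u i\<bar>" for i by (meson abs_ge_self order_trans)
  then have "avg I \<pi> u \<le> avg I \<pi> (\<lambda>i. \<bar>u i\<bar> * exp \<bar>u i\<bar>)"
    by (intro avg_mono w)
  then show ?thesis using 1 up by linarith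
qed

text \<open>
  The cumulant expansion of \<open>- ln\<langle>exp (- u)\<rangle>\<close> to second order. The remainder is measured by the third moment
  of \<open>f = |u| exp |u|\<close>. This works for large \<open>u\<close> as well: if this moment is small, so are all terms of
  the expansion; if it is not, it dominates each of them separately.
\<close>

lemma neg_log_avg_exp_expansion:
  assumes w: "weights I \<pi>"
  shows "\<bar>- ln (avg I \<pi> (\<lambda>i. exp (- u i)))
          - (avg I \<pi> u - avg I \<pi> (\<lambda>i. (u i)\<^sup>2) / 2 + (avg I \<pi> u)\<^sup>2 / 2)\<bar>
         \<le> 27 * avg I \<pi> (\<lambda>i. \<bar>u i\<bar>^3 * exp (3 * \<bar>u i\<bar>))"
proof -
  let ?Z = "avg I \<pi> (\<lambda>i. exp (- u i))"
  define f where "f = (\<lambda>i. \<bar>u i\<bar> * exp \<bar>u i\<bar>)"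
  define A where "A = avg I \<pi> f"
  define m where "m = avg I \<pi> (\<lambda>i. 1 - exp (- u i))"
  define q where "q = avg I \<pi> (\<lambda>i. f i^3)"
  define F2 where "F2 = avg I \<pi> (\<lambda>i. (f i)\<^sup>2)"
  define U where "U = avg I \<pi> u"
  define V where "V = avg I \<pi> (\<lambda>i. (u i)\<^sup>2)"
  have f0: "0 \<le> f i" for i by (simp add: f_def)
  have uf: "\<bar>u i\<bar> \<le> f i" for i
    using mult_left_mono[of 1 "exp \<bar>u i\<bar>" "\<bar>u i\<bar>"] by (simp add: f_def)
  have f3: "f i^3 = \<bar>u i\<bar>^3 * exp (3 * \<bar>u i\<bar>)" for i
    using exp_of_nat_mult[of 3 "\<bar>u i\<bar>"] by (simp add: f_def power_mult_distrib)
  have A0: "0 \<le> A" unfolding A_def by (intro avg_nonneg w f0)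
  have q0: "0 \<le> q" unfolding q_def by (intro avg_nonneg w) (simp add: f0)
  have A3: "A^3 \<le> q" unfolding A_def q_def by (intro avg_cube_le w f0)
  have V0: "0 \<le> V" unfolding V_def by (intro avg_nonneg w) simp
  have VF: "V \<le> F2" unfolding V_def F2_def
    by (intro avg_mono w) (metis uf abs_ge_zero power2_abs power_mono)
  have UA: "\<bar>U\<bar> \<le> A" unfolding U_def A_def by (intro avg_abs w uf)
  have mA: "\<bar>m\<bar> \<le> A" unfolding m_def A_def f_def by (intro avg_abs w exp_taylor_bounds(1))
  have Z: "?Z = 1 - m" unfolding m_def avg_diff avg_const[OF w] by simp
  have gA: "\<bar>- ln ?Z\<bar> \<le> A" unfolding A_def f_def by (rule neg_log_avg_exp_abs[OF w])
  have "\<bar>- ln ?Z - (U - V / 2 + U\<^sup>2 / 2)\<bar> \<le> 27 * q"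
  \<comment> \<open>The threshold makes \<open>A \<le> 1/2\<close>, so that the expansion of \<open>ln (1 - m)\<close> applies.\<close>
  proof (cases "q \<le> 1/8")
    case True
    have "A^3 \<le> (1/2)^3" using A3 True by (simp add: power3_eq_cube)
    then have Ah: "A \<le> 1/2" by (rule power_le_imp_le_base[of _ 2, simplified]) simp
    have 1: "\<bar>- ln (1 - m) - m - m\<^sup>2 / 2\<bar> \<le> q"
    proof -
      have "\<bar>- ln (1 - m) - m - m\<^sup>2 / 2\<bar> \<le> \<bar>m\<bar>^3" using mA Ah by (intro ln_one_minus_cubic) simp
      also have "\<dots> \<le> A^3" using mA by (intro power_mono) auto
      finally show ?thesis using A3 by simp
    qed
    have 2: "\<bar>m - U + V / 2\<bar> \<le> q"
    proof -
      have "m - U + V / 2 = avg I \<pi> (\<lambda>i. 1 - exp (- u i) - u i + (1/2) * (u i)\<^sup>2)"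
        unfolding m_def U_def V_def avg_diff avg_add avg_cmult by simp
      also have "\<bar>\<dots>\<bar> \<le> q" unfolding q_def
      proof (intro avg_abs w)
        fix i
        have "\<bar>u i\<bar>^3 * exp \<bar>u i\<bar> \<le> f i^3" unfolding f3 by (intro mult_left_mono) auto
        then show "\<bar>1 - exp (- u i) - u i + (1/2) * (u i)\<^sup>2\<bar> \<le> f i^3"
          using exp_taylor_bounds(3)[of "u i"] by simp
      qed
      finally show ?thesis .
    qed
    have 3: "\<bar>m - U\<bar> \<le> F2"
    proof -
      have "m - U = avg I \<pi> (\<lambda>i. 1 - exp (- u i) - u i)" unfolding m_def U_def avg_diff by simp
      also have "\<bar>\<dots>\<bar> \<le> F2" unfolding F2_def
      proof (intro avg_abs w)
        fix i
        have "(u i)\<^sup>2 * exp \<bar>u i\<bar> \<le> (u i)\<^sup>2 * exp (2 * \<bar>u i\<bar>)" by (intro mult_left_mono) auto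
        also have "\<dots> = (f i)\<^sup>2" by (simp add: f_def power_mult_distrib exp_double)
        finally show "\<bar>1 - exp (- u i) - u i\<bar> \<le> (f i)\<^sup>2"
          using exp_taylor_bounds(2)[of "u i"] by simp
      qed
      finally show ?thesis .
    qed
    have 4: "A * F2 \<le> q"
    proof -
      have "avg I \<pi> (\<lambda>i. (3 * A) * (f i)\<^sup>2) \<le> avg I \<pi> (\<lambda>i. A^3 + 2 * f i^3)"
        using cube_young(1)[OF A0 f0] by (intro avg_mono w) (auto simp: mult.assoc)
      then show ?thesis unfolding avg_cmult avg_add avg_const[OF w] F2_def[symmetric] q_def[symmetric]
        using A3 by simp
    qed
    have 5: "\<bar>m\<^sup>2 - U\<^sup>2\<bar> \<le> 2 * q"
    proof -
      have "\<bar>m\<^sup>2 - U\<^sup>2\<bar> = \<bar>m - U\<bar> * \<bar>m + U\<bar>" by (simp add: power2_eq_square algebra_simps flip: abs_mult)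
      also have "\<dots> \<le> F2 * (2 * A)" using 3 mA UA by (intro mult_mono) auto
      finally show ?thesis using 4 by (simp add: algebra_simps)
    qed
    show ?thesis unfolding Z using 1 2 5 q0 by linarith
  next
    case False
    have one: "y \<le> 1 + y^3" "y\<^sup>2 \<le> 1 + y^3" if "0 \<le> y" for y :: real
    proof -
      have "0 \<le> y^3" using that by simp
      moreover have "3 * y \<le> 2 + y^3" "3 * y\<^sup>2 \<le> 1 + 2 * y^3"
        using cube_young(2)[of 1 y] cube_young(1)[of 1 y] that by auto
      ultimately show "y \<le> 1 + y^3" "y\<^sup>2 \<le> 1 + y^3" by linarith+
    qed
    have a: "A \<le> 1 + q" "F2 \<le> 1 + q"
    proof -
      have "avg I \<pi> f \<le> avg I \<pi> (\<lambda>i. 1 + f i^3)" "avg I \<pi> (\<lambda>i. (f i)\<^sup>2) \<le> avg I \<pi> (\<lambda>i. 1 + f i^3)"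
        by (intro avg_mono w one f0)+
      then show "A \<le> 1 + q" "F2 \<le> 1 + q" unfolding A_def F2_def q_def avg_add avg_const[OF w] by auto
    qed
    have b: "U\<^sup>2 \<le> V" unfolding U_def V_def by (rule avg_square_le[OF w])
    show ?thesis using a b False gA UA VF V0 zero_le_power2[of U] by linarith
  qed
  then show ?thesis unfolding U_def V_def q_def f3 .
qed

text \<open>
  Chebyshev's association inequality: reweighting by a decreasing function of \<open>x\<close> lowers the average of an
  increasing function of \<open>x\<close>. The double sum over \<open>(i, j)\<close> has terms of one sign.
\<close>

lemma avg_antitone_reweight:
  fixes x :: "'i \<Rightarrow> real" and b c :: real
  assumes fin: "finite I" and w: "\<And>i. i \<in> I \<Longrightarrow> 0 \<le> w i" and b: "0 \<le> b" and c: "0 \<le> c"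
  shows "(\<Sum>i\<in>I. w i * exp (- b * x i) * exp (c * x i)) * (\<Sum>i\<in>I. w i)
       \<le> (\<Sum>i\<in>I. w i * exp (- b * x i)) * (\<Sum>i\<in>I. w i * exp (c * x i))"
proof -
  let ?H = "\<lambda>i. exp (- b * x i)" and ?G = "\<lambda>i. exp (c * x i)"
  have opp: "(?H i - ?H j) * (?G i - ?G j) \<le> 0" for i j
  proof (cases "x i \<le> x j")
    case True
    then have "?H j \<le> ?H i" "?G i \<le> ?G j" using b c by (auto simp: mult_left_mono)
    then show ?thesis by (intro mult_nonneg_nonpos) auto
  next
    case False
    then have "?H i \<le> ?H j" "?G j \<le> ?G i" using b c by (auto simp: mult_left_mono)
    then show ?thesis by (intro mult_nonpos_nonneg) auto
  qed
  have "0 \<ge> (\<Sum>i\<in>I. \<Sum>j\<in>I. w i * w j * ((?H i - ?H j) * (?G i - ?G j)))"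
    by (intro sum_nonpos mult_nonneg_nonpos mult_nonneg_nonneg opp w)
  also have "(\<Sum>i\<in>I. \<Sum>j\<in>I. w i * w j * ((?H i - ?H j) * (?G i - ?G j)))
    = (\<Sum>i\<in>I. \<Sum>j\<in>I. (w i * ?H i * ?G i) * w j + w i * (w j * ?H j * ?G j)
       - (w i * ?H i) * (w j * ?G j) - (w i * ?G i) * (w j * ?H j))"
    by (intro sum.cong refl) (simp add: algebra_simps)
  also have "\<dots> = (\<Sum>i\<in>I. w i * ?H i * ?G i) * (\<Sum>i\<in>I. w i)
      + (\<Sum>i\<in>I. w i) * (\<Sum>i\<in>I. w i * ?H i * ?G i)
      - (\<Sum>i\<in>I. w i * ?H i) * (\<Sum>i\<in>I. w i * ?G i)
      - (\<Sum>i\<in>I. w i * ?G i) * (\<Sum>i\<in>I. w i * ?H i)"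
    unfolding sum.distrib sum_subtractf sum_product ..
  finally have "0 \<ge> 2 * ((\<Sum>i\<in>I. w i * ?H i * ?G i) * (\<Sum>i\<in>I. w i))
      - 2 * ((\<Sum>i\<in>I. w i * ?H i) * (\<Sum>i\<in>I. w i * ?G i))"
    by (simp only: mult.commute)
  then show ?thesis by linarith
qed

section \<open>Inserting one block into a Gibbs average\<close>

lemma power_le_exp:
  fixes y c :: real assumes "0 \<le> y" "0 < c"
  shows "y^k \<le> (fact k / c^k) * exp (c * y)"
proof -
  have "(c * y)^k / fact k \<le> exp (c * y)"
  proof (cases "k = 0")
    case False
    obtain t where t: "\<bar>t\<bar> \<le> \<bar>c * y\<bar>" "exp (c * y) = (\<Sum>m<Suc k. (c * y)^m / fact m) + exp t / fact (Suc k) * (c * y)^(Suc k)"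
      using Maclaurin_exp_le[of "c * y" "Suc k"] by blast
    have cy: "0 \<le> c * y" using assms by simp
    have "(c * y)^k / fact k \<le> (\<Sum>m<Suc k. (c * y)^m / fact m)"
      unfolding sum.lessThan_Suc using cy by (simp add: sum_nonneg)
    also have "\<dots> \<le> exp (c * y)" unfolding t(2) using cy by simp
    finally show ?thesis .
  qed (use assms in simp)
  then show ?thesis using assms by (simp add: field_simps power_mult_distrib)
qed

text \<open>
  The part of degree at most two in \<open>t\<close> of the expansion of \<open>- ln\<langle>exp (- b (2 a t + t\<^sup>2))\<rangle>\<close>.
\<close>

definition gibbs_quadratic ::
  "'i set \<Rightarrow> ('i \<Rightarrow> real) \<Rightarrow> real \<Rightarrow> ('i \<Rightarrow> real) \<Rightarrow> ('i \<Rightarrow> real) \<Rightarrow> real" where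
  "gibbs_quadratic I \<pi> b a t =
     b * (2 * avg I \<pi> (\<lambda>i. a i * t i) + avg I \<pi> (\<lambda>i. (t i)\<^sup>2))
     - 2 * b\<^sup>2 * avg I \<pi> (\<lambda>i. (a i)\<^sup>2 * (t i)\<^sup>2) + 2 * b\<^sup>2 * (avg I \<pi> (\<lambda>i. a i * t i))\<^sup>2"

text \<open>
  With \<open>t = \<eta> z\<close> and \<open>\<eta> \<le> 1\<close>, the inequality \<open>2 |a| |z| \<le> a\<^sup>2 + z\<^sup>2\<close> gives \<open>|u| \<le> s D\<close> for \<open>s = b \<eta>\<close> and
  \<open>D = a\<^sup>2 + 2 z\<^sup>2\<close>. Powers of \<open>D\<close> and the factor \<open>exp (3 s D)\<close> are absorbed into \<open>exp (c D)\<close>. The terms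
  of degree three and four in \<open>t\<close> that the cumulant expansion still contains carry \<open>b\<^sup>2 \<eta>\<^sup>3 \<le> s\<^sup>3\<close>.
\<close>

lemma gibbs_expansion:
  fixes a t \<pi> :: "'i \<Rightarrow> real" and b \<eta> c :: real
  assumes w: "weights I \<pi>" and b: "1 \<le> b" and \<eta>: "0 < \<eta>" "\<eta> \<le> 1" and c: "0 < c" "6 * (b * \<eta>) \<le> c"
  defines "g \<equiv> - ln (avg I \<pi> (\<lambda>i. exp (- (b * (2 * a i * t i + (t i)\<^sup>2)))))"
    and "E \<equiv> avg I \<pi> (\<lambda>i. exp (c * ((a i)\<^sup>2 + 2 * (t i / \<eta>)\<^sup>2)))"
  shows "\<bar>g - gibbs_quadratic I \<pi> b a t\<bar> \<le> (1296 / c^3 + 10 / c\<^sup>2) * (b * \<eta>)^3 * E"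
    and "g\<^sup>2 \<le> 8 / c\<^sup>2 * (b * \<eta>)\<^sup>2 * E"
proof -
  define s where "s = b * \<eta>"
  define u where "u = (\<lambda>i. b * (2 * a i * t i + (t i)\<^sup>2))"
  define z where "z = (\<lambda>i. t i / \<eta>)"
  define D where "D = (\<lambda>i. (a i)\<^sup>2 + 2 * (z i)\<^sup>2)"
  have tz: "t i = \<eta> * z i" for i using \<eta> by (simp add: z_def)
  have s0: "0 < s" using b \<eta> by (simp add: s_def)
  have D0: "0 \<le> D i" for i by (simp add: D_def)
  have azD: "2 * (\<bar>a i\<bar> * \<bar>z i\<bar>) \<le> (a i)\<^sup>2 + (z i)\<^sup>2" for i
    using zero_le_power2[of "\<bar>a i\<bar> - \<bar>z i\<bar>"] by (simp add: power2_eq_square algebra_simps)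
  have azD': "\<bar>a i\<bar> * \<bar>z i\<bar> \<le> D i" "\<bar>a i * z i\<bar> \<le> D i" "(z i)\<^sup>2 \<le> D i" for i
    using azD[of i] mult_nonneg_nonneg[OF abs_ge_zero[of "a i"] abs_ge_zero[of "z i"]]
      zero_le_power2[of "z i"] zero_le_power2[of "a i"] unfolding D_def abs_mult by linarith+
  have uD: "\<bar>u i\<bar> \<le> s * D i" for i
  proof -
    have "\<bar>2 * a i * t i + (t i)\<^sup>2\<bar> \<le> \<eta> * (2 * (\<bar>a i\<bar> * \<bar>z i\<bar>)) + \<eta> * (\<eta> * (z i)\<^sup>2)"
      unfolding tz using \<eta> abs_triangle_ineq[of "2 * a i * (\<eta> * z i)" "(\<eta> * z i)\<^sup>2"]
      by (simp add: abs_mult power2_eq_square mult.assoc mult.left_commute)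
    also have "\<dots> \<le> \<eta> * ((a i)\<^sup>2 + (z i)\<^sup>2) + \<eta> * (1 * (z i)\<^sup>2)"
      using \<eta> azD[of i] by (intro add_mono mult_left_mono mult_right_mono) auto
    also have "\<dots> = \<eta> * D i" by (simp add: D_def algebra_simps)
    finally have "b * \<bar>2 * a i * t i + (t i)\<^sup>2\<bar> \<le> b * (\<eta> * D i)" using b by (intro mult_left_mono) auto
    then show ?thesis using b by (simp add: u_def s_def abs_mult mult.assoc)
  qed
  have E: "E = avg I \<pi> (\<lambda>i. exp (c * D i))" by (simp add: E_def D_def z_def)
  \<comment> \<open>Half of \<open>c\<close> pays for \<open>exp (3 s D)\<close>, the other half for the powers of \<open>D\<close>.\<close>
  have half: "exp (k * (s * D i)) \<le> exp (c / 2 * D i)" if "0 \<le> k" "k \<le> 3" for i k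
  proof -
    have "k * s \<le> 3 * s" using that s0 by (intro mult_right_mono) auto
    also have "\<dots> \<le> c / 2" using c by (simp add: s_def)
    finally have "k * s * D i \<le> c / 2 * D i" by (intro mult_right_mono D0)
    then show ?thesis by (simp add: mult.assoc)
  qed
  have Dk: "D i^k * exp (c / 2 * D i) \<le> (fact k / (c/2)^k) * exp (c * D i)" for i k
  proof -
    have "D i^k * exp (c / 2 * D i) \<le> ((fact k / (c/2)^k) * exp (c / 2 * D i)) * exp (c / 2 * D i)"
      using c by (intro mult_right_mono power_le_exp D0) auto
    also have "\<dots> = (fact k / (c/2)^k) * exp (c * D i)"
      by (simp add: mult.assoc flip: exp_add)
    finally show ?thesis .
  qed
  have gu: "g = - ln (avg I \<pi> (\<lambda>i. exp (- u i)))" by (simp add: g_def u_def)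
  show "g\<^sup>2 \<le> 8 / c\<^sup>2 * (b * \<eta>)\<^sup>2 * E"
  proof -
    have "g\<^sup>2 = \<bar>g\<bar>\<^sup>2" by simp
    also have "\<dots> \<le> (avg I \<pi> (\<lambda>i. \<bar>u i\<bar> * exp \<bar>u i\<bar>))\<^sup>2"
      unfolding gu by (intro power_mono neg_log_avg_exp_abs w) auto
    also have "\<dots> \<le> avg I \<pi> (\<lambda>i. (\<bar>u i\<bar> * exp \<bar>u i\<bar>)\<^sup>2)" by (rule avg_square_le[OF w])
    also have "\<dots> \<le> avg I \<pi> (\<lambda>i. (8 / c\<^sup>2 * s\<^sup>2) * exp (c * D i))"
    proof (intro avg_mono w)
      fix i
      have "(\<bar>u i\<bar> * exp \<bar>u i\<bar>)\<^sup>2 = \<bar>u i\<bar>\<^sup>2 * exp (2 * \<bar>u i\<bar>)"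
        by (simp add: power_mult_distrib exp_double)
      also have "\<dots> \<le> (s * D i)\<^sup>2 * exp (2 * (s * D i))"
        using uD[of i] by (intro mult_mono power_mono) auto
      also have "\<dots> \<le> (s * D i)\<^sup>2 * exp (c / 2 * D i)"
        by (intro mult_left_mono half) auto
      also have "\<dots> = s\<^sup>2 * (D i^2 * exp (c / 2 * D i))" by (simp add: power_mult_distrib)
      also have "\<dots> \<le> s\<^sup>2 * ((fact 2 / (c/2)^2) * exp (c * D i))" by (intro mult_left_mono Dk) auto
      also have "\<dots> = (8 / c\<^sup>2 * s\<^sup>2) * exp (c * D i)" by (simp add: power2_eq_square)
      finally show "(\<bar>u i\<bar> * exp \<bar>u i\<bar>)\<^sup>2 \<le> (8 / c\<^sup>2 * s\<^sup>2) * exp (c * D i)" .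
    qed
    finally show ?thesis unfolding E avg_cmult s_def .
  qed
  define q where "q = avg I \<pi> u - avg I \<pi> (\<lambda>i. (u i)\<^sup>2) / 2 + (avg I \<pi> u)\<^sup>2 / 2"
  have 1: "\<bar>g - q\<bar> \<le> (1296 / c^3) * s^3 * E"
  proof -
    have "\<bar>g - q\<bar> \<le> 27 * avg I \<pi> (\<lambda>i. \<bar>u i\<bar>^3 * exp (3 * \<bar>u i\<bar>))"
      unfolding gu q_def by (rule neg_log_avg_exp_expansion[OF w])
    also have "avg I \<pi> (\<lambda>i. \<bar>u i\<bar>^3 * exp (3 * \<bar>u i\<bar>)) \<le> avg I \<pi> (\<lambda>i. (48 / c^3 * s^3) * exp (c * D i))"
    proof (intro avg_mono w)
      fix i
      have "\<bar>u i\<bar>^3 * exp (3 * \<bar>u i\<bar>) \<le> (s * D i)^3 * exp (3 * (s * D i))"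
        using uD[of i] by (intro mult_mono power_mono) auto
      also have "\<dots> \<le> (s * D i)^3 * exp (c / 2 * D i)"
        using s0 D0 by (intro mult_left_mono half) auto
      also have "\<dots> = s^3 * (D i^3 * exp (c / 2 * D i))" by (simp add: power_mult_distrib)
      also have "\<dots> \<le> s^3 * ((fact 3 / (c/2)^3) * exp (c * D i))" using s0 by (intro mult_left_mono Dk) auto
      also have "\<dots> = (48 / c^3 * s^3) * exp (c * D i)" by (simp add: power3_eq_cube fact_numeral)
      finally show "\<bar>u i\<bar>^3 * exp (3 * \<bar>u i\<bar>) \<le> (48 / c^3 * s^3) * exp (c * D i)" .
    qed
    finally show ?thesis unfolding E avg_cmult by simp
  qed
  have 2: "\<bar>q - gibbs_quadratic I \<pi> b a t\<bar> \<le> (10 / c\<^sup>2) * s^3 * E"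
  proof -
    define Mat where "Mat = avg I \<pi> (\<lambda>i. a i * t i)"
    define Mtt where "Mtt = avg I \<pi> (\<lambda>i. (t i)\<^sup>2)"
    define Maatt where "Maatt = avg I \<pi> (\<lambda>i. (a i)\<^sup>2 * (t i)\<^sup>2)"
    define Mattt where "Mattt = avg I \<pi> (\<lambda>i. a i * t i ^ 3)"
    define Mtttt where "Mtttt = avg I \<pi> (\<lambda>i. t i ^ 4)"
    define D2 where "D2 = avg I \<pi> (\<lambda>i. (D i)\<^sup>2)"
    have U: "avg I \<pi> u = b * (2 * Mat + Mtt)"
      unfolding u_def Mat_def Mtt_def avg_cmult avg_add
      by (simp add: avg_cmult mult.assoc)
    have "(\<lambda>i. (u i)\<^sup>2) = (\<lambda>i. b\<^sup>2 * (4 * ((a i)\<^sup>2 * (t i)\<^sup>2) + (4 * (a i * t i ^ 3) + t i ^ 4)))"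
      by (auto simp: u_def power2_eq_square power3_eq_cube power4_eq_xxxx algebra_simps)
    then have V: "avg I \<pi> (\<lambda>i. (u i)\<^sup>2) = b\<^sup>2 * (4 * Maatt + 4 * Mattt + Mtttt)"
      unfolding Maatt_def Mattt_def Mtttt_def by (simp add: avg_cmult avg_add)
    have split: "q - gibbs_quadratic I \<pi> b a t
        = b\<^sup>2 * (- 2 * Mattt - Mtttt / 2 + 2 * (Mat * Mtt) + Mtt\<^sup>2 / 2)"
      unfolding q_def U V gibbs_quadratic_def Mat_def[symmetric] Mtt_def[symmetric] Maatt_def[symmetric]
      by (simp add: power2_eq_square field_simps)
    have b1: "\<bar>Mattt\<bar> \<le> \<eta>^3 * D2"
      unfolding Mattt_def D2_def avg_cmult[symmetric]
    proof (intro avg_abs w)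
      fix i
      have "\<bar>a i * t i ^ 3\<bar> = \<eta>^3 * ((\<bar>a i\<bar> * \<bar>z i\<bar>) * (z i)\<^sup>2)"
        unfolding tz using \<eta> by (simp add: abs_mult power_mult_distrib power3_eq_cube power2_eq_square power_abs)
      also have "\<dots> \<le> \<eta>^3 * (D i * D i)"
        using azD'[of i] \<eta> D0 by (intro mult_left_mono mult_mono) auto
      finally show "\<bar>a i * t i ^ 3\<bar> \<le> \<eta>^3 * (D i)\<^sup>2" by (simp add: power2_eq_square)
    qed
    have b2: "\<bar>Mtttt\<bar> \<le> \<eta>^3 * D2"
      unfolding Mtttt_def D2_def avg_cmult[symmetric]
    proof (intro avg_abs w)
      fix i
      have "\<bar>t i ^ 4\<bar> = t i ^ 4" by simp
      also have "\<dots> = \<eta>^4 * ((z i)\<^sup>2 * (z i)\<^sup>2)"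
        unfolding tz by (simp add: power_mult_distrib power4_eq_xxxx power2_eq_square)
      also have "\<dots> \<le> \<eta>^3 * (D i * D i)"
        using \<eta> D0 by (intro mult_mono power_decreasing) (auto simp: D_def)
      finally show "\<bar>t i ^ 4\<bar> \<le> \<eta>^3 * (D i)\<^sup>2" by (simp add: power2_eq_square)
    qed
    have c1: "\<bar>Mat\<bar> \<le> \<eta> * avg I \<pi> D"
      unfolding Mat_def avg_cmult[symmetric]
    proof (intro avg_abs w)
      fix i show "\<bar>a i * t i\<bar> \<le> \<eta> * D i"
        unfolding tz using \<eta> azD'(2)[of i] by (simp add: abs_mult mult.left_commute)
    qed
    have c2: "\<bar>Mtt\<bar> \<le> \<eta>\<^sup>2 * avg I \<pi> D"
      unfolding Mtt_def avg_cmult[symmetric]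
    proof (intro avg_abs w)
      fix i show "\<bar>(t i)\<^sup>2\<bar> \<le> \<eta>\<^sup>2 * D i"
        unfolding tz using \<eta> azD'(3)[of i] by (simp add: power_mult_distrib mult_left_mono)
    qed
    have mD: "0 \<le> avg I \<pi> D" by (intro avg_nonneg w D0)
    have D2_nonneg: "0 \<le> D2" unfolding D2_def by (intro avg_nonneg w) simp
    have DD: "(avg I \<pi> D)\<^sup>2 \<le> D2" unfolding D2_def by (rule avg_square_le[OF w])
    have b3: "\<bar>Mat * Mtt\<bar> \<le> \<eta>^3 * D2"
    proof -
      have "\<bar>Mat * Mtt\<bar> \<le> (\<eta> * avg I \<pi> D) * (\<eta>\<^sup>2 * avg I \<pi> D)"
        unfolding abs_mult using c1 c2 \<eta> mD by (intro mult_mono) auto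
      also have "\<dots> = \<eta>^3 * (avg I \<pi> D)\<^sup>2" by (simp add: power2_eq_square power3_eq_cube)
      also have "\<dots> \<le> \<eta>^3 * D2" using DD \<eta> by (intro mult_left_mono) auto
      finally show ?thesis .
    qed
    have b4: "\<bar>Mtt\<^sup>2\<bar> \<le> \<eta>^3 * D2"
    proof -
      have "\<bar>Mtt\<^sup>2\<bar> = \<bar>Mtt\<bar>\<^sup>2" by simp
      also have "\<dots> \<le> (\<eta>\<^sup>2 * avg I \<pi> D)\<^sup>2" using c2 by (intro power_mono) auto
      also have "\<dots> = \<eta>^4 * (avg I \<pi> D)\<^sup>2" by (simp add: power_mult_distrib)
      also have "\<dots> \<le> \<eta>^3 * D2" using DD \<eta> by (intro mult_mono power_decreasing) auto
      finally show ?thesis .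
    qed
    have "\<bar>- 2 * Mattt - Mtttt / 2 + 2 * (Mat * Mtt) + Mtt\<^sup>2 / 2\<bar> \<le> 5 * (\<eta>^3 * D2)"
      using b1 b2 b3 b4 by linarith
    then have "b\<^sup>2 * \<bar>- 2 * Mattt - Mtttt / 2 + 2 * (Mat * Mtt) + Mtt\<^sup>2 / 2\<bar> \<le> b\<^sup>2 * (5 * (\<eta>^3 * D2))"
      by (rule mult_left_mono) simp
    then have "\<bar>q - gibbs_quadratic I \<pi> b a t\<bar> \<le> b\<^sup>2 * (5 * (\<eta>^3 * D2))"
      unfolding split by (simp add: abs_mult)
    also have "b\<^sup>2 * (5 * (\<eta>^3 * D2)) \<le> b^3 * (5 * (\<eta>^3 * D2))"
      using b \<eta> D2_nonneg by (intro mult_right_mono power_increasing) auto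
    finally have "\<bar>q - gibbs_quadratic I \<pi> b a t\<bar> \<le> b^3 * (5 * (\<eta>^3 * D2))" .
    also have "\<dots> = 5 * s^3 * D2" by (simp add: s_def power_mult_distrib)
    also have "\<dots> \<le> 5 * s^3 * ((2 / c\<^sup>2) * E)"
    proof (intro mult_left_mono)
      show "D2 \<le> (2 / c\<^sup>2) * E" unfolding D2_def E avg_cmult[symmetric]
        using power_le_exp[OF D0 c(1), of _ 2] by (intro avg_mono w) simp
    qed (use s0 in auto)
    finally show ?thesis by simp
  qed
  have "\<bar>g - gibbs_quadratic I \<pi> b a t\<bar> \<le> \<bar>g - q\<bar> + \<bar>q - gibbs_quadratic I \<pi> b a t\<bar>" by linarith
  also have "\<dots> \<le> (1296 / c^3 + 10 / c\<^sup>2) * s^3 * E" using 1 2 by (simp only: distrib_right)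
  finally show "\<bar>g - gibbs_quadratic I \<pi> b a t\<bar> \<le> (1296 / c^3 + 10 / c\<^sup>2) * (b * \<eta>)^3 * E"
    unfolding s_def .
qed

section \<open>Exchanging one block\<close>

text \<open>
  For \<open>s > 0\<close> this says that the Orlicz norm of \<open>Z\<close> for \<open>exp(x\<^sup>2) - 1\<close> is at most \<open>1 / \<surd>s\<close>. The parameter \<open>s\<close> is
  kept inside the exponential because it is this exponential moment that enters the estimates.
\<close>

definition sq_exp_bounded :: "'a measure \<Rightarrow> real \<Rightarrow> ('a \<Rightarrow> real) \<Rightarrow> bool" where
  "sq_exp_bounded Q s Z \<longleftrightarrow> Z \<in> borel_measurable Q \<and>
     integrable Q (\<lambda>x. exp (s * (Z x)\<^sup>2)) \<and> (\<integral>x. exp (s * (Z x)\<^sup>2) \<partial>Q) \<le> 2"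

lemma sq_exp_boundedD:
  assumes "sq_exp_bounded Q s Z"
  shows "Z \<in> borel_measurable Q" "integrable Q (\<lambda>x. exp (s * (Z x)\<^sup>2))" "(\<integral>x. exp (s * (Z x)\<^sup>2) \<partial>Q) \<le> 2"
  using assms by (auto simp: sq_exp_bounded_def)

lemma sq_exp_bounded_integrable_mult:
  assumes "sq_exp_bounded Q s Z" "sq_exp_bounded Q s Y" "0 < s"
  shows "integrable Q (\<lambda>x. Z x * Y x)"
proof (rule Bochner_Integration.integrable_bound)
  show "integrable Q (\<lambda>x. (exp (s * (Z x)\<^sup>2) + exp (s * (Y x)\<^sup>2)) / s)"
    by (intro integrable_divide_zero Bochner_Integration.integrable_add impI sq_exp_boundedD(2) assms)
  show "(\<lambda>x. Z x * Y x) \<in> borel_measurable Q"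
    using sq_exp_boundedD(1)[OF assms(1)] sq_exp_boundedD(1)[OF assms(2)] by measurable
  show "AE x in Q. norm (Z x * Y x) \<le> norm ((exp (s * (Z x)\<^sup>2) + exp (s * (Y x)\<^sup>2)) / s)"
  proof (intro always_eventually allI)
    fix x
    have sq: "s * y\<^sup>2 \<le> exp (s * y\<^sup>2)" for y :: real using exp_ge_add_one_self[of "s * y\<^sup>2"] by linarith
    have "0 \<le> (\<bar>Z x\<bar> - \<bar>Y x\<bar>)\<^sup>2" by simp
    then have "2 * \<bar>Z x * Y x\<bar> \<le> (Z x)\<^sup>2 + (Y x)\<^sup>2" by (simp add: power2_eq_square algebra_simps abs_mult)
    then have "\<bar>Z x * Y x\<bar> \<le> (Z x)\<^sup>2 + (Y x)\<^sup>2" using abs_ge_zero[of "Z x * Y x"] by linarith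
    then have "s * \<bar>Z x * Y x\<bar> \<le> s * ((Z x)\<^sup>2 + (Y x)\<^sup>2)" using assms(3) by (intro mult_left_mono) auto
    also have "\<dots> \<le> exp (s * (Z x)\<^sup>2) + exp (s * (Y x)\<^sup>2)" using sq[of "Z x"] sq[of "Y x"] by (simp add: distrib_left)
    finally have "\<bar>Z x * Y x\<bar> \<le> (exp (s * (Z x)\<^sup>2) + exp (s * (Y x)\<^sup>2)) / s"
      using assms(3) by (simp add: field_simps)
    then show "norm (Z x * Y x) \<le> norm ((exp (s * (Z x)\<^sup>2) + exp (s * (Y x)\<^sup>2)) / s)"
      unfolding real_norm_def by linarith
  qed
qed

lemma (in prob_space) sq_exp_bounded_integrable:
  assumes "sq_exp_bounded M s Z" "0 < s"
  shows "integrable M Z"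
proof -
  have "integrable M (\<lambda>x. (Z x)\<^sup>2)"
    using sq_exp_bounded_integrable_mult[OF assms(1,1,2)] by (simp add: power2_eq_square)
  then show ?thesis using square_integrable_imp_integrable sq_exp_boundedD(1)[OF assms(1)] by blast
qed

definition C11_bounds :: "(real \<Rightarrow> real) \<Rightarrow> (real \<Rightarrow> real) \<Rightarrow> real \<Rightarrow> real \<Rightarrow> real \<Rightarrow> bool" where
  "C11_bounds \<psi> \<psi>' B0 B1 \<Lambda> \<longleftrightarrow> \<psi> \<in> borel_measurable borel \<and> (\<forall>x. \<bar>\<psi> x\<bar> \<le> B0) \<and> (\<forall>x. \<bar>\<psi>' x\<bar> \<le> B1) \<and>
     (\<forall>x y. \<bar>\<psi> y - \<psi> x - \<psi>' x * (y - x)\<bar> \<le> \<Lambda> * (y - x)\<^sup>2)"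

text \<open>
  The cost of one exchange with \<open>s = b \<eta>\<close>. The first term is the third-order remainder of the soft minimum,
  the second the square of its change, which a test function with Lipschitz derivative sees.
\<close>

definition step_error :: "real \<Rightarrow> real \<Rightarrow> real \<Rightarrow> real \<Rightarrow> real \<Rightarrow> real" where
  "step_error B1 \<Lambda> c \<beta> s = B1 * (1296 / c^3 + 10 / c\<^sup>2) * s^3 / \<beta> + \<Lambda> * (8 / c\<^sup>2) * s\<^sup>2 / \<beta>\<^sup>2"

definition gibbs_quadratic_mean ::
  "'i set \<Rightarrow> ('i \<Rightarrow> real) \<Rightarrow> real \<Rightarrow> ('i \<Rightarrow> real) \<Rightarrow> ('i \<Rightarrow> 'i \<Rightarrow> real) \<Rightarrow> real" where
  "gibbs_quadratic_mean I \<pi> b a \<Gamma> =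
     b * avg I \<pi> (\<lambda>i. \<Gamma> i i) - 2 * b\<^sup>2 * avg I \<pi> (\<lambda>i. (a i)\<^sup>2 * \<Gamma> i i)
     + 2 * b\<^sup>2 * (\<Sum>i\<in>I. \<Sum>j\<in>I. \<pi> i * a i * (\<pi> j * a j) * \<Gamma> i j)"

lemma has_bochner_integral_gibbs_quadratic:
  assumes m: "\<And>i. i \<in> I \<Longrightarrow> has_bochner_integral Q (t i) 0"
    and v: "\<And>i j. i \<in> I \<Longrightarrow> j \<in> I \<Longrightarrow> has_bochner_integral Q (\<lambda>x. t i x * t j x) (\<Gamma> i j)"
  shows "has_bochner_integral Q (\<lambda>x. gibbs_quadratic I \<pi> b a (\<lambda>i. t i x)) (gibbs_quadratic_mean I \<pi> b a \<Gamma>)"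
proof -
  have v': "has_bochner_integral Q (\<lambda>x. (t i x)\<^sup>2) (\<Gamma> i i)" if "i \<in> I" for i
    using v[OF that that] by (simp add: power2_eq_square)
  have 1: "has_bochner_integral Q (\<lambda>x. avg I \<pi> (\<lambda>i. a i * t i x)) (\<Sum>i\<in>I. \<pi> i * (a i * 0))"
    unfolding avg_def by (intro has_bochner_integral_sum has_bochner_integral_mult_right m)
  have 2: "has_bochner_integral Q (\<lambda>x. avg I \<pi> (\<lambda>i. (t i x)\<^sup>2)) (avg I \<pi> (\<lambda>i. \<Gamma> i i))"
    unfolding avg_def by (intro has_bochner_integral_sum has_bochner_integral_mult_right v')
  have 3: "has_bochner_integral Q (\<lambda>x. avg I \<pi> (\<lambda>i. (a i)\<^sup>2 * (t i x)\<^sup>2)) (avg I \<pi> (\<lambda>i. (a i)\<^sup>2 * \<Gamma> i i))"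
    unfolding avg_def by (intro has_bochner_integral_sum has_bochner_integral_mult_right v')
  have "(\<lambda>x. (avg I \<pi> (\<lambda>i. a i * t i x))\<^sup>2) = (\<lambda>x. \<Sum>i\<in>I. \<Sum>j\<in>I. \<pi> i * a i * (\<pi> j * a j) * (t i x * t j x))"
    unfolding avg_def power2_eq_square sum_product by (intro ext sum.cong refl) (simp add: mult_ac)
  then have 4: "has_bochner_integral Q (\<lambda>x. (avg I \<pi> (\<lambda>i. a i * t i x))\<^sup>2) (\<Sum>i\<in>I. \<Sum>j\<in>I. \<pi> i * a i * (\<pi> j * a j) * \<Gamma> i j)"
    by (simp only:) (intro has_bochner_integral_sum has_bochner_integral_mult_right v)
  have "has_bochner_integral Q (\<lambda>x. gibbs_quadratic I \<pi> b a (\<lambda>i. t i x))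
     (b * (2 * (\<Sum>i\<in>I. \<pi> i * (a i * 0)) + avg I \<pi> (\<lambda>i. \<Gamma> i i)) - 2 * b\<^sup>2 * avg I \<pi> (\<lambda>i. (a i)\<^sup>2 * \<Gamma> i i)
     + 2 * b\<^sup>2 * (\<Sum>i\<in>I. \<Sum>j\<in>I. \<pi> i * a i * (\<pi> j * a j) * \<Gamma> i j))"
    unfolding gibbs_quadratic_def
    by (intro has_bochner_integral_add has_bochner_integral_diff has_bochner_integral_mult_right 1 2 3 4)
  then show ?thesis by (simp add: gibbs_quadratic_mean_def)
qed

text \<open>
  The law of the block enters the approximation only through the covariances \<open>\<Gamma>\<close> of the linear forms
  \<open>t\<^sub>i\<close>. Hence two centred laws with the same \<open>\<Gamma>\<close> give integrals that differ by at most twice the bound. The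
  average in the bound is taken with the weights \<open>w\<close>, without the factor \<open>exp (- b a\<^sup>2)\<close>.
\<close>

lemma block_taylor:
  fixes t :: "'i \<Rightarrow> 'a \<Rightarrow> real" and a w :: "'i \<Rightarrow> real"
  assumes Q: "prob_space Q" and I: "finite I" "I \<noteq> {}" and w: "\<And>i. i \<in> I \<Longrightarrow> 0 < w i"
    and b: "1 \<le> b" and \<eta>: "0 < \<eta>" "\<eta> \<le> 1" and c: "0 < c" "6 * (b * \<eta>) \<le> c" and \<beta>: "0 < \<beta>"
    and sg: "\<And>i. i \<in> I \<Longrightarrow> sq_exp_bounded Q (2 * c / \<eta>\<^sup>2) (t i)"
    and mean: "\<And>i. i \<in> I \<Longrightarrow> (\<integral>x. t i x \<partial>Q) = 0"
    and cov: "\<And>i j. i \<in> I \<Longrightarrow> j \<in> I \<Longrightarrow> (\<integral>x. t i x * t j x \<partial>Q) = \<Gamma> i j"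
    and \<psi>: "C11_bounds \<psi> \<psi>' B0 B1 \<Lambda>"
  defines "Z0 \<equiv> \<Sum>i\<in>I. w i * exp (- b * (a i)\<^sup>2)"
  defines "f0 \<equiv> - (ln Z0 / \<beta>)" and "\<pi> \<equiv> \<lambda>i. w i * exp (- b * (a i)\<^sup>2) / Z0"
  shows "\<bar>(\<integral>x. \<psi> (- (ln (\<Sum>i\<in>I. w i * exp (- b * (a i + t i x)\<^sup>2)) / \<beta>)) \<partial>Q)
           - (\<psi> f0 + \<psi>' f0 / \<beta> * gibbs_quadratic_mean I \<pi> b a \<Gamma>)\<bar>
     \<le> step_error B1 \<Lambda> c \<beta> (b * \<eta>) * (2 * ((\<Sum>i\<in>I. w i * exp (c * (a i)\<^sup>2)) / (\<Sum>i\<in>I. w i)))"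
    (is "\<bar>(\<integral>x. \<psi> (?f x) \<partial>Q) - _\<bar> \<le> ?se * (2 * ?A)")
proof -
  interpret prob_space Q by (rule Q)
  have [measurable]: "\<psi> \<in> borel_measurable borel" using \<psi> by (simp add: C11_bounds_def)
  have [measurable]: "\<And>i. i \<in> I \<Longrightarrow> t i \<in> borel_measurable Q" using sg sq_exp_boundedD(1) by blast
  have s: "0 < 2 * c / \<eta>\<^sup>2" using c \<eta> by simp
  have Z0: "0 < Z0" unfolding Z0_def using I w by (intro sum_pos) auto
  have wt: "weights I \<pi>"
    unfolding weights_def
  proof (intro conjI ballI)
    show "sum \<pi> I = 1" unfolding \<pi>_def sum_divide_distrib[symmetric] Z0_def[symmetric] using Z0 by simp
  qed (use I w Z0 in \<open>auto simp: \<pi>_def less_imp_le\<close>)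
  have B1: "0 \<le> B1" using \<psi> abs_ge_zero order_trans unfolding C11_bounds_def by blast
  have \<Lambda>: "0 \<le> \<Lambda>"
  proof -
    have "\<bar>\<psi> 1 - \<psi> 0 - \<psi>' 0 * (1 - 0)\<bar> \<le> \<Lambda> * (1 - 0)\<^sup>2" using \<psi> unfolding C11_bounds_def by blast
    then show ?thesis using abs_ge_zero[of "\<psi> 1 - \<psi> 0 - \<psi>' 0 * (1 - 0)"] by simp
  qed
  define u where "u = (\<lambda>x i. b * (2 * a i * t i x + (t i x)\<^sup>2))"
  define g where "g = (\<lambda>x. - ln (avg I \<pi> (\<lambda>i. exp (- u x i))))"
  define q where "q = (\<lambda>x. gibbs_quadratic I \<pi> b a (\<lambda>i. t i x))"
  define E where "E = (\<lambda>x. avg I \<pi> (\<lambda>i. exp (c * ((a i)\<^sup>2 + 2 * (t i x / \<eta>)\<^sup>2))))"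
  \<comment> \<open>\<open>f0\<close> is the soft minimum without the block and \<open>g / \<beta>\<close> the change caused by the block.\<close>
  have f: "?f x = f0 + g x / \<beta>" for x
  proof -
    have "(\<Sum>i\<in>I. w i * exp (- b * (a i + t i x)\<^sup>2)) = Z0 * avg I \<pi> (\<lambda>i. exp (- u x i))"
      unfolding avg_def sum_distrib_left \<pi>_def u_def using Z0
      by (intro sum.cong refl) (simp add: power2_eq_square algebra_simps flip: exp_add)
    moreover have "0 < avg I \<pi> (\<lambda>i. exp (- u x i))"
      unfolding avg_def \<pi>_def using I w Z0 by (intro sum_pos) auto
    ultimately show ?thesis using Z0 \<beta> by (simp add: ln_mult f0_def g_def add_divide_distrib diff_divide_distrib)
  qed
  have exps: "\<bar>g x - q x\<bar> \<le> (1296 / c^3 + 10 / c\<^sup>2) * (b * \<eta>)^3 * E x"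
    "(g x)\<^sup>2 \<le> 8 / c\<^sup>2 * (b * \<eta>)\<^sup>2 * E x" for x
    unfolding g_def q_def E_def u_def by (rule gibbs_expansion[OF wt b \<eta> c])+
  have pt: "\<bar>\<psi> (?f x) - (\<psi> f0 + \<psi>' f0 / \<beta> * q x)\<bar> \<le> ?se * E x" for x
  proof -
    have "\<bar>\<psi> (?f x) - \<psi> f0 - \<psi>' f0 * (g x / \<beta>)\<bar> \<le> \<Lambda> * (g x / \<beta>)\<^sup>2"
      using \<psi> unfolding C11_bounds_def f by (metis add_diff_cancel_left')
    moreover have "\<Lambda> * (g x / \<beta>)\<^sup>2 \<le> \<Lambda> * (8 / c\<^sup>2 * (b * \<eta>)\<^sup>2 * E x) / \<beta>\<^sup>2"
      unfolding power_divide times_divide_eq_right by (intro divide_right_mono mult_left_mono exps(2) \<Lambda>) simp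
    moreover have "\<bar>\<psi>' f0 * ((g x - q x) / \<beta>)\<bar> \<le> B1 * ((1296 / c^3 + 10 / c\<^sup>2) * (b * \<eta>)^3 * E x / \<beta>)"
      unfolding abs_mult abs_divide using exps(1)[of x] \<psi> B1 \<beta>
      by (intro mult_mono) (auto simp: C11_bounds_def intro!: divide_right_mono)
    moreover have "?se * E x = B1 * ((1296 / c^3 + 10 / c\<^sup>2) * (b * \<eta>)^3 * E x / \<beta>) + \<Lambda> * (8 / c\<^sup>2 * (b * \<eta>)\<^sup>2 * E x) / \<beta>\<^sup>2"
      by (simp add: step_error_def distrib_right mult.assoc)
    moreover have "\<psi>' f0 * ((g x - q x) / \<beta>) = \<psi>' f0 * (g x / \<beta>) - \<psi>' f0 / \<beta> * q x"
      by (simp add: diff_divide_distrib right_diff_distrib)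
    ultimately show ?thesis by linarith
  qed
  have Eeq: "E x = (\<Sum>i\<in>I. \<pi> i * (exp (c * (a i)\<^sup>2) * exp (2 * c / \<eta>\<^sup>2 * (t i x)\<^sup>2)))" for x
    unfolding E_def avg_def by (intro sum.cong refl) (simp add: power_divide distrib_left flip: exp_add)
  have intE: "integrable Q E"
    unfolding Eeq[abs_def] by (intro Bochner_Integration.integrable_sum Bochner_Integration.integrable_mult_right sq_exp_boundedD(2) sg)
  have "(\<integral>x. E x \<partial>Q) = (\<Sum>i\<in>I. \<integral>x. \<pi> i * (exp (c * (a i)\<^sup>2) * exp (2 * c / \<eta>\<^sup>2 * (t i x)\<^sup>2)) \<partial>Q)"
    unfolding Eeq
    by (intro Bochner_Integration.integral_sum Bochner_Integration.integrable_mult_right sq_exp_boundedD(2) sg)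
  also have "\<dots> = (\<Sum>i\<in>I. \<pi> i * (exp (c * (a i)\<^sup>2) * (\<integral>x. exp (2 * c / \<eta>\<^sup>2 * (t i x)\<^sup>2) \<partial>Q)))"
    by simp
  also have "\<dots> \<le> (\<Sum>i\<in>I. \<pi> i * (exp (c * (a i)\<^sup>2) * 2))"
    using wt sg by (intro sum_mono mult_left_mono sq_exp_boundedD(3)) (auto simp: weights_def)
  also have "\<dots> = 2 * ((\<Sum>i\<in>I. w i * exp (- b * (a i)\<^sup>2) * exp (c * (a i)\<^sup>2)) / Z0)"
    by (simp add: \<pi>_def sum_distrib_left sum_divide_distrib mult_ac)
  also have "\<dots> \<le> 2 * ?A"
  proof -
    have "(\<Sum>i\<in>I. w i * exp (- b * (a i)\<^sup>2) * exp (c * (a i)\<^sup>2)) * (\<Sum>i\<in>I. w i)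
       \<le> Z0 * (\<Sum>i\<in>I. w i * exp (c * (a i)\<^sup>2))"
      unfolding Z0_def using w b c I by (intro avg_antitone_reweight) (auto simp: less_imp_le)
    moreover have "0 < (\<Sum>i\<in>I. w i)" using I w by (intro sum_pos) auto
    ultimately show ?thesis using Z0 by (simp add: field_simps)
  qed
  finally have EA: "(\<integral>x. E x \<partial>Q) \<le> 2 * ?A" .
  have se: "0 \<le> ?se" unfolding step_error_def using B1 \<Lambda> b \<eta> c \<beta> by auto
  have intq: "has_bochner_integral Q q (gibbs_quadratic_mean I \<pi> b a \<Gamma>)"
    unfolding q_def
  proof (rule has_bochner_integral_gibbs_quadratic)
    show "has_bochner_integral Q (t i) 0" if "i \<in> I" for i
      using sq_exp_bounded_integrable[OF sg[OF that] s] mean[OF that] has_bochner_integral_integrable by metis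
    show "has_bochner_integral Q (\<lambda>x. t i x * t j x) (\<Gamma> i j)" if "i \<in> I" "j \<in> I" for i j
      using sq_exp_bounded_integrable_mult[OF sg[OF that(1)] sg[OF that(2)] s] cov[OF that] has_bochner_integral_integrable by metis
  qed
  have int\<psi>: "integrable Q (\<lambda>x. \<psi> (?f x))"
    by (rule integrable_const_bound[of _ B0]) (use \<psi> in \<open>auto simp: C11_bounds_def\<close>)
  have "integrable Q q" using intq by (rule integrable.intros)
  then have intL: "integrable Q (\<lambda>x. \<psi> f0 + \<psi>' f0 / \<beta> * q x)" by auto
  have diff: "(\<integral>x. \<psi> (?f x) \<partial>Q) - (\<psi> f0 + \<psi>' f0 / \<beta> * gibbs_quadratic_mean I \<pi> b a \<Gamma>)
    = (\<integral>x. \<psi> (?f x) - (\<psi> f0 + \<psi>' f0 / \<beta> * q x) \<partial>Q)"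
    using int\<psi> intL \<open>integrable Q q\<close> has_bochner_integral_integral_eq[OF intq] by (simp add: prob_space)
  define h where "h = (\<lambda>x. \<psi> (?f x) - (\<psi> f0 + \<psi>' f0 / \<beta> * q x))"
  define e where "e = ?se"
  have inth: "integrable Q h" unfolding h_def by (rule Bochner_Integration.integrable_diff[OF int\<psi> intL])
  have "\<bar>\<integral>x. h x \<partial>Q\<bar> \<le> (\<integral>x. \<bar>h x\<bar> \<partial>Q)" by (rule integral_abs_bound)
  also have "\<dots> \<le> (\<integral>x. e * E x \<partial>Q)"
  proof (rule integral_mono)
    show "integrable Q (\<lambda>x. \<bar>h x\<bar>)" using inth by (rule integrable_abs)
    show "integrable Q (\<lambda>x. e * E x)" using intE by simp
    show "\<bar>h x\<bar> \<le> e * E x" for x unfolding h_def e_def by (rule pt)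
  qed
  also have "\<dots> = e * (\<integral>x. E x \<partial>Q)" by simp
  also have "\<dots> \<le> e * (2 * ?A)" using EA se unfolding e_def by (rule mult_left_mono)
  finally show ?thesis unfolding diff h_def e_def .
qed

section \<open>Lindeberg exchange on product spaces\<close>

lemma sq_exp_bounded_distr:
  assumes "f \<in> measurable M N" "Z \<in> borel_measurable N"
  shows "sq_exp_bounded (distr M N f) s Z \<longleftrightarrow> sq_exp_bounded M s (\<lambda>x. Z (f x))"
proof -
  have [measurable]: "f \<in> measurable M N" "Z \<in> borel_measurable N" by fact+
  show ?thesis by (simp add: sq_exp_bounded_def integrable_distr_eq integral_distr)
qed

text \<open>
  The mixed product laws between \<open>Q0\<close> and \<open>Q1\<close> through which Lindeberg's argument passes.
\<close>

definition hybrid :: "('k \<Rightarrow> 'a measure) \<Rightarrow> ('k \<Rightarrow> 'a measure) \<Rightarrow> 'k set \<Rightarrow> 'k \<Rightarrow> 'a measure" where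
  "hybrid Q0 Q1 J = (\<lambda>k. if k \<in> J then Q1 k else Q0 k)"

text \<open>
  Fubini for one coordinate. The product locales want a probability measure at every index; outside
  the index set a point mass is used.
\<close>

lemma integral_PiM_insert:
  fixes F :: "('k \<Rightarrow> 'a) \<Rightarrow> real"
  assumes K: "finite K" "k \<notin> K" and q: "\<And>j. j \<in> insert k K \<Longrightarrow> prob_space (q j)"
    and F: "F \<in> borel_measurable (PiM (insert k K) q)" "\<And>x. \<bar>F x\<bar> \<le> B"
  shows "(\<integral>x. F x \<partial>PiM (insert k K) q) = (\<integral>w. (\<integral>y. F (w(k := y)) \<partial>q k) \<partial>PiM K q)"
    and "integrable (PiM K q) (\<lambda>w. \<integral>y. F (w(k := y)) \<partial>q k)"
proof -
  define q' where "q' = (\<lambda>j. if j \<in> insert k K then q j else return (count_space UNIV) undefined)"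
  have q': "prob_space (q' j)" for j using q by (auto simp: q'_def intro!: prob_space_return)
  interpret product_prob_space q' by (rule product_prob_spaceI) (rule q')
  have eq: "PiM (insert k K) q = PiM (insert k K) q'" "PiM K q = PiM K q'" "q k = q' k"
    by (auto simp: q'_def intro!: PiM_cong)
  have [measurable]: "F \<in> borel_measurable (PiM (insert k K) q')" using F(1) by (simp add: eq)
  interpret PI: prob_space "PiM (insert k K) q'" by (rule prob_space_PiM) (rule q')
  interpret PK: prob_space "PiM K q'" by (rule prob_space_PiM) (rule q')
  interpret Qk: prob_space "q' k" by (rule q')
  have "integrable (PiM (insert k K) q') F" by (rule PI.integrable_const_bound[of _ B]) (use F(2) in auto)
  from product_integral_insert[OF K this]
  show "(\<integral>x. F x \<partial>PiM (insert k K) q) = (\<integral>w. (\<integral>y. F (w(k := y)) \<partial>q k) \<partial>PiM K q)"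
    unfolding eq .
  have upd: "(\<lambda>(w, y). w(k := y)) \<in> measurable (PiM K q' \<Otimes>\<^sub>M q' k) (PiM (insert k K) q')"
    by (rule measurable_add_dim)
  have m: "(\<lambda>w. \<integral>y. F (w(k := y)) \<partial>q' k) \<in> borel_measurable (PiM K q')"
  proof (rule sigma_finite_measure.borel_measurable_lebesgue_integral[OF prob_space_imp_sigma_finite[OF q']])
    show "(\<lambda>(w, y). F (w(k := y))) \<in> borel_measurable (PiM K q' \<Otimes>\<^sub>M q' k)"
      using measurable_compose[OF upd, of F borel] by (simp add: case_prod_beta)
  qed
  have "\<bar>\<integral>y. F (w(k := y)) \<partial>q' k\<bar> \<le> B" for w
  proof -
    have "\<bar>\<integral>y. F (w(k := y)) \<partial>q' k\<bar> \<le> (\<integral>y. \<bar>F (w(k := y))\<bar> \<partial>q' k)" by (rule integral_abs_bound)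
    also have "\<dots> \<le> (\<integral>y. B \<partial>q' k)"
      using F(2) order_trans[OF abs_ge_zero F(2)] by (intro integral_mono') auto
    finally show ?thesis by (simp add: prob_space.prob_space[OF q'])
  qed
  then have "integrable (PiM K q') (\<lambda>w. \<integral>y. F (w(k := y)) \<partial>q' k)"
    by (intro PK.integrable_const_bound[of _ B] m) auto
  then show "integrable (PiM K q) (\<lambda>w. \<integral>y. F (w(k := y)) \<partial>q k)" unfolding eq .
qed

text \<open>
  Lindeberg's telescoping sum. Two consecutive mixed laws differ in one coordinate, which is integrated
  first.
\<close>

lemma PiM_telescope:
  fixes F :: "('k \<Rightarrow> 'a) \<Rightarrow> real"
  assumes I: "finite I" and Q: "\<And>k. k \<in> I \<Longrightarrow> prob_space (Q0 k)" "\<And>k. k \<in> I \<Longrightarrow> prob_space (Q1 k)"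
    and sets_eq: "\<And>k. k \<in> I \<Longrightarrow> sets (Q1 k) = sets (Q0 k)"
    and F: "F \<in> borel_measurable (PiM I Q0)" "\<And>x. \<bar>F x\<bar> \<le> B"
    and step: "\<And>k J. k \<in> I \<Longrightarrow> J \<subseteq> I - {k} \<Longrightarrow>
       \<bar>\<integral>w. (\<integral>y. F (w(k := y)) \<partial>Q0 k) - (\<integral>y. F (w(k := y)) \<partial>Q1 k) \<partial>PiM (I - {k}) (hybrid Q0 Q1 J)\<bar> \<le> \<epsilon> k"
  shows "\<bar>(\<integral>x. F x \<partial>PiM I Q0) - (\<integral>x. F x \<partial>PiM I Q1)\<bar> \<le> (\<Sum>k\<in>I. \<epsilon> k)"
proof -
  let ?H = "\<lambda>J. \<integral>x. F x \<partial>PiM I (hybrid Q0 Q1 J)"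
  have setsH: "sets (PiM K (hybrid Q0 Q1 J)) = sets (PiM K Q0)" if "K \<subseteq> I" for J K
    using that sets_eq by (intro sets_PiM_cong) (auto simp: hybrid_def)
  have "\<bar>?H {} - ?H J\<bar> \<le> (\<Sum>k\<in>J. \<epsilon> k)" if "J \<subseteq> I" for J
    using finite_subset[OF that I] that
  proof (induction J rule: finite_induct)
    case (insert k J)
    then have k: "k \<in> I" "J \<subseteq> I - {k}" by auto
    have Ik: "insert k (I - {k}) = I" using k by auto
    have 1: "?H L = (\<integral>w. (\<integral>y. F (w(k := y)) \<partial>hybrid Q0 Q1 L k) \<partial>PiM (I - {k}) (hybrid Q0 Q1 L))"
      "integrable (PiM (I - {k}) (hybrid Q0 Q1 L)) (\<lambda>w. \<integral>y. F (w(k := y)) \<partial>hybrid Q0 Q1 L k)" for L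
    proof -
      have "F \<in> borel_measurable (PiM (insert k (I - {k})) (hybrid Q0 Q1 L))"
        unfolding Ik using F(1) by (simp add: measurable_cong_sets[OF setsH refl])
      from integral_PiM_insert[OF _ _ _ this F(2)] 
      show "?H L = (\<integral>w. (\<integral>y. F (w(k := y)) \<partial>hybrid Q0 Q1 L k) \<partial>PiM (I - {k}) (hybrid Q0 Q1 L))"
       "integrable (PiM (I - {k}) (hybrid Q0 Q1 L)) (\<lambda>w. \<integral>y. F (w(k := y)) \<partial>hybrid Q0 Q1 L k)"
        using I Q k unfolding Ik by (auto simp: hybrid_def)
    qed
    have same: "PiM (I - {k}) (hybrid Q0 Q1 (insert k J)) = PiM (I - {k}) (hybrid Q0 Q1 J)"
      by (intro PiM_cong) (auto simp: hybrid_def)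
    have hk: "hybrid Q0 Q1 J k = Q0 k" "hybrid Q0 Q1 (insert k J) k = Q1 k"
      using k by (auto simp: hybrid_def)
    have "?H J - ?H (insert k J) = (\<integral>w. (\<integral>y. F (w(k := y)) \<partial>Q0 k) - (\<integral>y. F (w(k := y)) \<partial>Q1 k) \<partial>PiM (I - {k}) (hybrid Q0 Q1 J))"
      using 1[of J] 1[of "insert k J"] unfolding same hk by (simp add: Bochner_Integration.integral_diff)
    then have "\<bar>?H J - ?H (insert k J)\<bar> \<le> \<epsilon> k" using step[OF k] by simp
    then show ?case using insert by simp
  qed simp
  from this[of I] have "\<bar>?H {} - ?H I\<bar> \<le> (\<Sum>k\<in>I. \<epsilon> k)" by simp
  moreover have "PiM I (hybrid Q0 Q1 {}) = PiM I Q0" "PiM I (hybrid Q0 Q1 I) = PiM I Q1"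
    by (auto simp: hybrid_def intro!: PiM_cong)
  ultimately show ?thesis by simp
qed

text \<open>
  A sum over \<open>J\<close> has the same law under every product measure with these factors on \<open>J\<close>. Thus the part of a
  mixed row that stems from one design inherits the bound that holds for the pure design.
\<close>

lemma sq_exp_bounded_marginal:
  fixes t :: "'k \<Rightarrow> 'a \<Rightarrow> real"
  assumes K: "finite K" "J \<subseteq> K" and P: "finite P" "J \<subseteq> P"
    and q: "\<And>j. j \<in> K \<Longrightarrow> prob_space (q j)" and r: "\<And>j. j \<in> P \<Longrightarrow> prob_space (r j)"
    and eq: "\<And>j. j \<in> J \<Longrightarrow> q j = r j"
    and t: "\<And>j. j \<in> J \<Longrightarrow> t j \<in> borel_measurable (q j)"
    and bd: "sq_exp_bounded (PiM P r) s (\<lambda>x. \<Sum>j\<in>J. t j (x j))"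
  shows "sq_exp_bounded (PiM K q) s (\<lambda>x. \<Sum>j\<in>J. t j (x j))"
proof -
  have restr: "sq_exp_bounded (PiM J q) s (\<lambda>x. \<Sum>j\<in>J. t j (x j)) \<longleftrightarrow>
      sq_exp_bounded (PiM L p) s (\<lambda>x. \<Sum>j\<in>J. t j (x j))"
    if L: "finite L" "J \<subseteq> L" and p: "\<And>j. j \<in> L \<Longrightarrow> prob_space (p j)" and pq: "\<And>j. j \<in> J \<Longrightarrow> p j = q j" for L p
  proof -
    define p' where "p' = (\<lambda>j. if j \<in> L then p j else return (count_space UNIV) undefined)"
    have p': "prob_space (p' j)" for j using p by (auto simp: p'_def intro!: prob_space_return)
    interpret product_prob_space p' by (rule product_prob_spaceI) (rule p')
    have pe: "PiM L p = PiM L p'" "PiM J q = PiM J p'"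
      using L pq by (auto simp: p'_def intro!: PiM_cong)
    have [measurable]: "(\<lambda>x. \<Sum>j\<in>J. t j (x j)) \<in> borel_measurable (PiM J p')"
    proof (intro borel_measurable_sum)
      fix j assume j: "j \<in> J"
      then have "t j \<in> borel_measurable (p' j)" using t pq L by (auto simp: p'_def)
      then show "(\<lambda>x. t j (x j)) \<in> borel_measurable (PiM J p')"
        using j by (intro measurable_compose[OF measurable_component_singleton])
    qed
    have d: "PiM J p' = distr (PiM L p') (PiM J p') (\<lambda>x. restrict x J)"
      using distr_restrict[OF L(2,1)] .
    have "sq_exp_bounded (PiM J p') s (\<lambda>x. \<Sum>j\<in>J. t j (x j)) \<longleftrightarrow>
        sq_exp_bounded (distr (PiM L p') (PiM J p') (\<lambda>x. restrict x J)) s (\<lambda>x. \<Sum>j\<in>J. t j (x j))"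
      using d by simp
    also have "\<dots> \<longleftrightarrow> sq_exp_bounded (PiM L p') s (\<lambda>x. \<Sum>j\<in>J. t j (restrict x J j))"
      by (rule sq_exp_bounded_distr) (auto intro!: measurable_restrict_subset L)
    finally show ?thesis unfolding pe by simp
  qed
  show ?thesis using restr[OF P r] restr[OF K q] eq bd by auto
qed

text \<open>
  Splits the residual of a mixed row into its two pure parts and the noise. The last step is
  \<open>X Y \<le> (X\<^sup>2 + Y\<^sup>2) / 2\<close>, so that each term of the bound involves one of the two designs only.
\<close>

lemma sq_exp_three:
  fixes x y z c :: real assumes "0 \<le> c"
  shows "exp (c * (x + y - z)\<^sup>2) \<le> exp (3 * c * z\<^sup>2) * ((exp (6 * c * x\<^sup>2) + exp (6 * c * y\<^sup>2)) / 2)"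
proof -
  have "3 * (x\<^sup>2 + y\<^sup>2 + z\<^sup>2) - (x + y - z)\<^sup>2 = (x - y)\<^sup>2 + (x + z)\<^sup>2 + (y + z)\<^sup>2"
    by (simp add: power2_eq_square algebra_simps)
  moreover have "0 \<le> (x - y)\<^sup>2 + (x + z)\<^sup>2 + (y + z)\<^sup>2" by simp
  ultimately have "(x + y - z)\<^sup>2 \<le> 3 * (x\<^sup>2 + y\<^sup>2 + z\<^sup>2)" by linarith
  then have "c * (x + y - z)\<^sup>2 \<le> c * (3 * (x\<^sup>2 + y\<^sup>2 + z\<^sup>2))" using assms by (rule mult_left_mono)
  then have "exp (c * (x + y - z)\<^sup>2) \<le> exp (3 * c * z\<^sup>2 + (3 * c * x\<^sup>2 + 3 * c * y\<^sup>2))" by (simp add: algebra_simps)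
  also have "\<dots> = exp (3 * c * z\<^sup>2) * (exp (3 * c * x\<^sup>2) * exp (3 * c * y\<^sup>2))" by (simp add: exp_add)
  also have "\<dots> \<le> exp (3 * c * z\<^sup>2) * ((exp (6 * c * x\<^sup>2) + exp (6 * c * y\<^sup>2)) / 2)"
  proof (intro mult_left_mono)
    let ?X = "exp (3 * c * x\<^sup>2)" and ?Y = "exp (3 * c * y\<^sup>2)"
    have "0 \<le> (?X - ?Y)\<^sup>2" by simp
    moreover have "?X\<^sup>2 = exp (6 * c * x\<^sup>2)" "?Y\<^sup>2 = exp (6 * c * y\<^sup>2)" by (simp_all add: power2_eq_square flip: exp_add)
    ultimately show "?X * ?Y \<le> (exp (6 * c * x\<^sup>2) + exp (6 * c * y\<^sup>2)) / 2"
      by (simp add: power2_eq_square algebra_simps)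
  qed simp
  finally show ?thesis .
qed

text \<open>
  The index set \<open>P\<close> is the set of blocks, \<open>t i k\<close> is the contribution of block \<open>k\<close> to the linear form
  \<open>i\<close>, and the weights \<open>w\<close> collect the penalty and all other rows. The bound is uniform in \<open>w\<close>, which is
  what makes the exchange of the rows a mere telescoping afterwards.
\<close>

lemma row_exchange:
  fixes t :: "'i \<Rightarrow> 'k \<Rightarrow> 'a \<Rightarrow> real" and w :: "'i \<Rightarrow> real" and \<zeta> :: real
  assumes P: "finite P" and Q: "\<And>k. k \<in> P \<Longrightarrow> prob_space (Q0 k)" "\<And>k. k \<in> P \<Longrightarrow> prob_space (Q1 k)"
    and sets_eq: "\<And>k. k \<in> P \<Longrightarrow> sets (Q1 k) = sets (Q0 k)"
    and I: "finite I" "I \<noteq> {}" and w: "\<And>i. i \<in> I \<Longrightarrow> 0 < w i"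
    and b: "1 \<le> b" and \<eta>: "\<And>k. k \<in> P \<Longrightarrow> 0 < \<eta> k" "\<And>k. k \<in> P \<Longrightarrow> \<eta> k \<le> 1"
    and c: "0 < c" "\<And>k. k \<in> P \<Longrightarrow> 6 * (b * \<eta> k) \<le> c" and \<beta>: "0 < \<beta>"
    and block: "\<And>i k. i \<in> I \<Longrightarrow> k \<in> P \<Longrightarrow> sq_exp_bounded (Q0 k) (2 * c / (\<eta> k)\<^sup>2) (t i k)"
      "\<And>i k. i \<in> I \<Longrightarrow> k \<in> P \<Longrightarrow> sq_exp_bounded (Q1 k) (2 * c / (\<eta> k)\<^sup>2) (t i k)"
    and mean: "\<And>i k. i \<in> I \<Longrightarrow> k \<in> P \<Longrightarrow> (\<integral>x. t i k x \<partial>Q0 k) = 0"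
      "\<And>i k. i \<in> I \<Longrightarrow> k \<in> P \<Longrightarrow> (\<integral>x. t i k x \<partial>Q1 k) = 0"
    and cov: "\<And>i j k. i \<in> I \<Longrightarrow> j \<in> I \<Longrightarrow> k \<in> P \<Longrightarrow>
        (\<integral>x. t i k x * t j k x \<partial>Q0 k) = (\<integral>x. t i k x * t j k x \<partial>Q1 k)"
    and row: "\<And>i J. i \<in> I \<Longrightarrow> J \<subseteq> P \<Longrightarrow> sq_exp_bounded (PiM P Q0) (6 * c) (\<lambda>x. \<Sum>k\<in>J. t i k (x k))"
      "\<And>i J. i \<in> I \<Longrightarrow> J \<subseteq> P \<Longrightarrow> sq_exp_bounded (PiM P Q1) (6 * c) (\<lambda>x. \<Sum>k\<in>J. t i k (x k))"
    and \<psi>: "C11_bounds \<psi> \<psi>' B0 B1 \<Lambda>"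
  defines "F \<equiv> \<lambda>x. \<psi> (- (ln (\<Sum>i\<in>I. w i * exp (- b * ((\<Sum>k\<in>P. t i k (x k)) - \<zeta>)\<^sup>2)) / \<beta>))"
  shows "\<bar>(\<integral>x. F x \<partial>PiM P Q0) - (\<integral>x. F x \<partial>PiM P Q1)\<bar>
     \<le> (\<Sum>k\<in>P. step_error B1 \<Lambda> c \<beta> (b * \<eta> k) * (8 * exp (3 * c * \<zeta>\<^sup>2)))"
proof (rule PiM_telescope[where B = B0])
  have [measurable]: "\<psi> \<in> borel_measurable borel" using \<psi> by (simp add: C11_bounds_def)
  have tm: "(\<lambda>x. t i k (x k)) \<in> borel_measurable (PiM P Q0)" if "i \<in> I" "k \<in> P" for i k
    using sq_exp_boundedD(1)[OF block(1)[OF that]] that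
    by (intro measurable_compose[OF measurable_component_singleton])
  have [measurable]: "(\<lambda>x. \<Sum>k\<in>P. t i k (x k)) \<in> borel_measurable (PiM P Q0)" if "i \<in> I" for i
    using tm that by (intro borel_measurable_sum)
  show "F \<in> borel_measurable (PiM P Q0)" unfolding F_def by measurable
  show "\<bar>F x\<bar> \<le> B0" for x using \<psi> by (simp add: F_def C11_bounds_def)
  fix k J assume k: "k \<in> P" and J: "J \<subseteq> P - {k}"
  let ?K = "P - {k}" let ?H = "PiM (P - {k}) (hybrid Q0 Q1 J)"
  define a where "a = (\<lambda>x i. (\<Sum>j\<in>?K. t i j (x j)) - \<zeta>)"
  define A where "A = (\<lambda>x. (\<Sum>i\<in>I. w i * exp (c * (a x i)\<^sup>2)) / (\<Sum>i\<in>I. w i))"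
  define se where "se = step_error B1 \<Lambda> c \<beta> (b * \<eta> k)"
  have W: "0 < (\<Sum>i\<in>I. w i)" using I w by (intro sum_pos) auto
  have pt: "\<bar>(\<integral>y. F (x(k := y)) \<partial>Q0 k) - (\<integral>y. F (x(k := y)) \<partial>Q1 k)\<bar> \<le> se * (4 * A x)" for x
  proof -
    have Fx: "F (x(k := y)) = \<psi> (- (ln (\<Sum>i\<in>I. w i * exp (- b * (a x i + t i k y)\<^sup>2)) / \<beta>))" for y
    proof -
      have "(\<Sum>j\<in>P. t i j ((x(k := y)) j)) = t i k y + (\<Sum>j\<in>?K. t i j (x j))" for i
        unfolding sum.remove[OF P k] by (auto intro!: sum.cong)
      then show ?thesis unfolding F_def a_def by (simp add: algebra_simps)
    qed
    note T = block_taylor[where I = I and w = w and a = "a x" and t = "\<lambda>i. t i k" and \<Gamma> = "\<lambda>i j. (\<integral>y. t i k y * t j k y \<partial>Q0 k)",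
        OF _ I w b \<eta>(1)[OF k] \<eta>(2)[OF k] c(1) c(2)[OF k] \<beta> _ _ _ \<psi>]
    let ?T = "\<lambda>Q. \<bar>(\<integral>y. \<psi> (- (ln (\<Sum>i\<in>I. w i * exp (- b * (a x i + t i k y)\<^sup>2)) / \<beta>)) \<partial>Q)
       - (\<psi> (- (ln (\<Sum>i\<in>I. w i * exp (- b * (a x i)\<^sup>2)) / \<beta>)) +
          \<psi>' (- (ln (\<Sum>i\<in>I. w i * exp (- b * (a x i)\<^sup>2)) / \<beta>)) / \<beta> *
          gibbs_quadratic_mean I (\<lambda>i. w i * exp (- b * (a x i)\<^sup>2) / (\<Sum>i\<in>I. w i * exp (- b * (a x i)\<^sup>2)))
             b (a x) (\<lambda>i j. (\<integral>y. t i k y * t j k y \<partial>Q0 k)))\<bar> \<le> se * (2 * A x)"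
    have "?T (Q0 k)" unfolding se_def A_def by (rule T) (use Q block mean k in auto)
    moreover have "?T (Q1 k)" unfolding se_def A_def by (rule T) (use Q block mean cov k in auto)
    ultimately show ?thesis unfolding Fx by linarith
  qed
  have hprob: "prob_space (hybrid Q0 Q1 J j)" if "j \<in> ?K" for j
    using that Q by (auto simp: hybrid_def)
  interpret H: prob_space ?H
    by (intro prob_space_PiM hprob)
  have tj: "t i j \<in> borel_measurable (hybrid Q0 Q1 J j)" if "i \<in> I" "j \<in> ?K" for i j
    using that sq_exp_boundedD(1)[OF block(1)] sq_exp_boundedD(1)[OF block(2)] by (auto simp: hybrid_def)
  \<comment> \<open>\<open>a\<close> is the residual of a mixed row without the block \<open>k\<close>: \<open>S1\<close> is the part already exchanged.\<close>
  have exp_a: "integrable ?H (\<lambda>x. exp (c * (a x i)\<^sup>2)) \<and> (\<integral>x. exp (c * (a x i)\<^sup>2) \<partial>?H) \<le> 2 * exp (3 * c * \<zeta>\<^sup>2)"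
    if i: "i \<in> I" for i
  proof -
    define S0 where "S0 = (\<lambda>x. \<Sum>j\<in>?K - J. t i j (x j))"
    define S1 where "S1 = (\<lambda>x. \<Sum>j\<in>J. t i j (x j))"
    have S0: "sq_exp_bounded ?H (6 * c) S0"
      unfolding S0_def
    proof (rule sq_exp_bounded_marginal[where P = P and r = Q0])
      show "finite ?K" "finite P" "?K - J \<subseteq> ?K" "?K - J \<subseteq> P" using P J by auto
      show "prob_space (hybrid Q0 Q1 J j)" if "j \<in> ?K" for j using that by (rule hprob)
      show "prob_space (Q0 j)" if "j \<in> P" for j using that by (rule Q)
      show "hybrid Q0 Q1 J j = Q0 j" if "j \<in> ?K - J" for j using that by (simp add: hybrid_def)
      show "t i j \<in> borel_measurable (hybrid Q0 Q1 J j)" if "j \<in> ?K - J" for j using that J by (intro tj i) auto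
      show "sq_exp_bounded (PiM P Q0) (6 * c) (\<lambda>x. \<Sum>j\<in>?K - J. t i j (x j))" using J by (intro row i) auto
    qed
    have S1: "sq_exp_bounded ?H (6 * c) S1"
      unfolding S1_def
    proof (rule sq_exp_bounded_marginal[where P = P and r = Q1])
      show "finite ?K" "finite P" "J \<subseteq> ?K" "J \<subseteq> P" using P J by auto
      show "prob_space (hybrid Q0 Q1 J j)" if "j \<in> ?K" for j using that by (rule hprob)
      show "prob_space (Q1 j)" if "j \<in> P" for j using that by (rule Q)
      show "hybrid Q0 Q1 J j = Q1 j" if "j \<in> J" for j using that by (simp add: hybrid_def)
      show "t i j \<in> borel_measurable (hybrid Q0 Q1 J j)" if "j \<in> J" for j using that J by (intro tj i) auto
      show "sq_exp_bounded (PiM P Q1) (6 * c) (\<lambda>x. \<Sum>j\<in>J. t i j (x j))" using J by (intro row i) auto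
    qed
    have [measurable]: "S0 \<in> borel_measurable ?H" "S1 \<in> borel_measurable ?H"
      using S0 S1 sq_exp_boundedD(1) by blast+
    have aS: "a x i = S0 x + S1 x - \<zeta>" for x
    proof -
      have "(\<Sum>j\<in>?K. t i j (x j)) = S0 x + S1 x"
        unfolding S0_def S1_def using P J by (intro sum.subset_diff) auto
      then show ?thesis by (simp add: a_def)
    qed
    let ?R = "\<lambda>x. exp (3 * c * \<zeta>\<^sup>2) * ((exp (6 * c * (S0 x)\<^sup>2) + exp (6 * c * (S1 x)\<^sup>2)) / 2)"
    have le: "exp (c * (a x i)\<^sup>2) \<le> ?R x" for x
      unfolding aS using c(1) by (intro sq_exp_three) simp
    have intR: "integrable ?H ?R"
      by (intro Bochner_Integration.integrable_mult_right integrable_divide Bochner_Integration.integrable_add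
          sq_exp_boundedD(2) S0 S1)
    have int: "integrable ?H (\<lambda>x. exp (c * (a x i)\<^sup>2))"
    proof (rule Bochner_Integration.integrable_bound[OF intR])
      show "(\<lambda>x. exp (c * (a x i)\<^sup>2)) \<in> borel_measurable ?H" unfolding aS by measurable
      show "AE x in ?H. norm (exp (c * (a x i)\<^sup>2)) \<le> norm (?R x)"
        using le by (intro always_eventually allI) (simp add: abs_of_pos add_pos_pos)
    qed
    have "(\<integral>x. exp (c * (a x i)\<^sup>2) \<partial>?H) \<le> (\<integral>x. ?R x \<partial>?H)" by (intro integral_mono int intR le)
    also have "\<dots> = exp (3 * c * \<zeta>\<^sup>2) * (((\<integral>x. exp (6 * c * (S0 x)\<^sup>2) \<partial>?H) + (\<integral>x. exp (6 * c * (S1 x)\<^sup>2) \<partial>?H)) / 2)"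
      using sq_exp_boundedD(2)[OF S0] sq_exp_boundedD(2)[OF S1] by simp
    also have "\<dots> \<le> exp (3 * c * \<zeta>\<^sup>2) * ((2 + 2) / 2)"
      using sq_exp_boundedD(3)[OF S0] sq_exp_boundedD(3)[OF S1] by (intro mult_left_mono divide_right_mono add_mono) auto
    finally show ?thesis using int by simp
  qed
  have intA: "integrable ?H A"
    unfolding A_def using exp_a by (intro integrable_divide Bochner_Integration.integrable_sum Bochner_Integration.integrable_mult_right) auto
  have "(\<integral>x. A x \<partial>?H) = (\<Sum>i\<in>I. w i * (\<integral>x. exp (c * (a x i)\<^sup>2) \<partial>?H)) / (\<Sum>i\<in>I. w i)"
    unfolding A_def using exp_a by (simp add: Bochner_Integration.integral_sum)
  also have "\<dots> \<le> (\<Sum>i\<in>I. w i * (2 * exp (3 * c * \<zeta>\<^sup>2))) / (\<Sum>i\<in>I. w i)"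
    using W exp_a w by (intro divide_right_mono sum_mono mult_left_mono) (auto simp: less_imp_le)
  also have "\<dots> = 2 * exp (3 * c * \<zeta>\<^sup>2)" using W by (simp add: sum_distrib_right[symmetric])
  finally have EA: "(\<integral>x. A x \<partial>?H) \<le> 2 * exp (3 * c * \<zeta>\<^sup>2)" .
  have A0: "0 \<le> A x" for x unfolding A_def using w W by (intro divide_nonneg_pos sum_nonneg) (auto simp: less_imp_le)
  have se0: "0 \<le> se"
  proof -
    obtain i where "i \<in> I" using I by auto
    have "0 \<le> se * (4 * A x)" for x using pt[of x] by linarith
    moreover have "0 < A x" for x unfolding A_def using I w W by (intro divide_pos_pos sum_pos) auto
    ultimately show ?thesis by (metis mult_pos_pos not_le zero_less_numeral zero_le_mult_iff)
  qed
  have "\<bar>\<integral>x. (\<integral>y. F (x(k := y)) \<partial>Q0 k) - (\<integral>y. F (x(k := y)) \<partial>Q1 k) \<partial>?H\<bar>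
      \<le> (\<integral>x. \<bar>(\<integral>y. F (x(k := y)) \<partial>Q0 k) - (\<integral>y. F (x(k := y)) \<partial>Q1 k)\<bar> \<partial>?H)"
    by (rule integral_abs_bound)
  also have "\<dots> \<le> (\<integral>x. se * (4 * A x) \<partial>?H)"
    using intA A0 se0 pt by (intro integral_mono') auto
  also have "\<dots> = se * (4 * (\<integral>x. A x \<partial>?H))" by simp
  also have "\<dots> \<le> se * (4 * (2 * exp (3 * c * \<zeta>\<^sup>2)))" using EA se0 by (intro mult_left_mono) auto
  finally show "\<bar>\<integral>x. (\<integral>y. F (x(k := y)) \<partial>Q0 k) - (\<integral>y. F (x(k := y)) \<partial>Q1 k) \<partial>?H\<bar>
      \<le> step_error B1 \<Lambda> c \<beta> (b * \<eta> k) * (8 * exp (3 * c * \<zeta>\<^sup>2))"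
    by (simp add: se_def)
qed (use P Q sets_eq in auto)

section \<open>Sub-Gaussian linear forms\<close>

lemma (in prob_space) sq_exp_bounded_iff_nn:
  assumes [measurable]: "Z \<in> borel_measurable M"
  shows "sq_exp_bounded M s Z \<longleftrightarrow> (\<integral>\<^sup>+\<omega>. ennreal (exp (s * (Z \<omega>)\<^sup>2)) \<partial>M) \<le> 2"
proof
  assume "sq_exp_bounded M s Z"
  note * = sq_exp_boundedD[OF this]
  have "(\<integral>\<^sup>+\<omega>. ennreal (exp (s * (Z \<omega>)\<^sup>2)) \<partial>M) = ennreal (\<integral>\<omega>. exp (s * (Z \<omega>)\<^sup>2) \<partial>M)"
    by (rule nn_integral_eq_integral[OF *(2)]) simp
  also have "\<dots> \<le> ennreal 2" using *(3) by (rule ennreal_leI)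
  finally show "(\<integral>\<^sup>+\<omega>. ennreal (exp (s * (Z \<omega>)\<^sup>2)) \<partial>M) \<le> 2" by simp
next
  assume le: "(\<integral>\<^sup>+\<omega>. ennreal (exp (s * (Z \<omega>)\<^sup>2)) \<partial>M) \<le> 2"
  have int: "integrable M (\<lambda>\<omega>. exp (s * (Z \<omega>)\<^sup>2))"
    by (rule integrableI_nonneg) (use le in \<open>auto intro: le_less_trans\<close>)
  have "ennreal (\<integral>\<omega>. exp (s * (Z \<omega>)\<^sup>2) \<partial>M) \<le> ennreal 2"
    using le nn_integral_eq_integral[OF int] by simp
  then have "(\<integral>\<omega>. exp (s * (Z \<omega>)\<^sup>2) \<partial>M) \<le> 2" by (subst (asm) ennreal_le_iff) auto
  then show "sq_exp_bounded M s Z" using int by (simp add: sq_exp_bounded_def)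
qed

text \<open>
  The norm is an infimum that may not be attained, and \<open>ennreal L\<close> is zero for negative \<open>L\<close>; the value
  \<open>|L| + 1\<close> lies strictly above it, hence above some admissible \<open>t\<close>.
\<close>

lemma (in prob_space) sq_exp_bounded_subgaussian_norm:
  assumes Z: "Z \<in> borel_measurable M" and L: "subgaussian_norm M Z \<le> ennreal L"
    and s: "s * (\<bar>L\<bar> + 1)\<^sup>2 \<le> 1"
  shows "sq_exp_bounded M s Z"
proof -
  have "subgaussian_norm M Z < ennreal (\<bar>L\<bar> + 1)"
    by (rule le_less_trans[OF L], rule ennreal_lessI) auto
  then obtain t where t: "0 < t" "ennreal t < ennreal (\<bar>L\<bar> + 1)"
      "(\<integral>\<^sup>+\<omega>. ennreal (exp ((Z \<omega>)\<^sup>2 / t\<^sup>2)) \<partial>M) \<le> 2"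
    unfolding subgaussian_norm_def Inf_less_iff by auto
  have tL: "t < \<bar>L\<bar> + 1" using t(1,2) by (metis ennreal_less_iff less_imp_le)
  have st: "s \<le> 1 / t\<^sup>2"
  proof (cases "0 \<le> s")
    case True
    have "s * t\<^sup>2 \<le> s * (\<bar>L\<bar> + 1)\<^sup>2" using True t(1) tL by (intro mult_left_mono power_mono) auto
    then have "s * t\<^sup>2 \<le> 1" using s by linarith
    then show ?thesis using t(1) by (simp add: field_simps)
  next
    case False
    then show ?thesis by (meson less_eq_real_def not_le order_trans zero_le_divide_1_iff zero_le_power2)
  qed
  have "(\<integral>\<^sup>+\<omega>. ennreal (exp (s * (Z \<omega>)\<^sup>2)) \<partial>M) \<le> (\<integral>\<^sup>+\<omega>. ennreal (exp ((Z \<omega>)\<^sup>2 / t\<^sup>2)) \<partial>M)"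
    using mult_right_mono[OF st, of "(Z _)\<^sup>2"] by (intro nn_integral_mono ennreal_leI) simp
  then show ?thesis using t(3) Z by (simp add: sq_exp_bounded_iff_nn)
qed

lemma (in prob_space) sq_exp_bounded_zero: "sq_exp_bounded M s (\<lambda>\<omega>. 0)"
  by (simp add: sq_exp_bounded_iff_nn emeasure_space_1)

lemma sq_exp_bounded_cmult: "sq_exp_bounded M s (\<lambda>\<omega>. r * Z \<omega>)" 
  if "sq_exp_bounded M (s * r\<^sup>2) Z"
  using that sq_exp_boundedD(1)[OF that] by (simp add: sq_exp_bounded_def power_mult_distrib mult.assoc)

lemma (in prob_space) sq_exp_bounded_subgaussian_vec_norm:
  assumes W: "\<And>j. j < p \<Longrightarrow> W j \<in> borel_measurable M" and L: "subgaussian_vec_norm M p W \<le> ennreal L"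
    and s: "s * (\<Sum>j<p. (v j)\<^sup>2) * (\<bar>L\<bar> + 1)\<^sup>2 \<le> 1"
  shows "sq_exp_bounded M s (\<lambda>\<omega>. \<Sum>j<p. v j * W j \<omega>)"
proof -
  define r where "r = L2_set v {..<p}"
  have r2: "r\<^sup>2 = (\<Sum>j<p. (v j)\<^sup>2)" by (simp add: r_def L2_set_def sum_nonneg)
  have r0: "0 \<le> r" by (simp add: r_def L2_set_nonneg)
  show ?thesis
  proof (cases "r = 0")
    case True
    then have "\<And>j. j < p \<Longrightarrow> v j = 0" using r2 by (simp add: sum_nonneg_eq_0_iff)
    then have "(\<lambda>\<omega>. \<Sum>j<p. v j * W j \<omega>) = (\<lambda>\<omega>. 0)" by auto
    then show ?thesis using sq_exp_bounded_zero by simp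
  next
    case False
    then have rp: "0 < r" using r0 by simp
    define u where "u = restrict (\<lambda>j. v j / r) {..<p}"
    have "L2_set u {..<p} = 1"
    proof -
      have "(\<Sum>j<p. (u j)\<^sup>2) = (\<Sum>j<p. (v j)\<^sup>2) / r\<^sup>2"
        unfolding sum_divide_distrib by (intro sum.cong) (auto simp: u_def power_divide)
      also have "\<dots> = 1" using rp by (simp flip: r2)
      finally show ?thesis by (simp add: L2_set_def)
    qed
    moreover have "u \<in> Rvec p" by (simp add: u_def Rvec_def)
    ultimately have "subgaussian_norm M (\<lambda>\<omega>. \<Sum>j<p. u j * W j \<omega>) \<le> subgaussian_vec_norm M p W"
      unfolding subgaussian_vec_norm_def by (intro SUP_upper) simp
    then have "subgaussian_norm M (\<lambda>\<omega>. \<Sum>j<p. u j * W j \<omega>) \<le> ennreal L" using L by (rule order_trans)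
    then have "sq_exp_bounded M (s * r\<^sup>2) (\<lambda>\<omega>. \<Sum>j<p. u j * W j \<omega>)"
      using W s unfolding r2 by (intro sq_exp_bounded_subgaussian_norm[of _ L]) auto
    then have "sq_exp_bounded M s (\<lambda>\<omega>. r * (\<Sum>j<p. u j * W j \<omega>))" by (rule sq_exp_bounded_cmult)
    also have "(\<lambda>\<omega>. r * (\<Sum>j<p. u j * W j \<omega>)) = (\<lambda>\<omega>. \<Sum>j<p. v j * W j \<omega>)"
      unfolding sum_distrib_left using rp by (intro ext sum.cong) (auto simp: u_def)
    finally show ?thesis .
  qed
qed

text \<open>
  The density of \<open>N(0, \<tau>\<^sup>2)\<close> times \<open>exp (x\<^sup>2 / (4 \<tau>\<^sup>2))\<close> is \<open>\<surd>2\<close> times the density of \<open>N(0, 2 \<tau>\<^sup>2)\<close>.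
\<close>

lemma (in prob_space) sq_exp_bounded_normal:
  assumes Z: "distributed M lborel Z (normal_density 0 \<tau>)" and \<tau>: "0 < \<tau>" and s: "4 * s * \<tau>\<^sup>2 \<le> 1"
  shows "sq_exp_bounded M s Z"
proof -
  have Zm: "Z \<in> borel_measurable M" using distributed_measurable[OF Z] by simp
  have "(\<integral>\<^sup>+\<omega>. ennreal (exp (s * (Z \<omega>)\<^sup>2)) \<partial>M)
      = (\<integral>\<^sup>+x. ennreal (normal_density 0 \<tau> x) * ennreal (exp (s * x\<^sup>2)) \<partial>lborel)"
    by (rule distributed_nn_integral[OF Z, symmetric]) simp
  also have "\<dots> \<le> (\<integral>\<^sup>+x. ennreal (sqrt 2) * ennreal (normal_density 0 (sqrt 2 * \<tau>) x) \<partial>lborel)"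
  proof (intro nn_integral_mono)
    fix x :: real
    have "s \<le> 1 / (4 * \<tau>\<^sup>2)" using s \<tau> by (simp add: field_simps)
    then have "s * x\<^sup>2 \<le> 1 / (4 * \<tau>\<^sup>2) * x\<^sup>2" by (rule mult_right_mono) simp
    then have "exp (- x\<^sup>2 / (2 * \<tau>\<^sup>2)) * exp (s * x\<^sup>2) \<le> exp (- x\<^sup>2 / (4 * \<tau>\<^sup>2))"
      using \<tau> by (simp flip: exp_add)
    then have "1 / sqrt (2 * pi * \<tau>\<^sup>2) * (exp (- x\<^sup>2 / (2 * \<tau>\<^sup>2)) * exp (s * x\<^sup>2))
        \<le> 1 / sqrt (2 * pi * \<tau>\<^sup>2) * exp (- x\<^sup>2 / (4 * \<tau>\<^sup>2))"
      by (rule mult_left_mono) simp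
    moreover have "sqrt 2 * normal_density 0 (sqrt 2 * \<tau>) x = 1 / sqrt (2 * pi * \<tau>\<^sup>2) * exp (- x\<^sup>2 / (4 * \<tau>\<^sup>2))"
    proof -
      have "sqrt (2 * pi * (sqrt 2 * \<tau>)\<^sup>2) = sqrt 2 * sqrt (2 * pi * \<tau>\<^sup>2)" "2 * (sqrt 2 * \<tau>)\<^sup>2 = 4 * \<tau>\<^sup>2"
        by (simp_all add: power_mult_distrib flip: real_sqrt_mult)
      then show ?thesis by (simp only: normal_density_def) simp
    qed
    ultimately have "normal_density 0 \<tau> x * exp (s * x\<^sup>2) \<le> sqrt 2 * normal_density 0 (sqrt 2 * \<tau>) x"
      by (simp add: normal_density_def mult.assoc)
    then show "ennreal (normal_density 0 \<tau> x) * ennreal (exp (s * x\<^sup>2))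
        \<le> ennreal (sqrt 2) * ennreal (normal_density 0 (sqrt 2 * \<tau>) x)"
      by (simp add: ennreal_mult[symmetric] ennreal_leI)
  qed
  also have "\<dots> = ennreal (sqrt 2)"
  proof -
    interpret N: prob_space "density lborel (\<lambda>x. ennreal (normal_density 0 (sqrt 2 * \<tau>) x))"
      using \<tau> by (intro prob_space_normal_density) simp
    have "(\<integral>\<^sup>+x. ennreal (normal_density 0 (sqrt 2 * \<tau>) x) \<partial>lborel) = 1"
      using N.emeasure_space_1 by (simp add: emeasure_density)
    then show ?thesis by (simp add: nn_integral_cmult)
  qed
  also have "\<dots> \<le> 2"
  proof -
    have "sqrt 2 \<le> (2::real)" by (rule real_le_lsqrt) auto
    then have "ennreal (sqrt 2) \<le> ennreal 2" by (rule ennreal_leI)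
    then show ?thesis by simp
  qed
  finally show ?thesis using Zm by (simp add: sq_exp_bounded_iff_nn)
qed

lemma (in prob_space) sq_exp_bounded_gaussian_vector:
  fixes p :: nat
  assumes ind: "indep_vars (\<lambda>_. borel) G {..<p}"
    and G: "\<And>j. j < p \<Longrightarrow> distributed M lborel (G j) (\<lambda>x. ennreal (std_normal_density x))"
    and s: "4 * s * (\<Sum>j<p. (v j)\<^sup>2) \<le> 1"
  shows "sq_exp_bounded M s (\<lambda>\<omega>. \<Sum>j<p. v j * G j \<omega>)"
proof -
  define J where "J = {j. j < p \<and> v j \<noteq> 0}"
  have J: "J \<subseteq> {..<p}" by (auto simp: J_def)
  have finJ: "finite J" using J by (rule finite_subset) simp
  have sumJ: "(\<lambda>\<omega>. \<Sum>j<p. v j * G j \<omega>) = (\<lambda>\<omega>. \<Sum>j\<in>J. v j * G j \<omega>)"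
    by (intro ext sum.mono_neutral_right) (auto simp: J_def)
  have sqJ: "(\<Sum>j<p. (v j)\<^sup>2) = (\<Sum>j\<in>J. (v j)\<^sup>2)"
    by (intro sum.mono_neutral_right) (auto simp: J_def)
  show ?thesis
  proof (cases "J = {}")
    case True
    then show ?thesis unfolding sumJ using sq_exp_bounded_zero by simp
  next
    case False
    have "indep_vars (\<lambda>_. borel) (\<lambda>j \<omega>. v j * G j \<omega>) J"
      using indep_vars_compose2[OF indep_vars_subset[OF ind J], of "\<lambda>j x. v j * x" "\<lambda>_. borel"] by simp
    moreover have "distributed M lborel (\<lambda>\<omega>. v j * G j \<omega>) (normal_density 0 \<bar>v j\<bar>)" if "j \<in> J" for j
      using normal_density_affine[of "G j" 0 1 "v j" 0] G[of j] that by (simp add: J_def)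
    ultimately have "distributed M lborel (\<lambda>\<omega>. \<Sum>j\<in>J. v j * G j \<omega>)
        (normal_density (\<Sum>j\<in>J. 0) (sqrt (\<Sum>j\<in>J. \<bar>v j\<bar>\<^sup>2)))"
      using finJ False by (intro sum_indep_normal) (auto simp: J_def)
    then have D: "distributed M lborel (\<lambda>\<omega>. \<Sum>j\<in>J. v j * G j \<omega>) (normal_density 0 (sqrt (\<Sum>j\<in>J. (v j)\<^sup>2)))"
      by simp
    have "0 < (\<Sum>j\<in>J. (v j)\<^sup>2)" using finJ False by (intro sum_pos) (auto simp: J_def)
    then show ?thesis unfolding sumJ
      using D s by (intro sq_exp_bounded_normal[OF D]) (auto simp: sqJ)
  qed
qed

section \<open>Exchanging one row\<close>

text \<open>
  What the exchange uses of a row, and what the rows of both designs have in common, with the same \<open>P\<close>,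
  \<open>l\<close> and \<open>\<tau>\<close>. The last conjunct says that \<open>\<Sum> v\<^sub>j A\<^sub>j\<close> has sub-Gaussian norm at most \<open>\<parallel>v\<parallel> / \<surd>\<tau>\<close>; it is
  stated with \<open>s\<close> and for all \<open>v\<close> so that \<open>v\<close> is not normalised.
\<close>

definition row_regular ::
  "'w measure \<Rightarrow> nat \<Rightarrow> nat set set \<Rightarrow> (nat \<Rightarrow> real) \<Rightarrow> real \<Rightarrow> (nat \<Rightarrow> 'w \<Rightarrow> real) \<Rightarrow> bool" where
  "row_regular M p P l \<tau> A \<longleftrightarrow> prob_space M \<and>
     prob_space.indep_vars M (\<lambda>B. vec_space B) (\<lambda>B. rand_vec B A) P \<and>
     (\<forall>j<p. A j \<in> borel_measurable M \<and> (\<integral>\<omega>. A j \<omega> \<partial>M) = 0) \<and>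
     (\<forall>j<p. \<forall>k<p. (\<integral>\<omega>. A j \<omega> * A k \<omega> \<partial>M) = (if j = k then l j else 0)) \<and>
     (\<forall>v s. 0 \<le> s \<longrightarrow> s * (\<Sum>j<p. (v j)\<^sup>2) \<le> \<tau> \<longrightarrow> sq_exp_bounded M s (\<lambda>\<omega>. \<Sum>j<p. v j * A j \<omega>))"

lemma row_regular_sub:
  assumes R: "row_regular M p P l \<tau> A" and s: "0 \<le> s" "s * (\<Sum>j\<in>B. (v j)\<^sup>2) \<le> \<tau>" and B: "B \<subseteq> {..<p}"
  shows "sq_exp_bounded M s (\<lambda>\<omega>. \<Sum>j\<in>B. v j * A j \<omega>)"
proof -
  let ?v = "\<lambda>j. if j \<in> B then v j else 0"
  have "(\<Sum>j<p. (?v j)\<^sup>2) = (\<Sum>j\<in>B. (v j)\<^sup>2)"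
    using B by (intro sum.mono_neutral_cong_right) auto
  moreover have "(\<lambda>\<omega>. \<Sum>j<p. ?v j * A j \<omega>) = (\<lambda>\<omega>. \<Sum>j\<in>B. v j * A j \<omega>)"
    using B by (intro ext sum.mono_neutral_cong_right) auto
  moreover have "sq_exp_bounded M s (\<lambda>\<omega>. \<Sum>j<p. ?v j * A j \<omega>)"
    using R s calculation(1) unfolding row_regular_def by auto
  ultimately show ?thesis by simp
qed

lemma row_regular_integrable:
  assumes R: "row_regular M p P l \<tau> A" and \<tau>: "0 < \<tau>" and jk: "j < p" "k < p"
  shows "integrable M (A j)" "integrable M (\<lambda>\<omega>. A j \<omega> * A k \<omega>)"
proof -
  interpret prob_space M using R by (simp add: row_regular_def)
  have sg: "sq_exp_bounded M \<tau> (A j)" if "j < p" for j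
    using row_regular_sub[OF R, where s = \<tau> and B = "{j}" and v = "\<lambda>_. 1"] \<tau> that by simp
  show "integrable M (A j)" by (rule sq_exp_bounded_integrable[OF sg[OF jk(1)] \<tau>])
  show "integrable M (\<lambda>\<omega>. A j \<omega> * A k \<omega>)" by (rule sq_exp_bounded_integrable_mult[OF sg[OF jk(1)] sg[OF jk(2)] \<tau>])
qed

text \<open>
  The abstract exchange applied to the blocks of a random row: the law of the vector of blocks is the
  product of their laws. The constant \<open>c\<close> is so small that the linear forms of a block, rescaled by
  \<open>\<eta> = \<surd>|B| h\<close>, and the linear forms of the row have the required exponential moments.
\<close>

lemma row_exchange_blocks:
  fixes \<Phi> :: "(nat \<Rightarrow> real) set" and \<zeta> :: real and A0 A1 :: "nat \<Rightarrow> 'w \<Rightarrow> real"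
  assumes R: "row_regular M0 p P l \<tau> A0" "row_regular M1 p P l \<tau> A1" and \<tau>: "0 < \<tau>"
    and P: "partition_on {..<p} P" and p: "0 < p"
    and \<Phi>: "finite \<Phi>" "\<Phi> \<noteq> {}" "\<And>\<phi>. \<phi> \<in> \<Phi> \<Longrightarrow> 0 < w \<phi>"
    and sup: "\<And>\<phi> j. \<phi> \<in> \<Phi> \<Longrightarrow> j < p \<Longrightarrow> \<bar>\<phi> j\<bar> \<le> h" and h: "0 < h"
    and norm: "\<And>\<phi>. \<phi> \<in> \<Phi> \<Longrightarrow> 6 * c * (\<Sum>j<p. (\<phi> j)\<^sup>2) \<le> \<tau>"
    and c: "0 < c" "2 * c \<le> \<tau>" and b: "1 \<le> b" and \<beta>: "0 < \<beta>"
    and d: "\<And>B. B \<in> P \<Longrightarrow> card B \<le> d" and small: "sqrt d * h \<le> 1" "6 * (b * (sqrt d * h)) \<le> c"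
    and \<psi>: "C11_bounds \<psi> \<psi>' B0 B1 \<Lambda>"
  defines "F \<equiv> \<lambda>y. \<psi> (- (ln (\<Sum>\<phi>\<in>\<Phi>. w \<phi> * exp (- b * ((\<Sum>j<p. y j * \<phi> j) - \<zeta>)\<^sup>2)) / \<beta>))"
  shows "\<bar>(\<integral>\<omega>. F (\<lambda>j. A0 j \<omega>) \<partial>M0) - (\<integral>\<omega>. F (\<lambda>j. A1 j \<omega>) \<partial>M1)\<bar>
     \<le> (\<Sum>B\<in>P. step_error B1 \<Lambda> c \<beta> (b * (sqrt (card B) * h)) * (8 * exp (3 * c * \<zeta>\<^sup>2)))"
proof -
  define t where "t = (\<lambda>(\<phi> :: nat \<Rightarrow> real) B (y :: nat \<Rightarrow> real). \<Sum>j\<in>B. y j * \<phi> j)"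
  define Q where "Q = (\<lambda>M A B. distr M (vec_space B) (rand_vec B (A :: nat \<Rightarrow> 'w \<Rightarrow> real)))"
  define \<eta> where "\<eta> = (\<lambda>B :: nat set. sqrt (card B) * h)"
  define H where "H = (\<lambda>x. \<psi> (- (ln (\<Sum>\<phi>\<in>\<Phi>. w \<phi> * exp (- b * ((\<Sum>B\<in>P. t \<phi> B (x B)) - \<zeta>)\<^sup>2)) / \<beta>)))"
  have finP: "finite P" using P finite_elements[of "{..<p}" P] by simp
  have PB: "B \<subseteq> {..<p}" "finite B" "B \<noteq> {}" if "B \<in> P" for B
    using that P finite_subset[of B "{..<p}"] by (auto simp: partition_on_def)
  have cardB: "0 < card B" if "B \<in> P" for B using PB[OF that] by (simp add: card_gt_0_iff)
  have Pne: "P \<noteq> {}" using P p by (auto simp: partition_on_def)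
  have sum_Union: "(\<Sum>j\<in>\<Union>J. f j) = (\<Sum>B\<in>J. \<Sum>j\<in>B. f j)" if "J \<subseteq> P" for f :: "nat \<Rightarrow> real" and J
  proof (rule sum.Union_disjoint[unfolded comp_def])
    show "\<forall>A\<in>J. \<forall>B\<in>J. A \<noteq> B \<longrightarrow> A \<inter> B = {}"
      using P that unfolding partition_on_def disjoint_def by blast
  qed (use that PB in auto)
  have sum_blocks: "(\<Sum>j<p. f j) = (\<Sum>B\<in>P. \<Sum>j\<in>B. f j)" for f :: "nat \<Rightarrow> real"
    using sum_Union[of P] P by (simp add: partition_on_def)
  have [measurable]: "t \<phi> B \<in> borel_measurable (vec_space B)" if "finite B" for \<phi> B
    unfolding t_def by (intro borel_measurable_sum borel_measurable_times measurable_component_singleton) auto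
  have \<eta>1: "\<eta> B \<le> sqrt d * h" if "B \<in> P" for B
    unfolding \<eta>_def using d[OF that] h by (intro mult_right_mono) auto
  \<comment> \<open>All hypotheses of the abstract exchange that concern a single design, for both designs at once.\<close>
  have key: "(\<integral>\<omega>. F (\<lambda>j. A j \<omega>) \<partial>M) = (\<integral>x. H x \<partial>PiM P (Q M A))
      \<and> (\<forall>B\<in>P. prob_space (Q M A B) \<and> sets (Q M A B) = sets (vec_space B))
      \<and> (\<forall>\<phi>\<in>\<Phi>. \<forall>B\<in>P. sq_exp_bounded (Q M A B) (2 * c / (\<eta> B)\<^sup>2) (t \<phi> B) \<and> (\<integral>x. t \<phi> B x \<partial>Q M A B) = 0)
      \<and> (\<forall>\<phi>\<in>\<Phi>. \<forall>\<phi>'\<in>\<Phi>. \<forall>B\<in>P. (\<integral>x. t \<phi> B x * t \<phi>' B x \<partial>Q M A B) = (\<Sum>j\<in>B. \<phi> j * \<phi>' j * l j))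
      \<and> (\<forall>\<phi>\<in>\<Phi>. \<forall>J\<subseteq>P. sq_exp_bounded (PiM P (Q M A)) (6 * c) (\<lambda>x. \<Sum>B\<in>J. t \<phi> B (x B)))"
    if R: "row_regular M p P l \<tau> A" for M and A :: "nat \<Rightarrow> 'w \<Rightarrow> real"
  proof -
    interpret prob_space M using R by (simp add: row_regular_def)
    have ind: "indep_vars (\<lambda>B. vec_space B) (\<lambda>B. rand_vec B A) P" using R by (simp add: row_regular_def)
    have Am[measurable]: "A j \<in> borel_measurable M" if "j < p" for j using R that by (simp add: row_regular_def)
    have rv[measurable]: "rand_vec B A \<in> measurable M (vec_space B)" if "B \<in> P" for B
      using ind that unfolding indep_vars_def by auto
    have trv: "t \<phi> B (rand_vec B A \<omega>) = (\<Sum>j\<in>B. \<phi> j * A j \<omega>)" for \<phi> B \<omega>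
      by (simp add: t_def rand_vec_def mult.commute)
    have law: "PiM P (Q M A) = distr M (PiM P (\<lambda>B. vec_space B)) (\<lambda>\<omega>. \<lambda>B\<in>P. rand_vec B A \<omega>)"
      unfolding Q_def using indep_vars_iff_distr_eq_PiM'[OF Pne rv] ind by auto
    have rvP: "(\<lambda>\<omega>. \<lambda>B\<in>P. rand_vec B A \<omega>) \<in> measurable M (PiM P (\<lambda>B. vec_space B))"
      by (intro measurable_restrict rv)
    have tP: "(\<lambda>x. t \<phi> B (x B)) \<in> borel_measurable (PiM P (\<lambda>B. vec_space B))" if "B \<in> P" for \<phi> B
      using that PB by (intro measurable_compose[OF measurable_component_singleton]) auto
    have [measurable]: "\<psi> \<in> borel_measurable borel" using \<psi> by (simp add: C11_bounds_def)
    have Hm: "H \<in> borel_measurable (PiM P (\<lambda>B. vec_space B))"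
    proof -
      have [measurable]: "(\<lambda>x. \<Sum>B\<in>P. t \<phi> B (x B)) \<in> borel_measurable (PiM P (\<lambda>B. vec_space B))" for \<phi>
        by (intro borel_measurable_sum tP)
      show ?thesis unfolding H_def by measurable
    qed
    have 1: "(\<integral>\<omega>. F (\<lambda>j. A j \<omega>) \<partial>M) = (\<integral>x. H x \<partial>PiM P (Q M A))"
    proof -
      have "(\<Sum>j<p. A j \<omega> * \<phi> j) = (\<Sum>B\<in>P. t \<phi> B ((\<lambda>B\<in>P. rand_vec B A \<omega>) B))" for \<phi> \<omega>
        unfolding sum_blocks by (intro sum.cong) (auto simp: trv mult.commute)
      then have "F (\<lambda>j. A j \<omega>) = H (\<lambda>B\<in>P. rand_vec B A \<omega>)" for \<omega> unfolding F_def H_def by presburger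
      then show ?thesis unfolding law by (simp add: integral_distr[OF rvP Hm])
    qed
    have Qp: "prob_space (Q M A B)" if "B \<in> P" for B unfolding Q_def using rv[OF that] by (rule prob_space_distr)
    have Qint: "(\<integral>x. f x \<partial>Q M A B) = (\<integral>\<omega>. f (rand_vec B A \<omega>) \<partial>M)"
      if "B \<in> P" "f \<in> borel_measurable (vec_space B)" for B and f :: "_ \<Rightarrow> real"
      unfolding Q_def using that rv by (intro integral_distr) auto
    have 2: "sq_exp_bounded (Q M A B) (2 * c / (\<eta> B)\<^sup>2) (t \<phi> B)" if "\<phi> \<in> \<Phi>" "B \<in> P" for \<phi> B
    proof -
      have "(\<Sum>j\<in>B. (\<phi> j)\<^sup>2) \<le> (\<Sum>j\<in>B. h\<^sup>2)"
        using sup[OF that(1)] PB[OF that(2)] by (intro sum_mono) (auto simp: abs_le_square_iff[symmetric] h less_imp_le)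
      also have "\<dots> = (\<eta> B)\<^sup>2" by (simp add: \<eta>_def power_mult_distrib)
      finally have "2 * c / (\<eta> B)\<^sup>2 * (\<Sum>j\<in>B. (\<phi> j)\<^sup>2) \<le> 2 * c / (\<eta> B)\<^sup>2 * (\<eta> B)\<^sup>2"
        using c by (intro mult_left_mono) auto
      also have "\<dots> \<le> \<tau>" using c h cardB[OF that(2)] by (simp add: \<eta>_def)
      finally have "sq_exp_bounded M (2 * c / (\<eta> B)\<^sup>2) (\<lambda>\<omega>. \<Sum>j\<in>B. \<phi> j * A j \<omega>)"
        using c PB[OF that(2)] by (intro row_regular_sub[OF R]) auto
      then show ?thesis unfolding Q_def using rv[OF that(2)] PB[OF that(2)] by (subst sq_exp_bounded_distr) (auto simp: trv)
    qed
    have int: "integrable M (A j)" "integrable M (\<lambda>\<omega>. A j \<omega> * A k \<omega>)" if "j < p" "k < p" for j k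
      using row_regular_integrable[OF R \<tau> that] by auto
    have 3: "(\<integral>x. t \<phi> B x \<partial>Q M A B) = 0" if "B \<in> P" for \<phi> B
    proof -
      have "(\<integral>x. t \<phi> B x \<partial>Q M A B) = (\<integral>\<omega>. (\<Sum>j\<in>B. \<phi> j * A j \<omega>) \<partial>M)"
        using that PB by (simp add: Qint trv)
      also have "\<dots> = (\<Sum>j\<in>B. \<integral>\<omega>. \<phi> j * A j \<omega> \<partial>M)"
        using PB[OF that] int by (intro Bochner_Integration.integral_sum Bochner_Integration.integrable_mult_right) auto
      also have "\<dots> = 0" using PB[OF that] R by (intro sum.neutral) (auto simp: row_regular_def)
      finally show ?thesis .
    qed
    have 4: "(\<integral>x. t \<phi> B x * t \<phi>' B x \<partial>Q M A B) = (\<Sum>j\<in>B. \<phi> j * \<phi>' j * l j)" if "B \<in> P" for \<phi> \<phi>' B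
    proof -
      have "(\<integral>x. t \<phi> B x * t \<phi>' B x \<partial>Q M A B) = (\<integral>\<omega>. (\<Sum>j\<in>B. \<Sum>k\<in>B. \<phi> j * \<phi>' k * (A j \<omega> * A k \<omega>)) \<partial>M)"
        proof -
        have "(\<Sum>j\<in>B. \<phi> j * A j \<omega>) * (\<Sum>j\<in>B. \<phi>' j * A j \<omega>)
            = (\<Sum>j\<in>B. \<Sum>k\<in>B. \<phi> j * \<phi>' k * (A j \<omega> * A k \<omega>))" for \<omega>
          unfolding sum_product by (intro sum.cong refl) (simp add: mult_ac)
        then show ?thesis using that PB by (simp add: Qint trv)
      qed
      also have "\<dots> = (\<Sum>j\<in>B. \<Sum>k\<in>B. \<integral>\<omega>. \<phi> j * \<phi>' k * (A j \<omega> * A k \<omega>) \<partial>M)"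
      proof -
        have jp: "j < p" if "j \<in> B" for j using PB[OF \<open>B \<in> P\<close>] that by auto
        have i1: "integrable M (\<lambda>\<omega>. \<phi> j * \<phi>' k * (A j \<omega> * A k \<omega>))" if "j \<in> B" "k \<in> B" for j k
          using int(2)[OF jp[OF that(1)] jp[OF that(2)]] by simp
        then have i2: "integrable M (\<lambda>\<omega>. \<Sum>k\<in>B. \<phi> j * \<phi>' k * (A j \<omega> * A k \<omega>))" if "j \<in> B" for j
          using that by (intro Bochner_Integration.integrable_sum)
        have "(\<integral>\<omega>. (\<Sum>j\<in>B. \<Sum>k\<in>B. \<phi> j * \<phi>' k * (A j \<omega> * A k \<omega>)) \<partial>M)
            = (\<Sum>j\<in>B. \<integral>\<omega>. (\<Sum>k\<in>B. \<phi> j * \<phi>' k * (A j \<omega> * A k \<omega>)) \<partial>M)"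
          by (rule Bochner_Integration.integral_sum) (rule i2)
        also have "\<dots> = (\<Sum>j\<in>B. \<Sum>k\<in>B. \<integral>\<omega>. \<phi> j * \<phi>' k * (A j \<omega> * A k \<omega>) \<partial>M)"
          by (rule sum.cong[OF refl], rule Bochner_Integration.integral_sum, rule i1)
        finally show ?thesis .
      qed
      also have "\<dots> = (\<Sum>j\<in>B. \<Sum>k\<in>B. if j = k then \<phi> j * \<phi>' j * l j else 0)"
        using PB[OF that] R by (intro sum.cong refl) (auto simp: row_regular_def subset_iff)
      also have "\<dots> = (\<Sum>j\<in>B. \<phi> j * \<phi>' j * l j)" using PB[OF that] by (simp add: sum.delta)
      finally show ?thesis .
    qed
    have 5: "sq_exp_bounded (PiM P (Q M A)) (6 * c) (\<lambda>x. \<Sum>B\<in>J. t \<phi> B (x B))" if "\<phi> \<in> \<Phi>" "J \<subseteq> P" for \<phi> J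
    proof -
      have J: "\<Union>J \<subseteq> {..<p}" using that PB by blast
      have eq: "(\<lambda>\<omega>. \<Sum>j\<in>\<Union>J. \<phi> j * A j \<omega>) = (\<lambda>\<omega>. \<Sum>B\<in>J. t \<phi> B ((\<lambda>B\<in>P. rand_vec B A \<omega>) B))"
        unfolding sum_Union[OF that(2)] using that by (intro ext sum.cong refl) (auto simp: trv)
      have "(\<Sum>j\<in>\<Union>J. (\<phi> j)\<^sup>2) \<le> (\<Sum>j<p. (\<phi> j)\<^sup>2)" using J by (intro sum_mono2) auto
      then have "6 * c * (\<Sum>j\<in>\<Union>J. (\<phi> j)\<^sup>2) \<le> 6 * c * (\<Sum>j<p. (\<phi> j)\<^sup>2)" using c by (intro mult_left_mono) auto
      then have "sq_exp_bounded M (6 * c) (\<lambda>\<omega>. \<Sum>j\<in>\<Union>J. \<phi> j * A j \<omega>)"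
        using order_trans[OF _ norm[OF that(1)]] c J by (intro row_regular_sub[OF R]) auto
      then show ?thesis unfolding law eq
        using that tP by (subst sq_exp_bounded_distr[OF rvP]) (auto intro!: borel_measurable_sum)
    qed
    show ?thesis using 1 2 3 4 5 Qp by (auto simp: Q_def)
  qed
  note k0 = key[OF R(1)] and k1 = key[OF R(2)]
  have "\<bar>(\<integral>x. H x \<partial>PiM P (Q M0 A0)) - (\<integral>x. H x \<partial>PiM P (Q M1 A1))\<bar>
     \<le> (\<Sum>B\<in>P. step_error B1 \<Lambda> c \<beta> (b * \<eta> B) * (8 * exp (3 * c * \<zeta>\<^sup>2)))"
    unfolding H_def
  proof (rule row_exchange)
    show "C11_bounds \<psi> \<psi>' B0 B1 \<Lambda>" by (rule \<psi>)
    show "6 * (b * \<eta> B) \<le> c" if "B \<in> P" for B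
    proof -
      have "6 * (b * \<eta> B) \<le> 6 * (b * (sqrt d * h))" using \<eta>1[OF that] b by (intro mult_left_mono) auto
      then show ?thesis using small by linarith
    qed
    show "\<eta> B \<le> 1" if "B \<in> P" for B using \<eta>1[OF that] small by linarith
    show "0 < \<eta> B" if "B \<in> P" for B using cardB[OF that] h by (simp add: \<eta>_def)
  qed (use finP \<Phi> b c \<beta> \<psi> k0 k1 in auto)
  then show ?thesis using k0 k1 by (simp add: \<eta>_def)
qed

section \<open>Exchanging the whole design\<close>

lemma (in prob_space) distr_pair_indep_set:
  assumes f: "f \<in> measurable M S" and g: "g \<in> measurable M T"
    and ind: "indep_set (sets (vimage_algebra (space M) f S)) (sets (vimage_algebra (space M) g T))"
  shows "distr M (S \<Otimes>\<^sub>M T) (\<lambda>\<omega>. (f \<omega>, g \<omega>)) = distr M S f \<Otimes>\<^sub>M distr M T g"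
proof (rule pair_measure_eqI[symmetric])
  interpret f: prob_space "distr M S f" using f by (rule prob_space_distr)
  interpret g: prob_space "distr M T g" using g by (rule prob_space_distr)
  show "sigma_finite_measure (distr M S f)" "sigma_finite_measure (distr M T g)" by unfold_locales
  show "sets (distr M S f \<Otimes>\<^sub>M distr M T g) = sets (distr M (S \<Otimes>\<^sub>M T) (\<lambda>\<omega>. (f \<omega>, g \<omega>)))"
    by (simp cong: sets_pair_measure_cong)
  fix A B assume "A \<in> sets (distr M S f)" "B \<in> sets (distr M T g)"
  then have A: "A \<in> sets S" and B: "B \<in> sets T" by auto
  have fg: "(\<lambda>\<omega>. (f \<omega>, g \<omega>)) \<in> measurable M (S \<Otimes>\<^sub>M T)" using f g by measurable
  let ?A = "f -` A \<inter> space M" and ?B = "g -` B \<inter> space M"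
  have "?A \<in> sets (vimage_algebra (space M) f S)" "?B \<in> sets (vimage_algebra (space M) g T)"
    using A B by (auto intro: in_vimage_algebra)
  then have "prob (?A \<inter> ?B) = prob ?A * prob ?B" by (rule indep_setD[OF ind])
  then have "emeasure M (?A \<inter> ?B) = emeasure M ?A * emeasure M ?B"
    using measurable_sets[OF f A] measurable_sets[OF g B]
    by (simp add: emeasure_eq_measure ennreal_mult[symmetric])
  moreover have "(\<lambda>\<omega>. (f \<omega>, g \<omega>)) -` (A \<times> B) \<inter> space M = ?A \<inter> ?B" by auto
  ultimately show "emeasure (distr M S f) A * emeasure (distr M T g) B
      = emeasure (distr M (S \<Otimes>\<^sub>M T) (\<lambda>\<omega>. (f \<omega>, g \<omega>))) (A \<times> B)"
    using A B f g fg by (simp add: emeasure_distr)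
qed

text \<open>
  Here \<open>x\<close> is the design, \<open>z\<close> the noise, and \<open>w \<phi>\<close> the penalty factor. With \<open>\<beta> = 2 n b\<close> the factor of row \<open>i\<close>
  is \<open>exp\<close> of \<open>- \<beta>\<close> times its share of the risk.
\<close>

definition softmin ::
  "(nat \<Rightarrow> real) set \<Rightarrow> ((nat \<Rightarrow> real) \<Rightarrow> real) \<Rightarrow> real \<Rightarrow> real \<Rightarrow> nat \<Rightarrow> nat \<Rightarrow> (nat \<Rightarrow> nat \<Rightarrow> real) \<Rightarrow> (nat \<Rightarrow> real) \<Rightarrow> real" where
  "softmin \<Phi> w b \<beta> n p x z =
     - (ln (\<Sum>\<phi>\<in>\<Phi>. w \<phi> * (\<Prod>i<n. exp (- b * ((\<Sum>j<p. x i j * \<phi> j) - z i)\<^sup>2))) / \<beta>)"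

lemma rand_mat_apply: "i < n \<Longrightarrow> j < p \<Longrightarrow> rand_mat n p A \<omega> i j = A i j \<omega>"
  by (simp add: rand_mat_def rand_vec_def)

lemma softmin_cong:
  assumes "\<And>i j. i < n \<Longrightarrow> j < p \<Longrightarrow> x i j = x' i j" "\<And>i. i < n \<Longrightarrow> z i = z' i"
  shows "softmin \<Phi> w b \<beta> n p x z = softmin \<Phi> w b \<beta> n p x' z'"
  using assms by (simp add: softmin_def)

lemma measurable_softmin:
  "(\<lambda>(x, z). softmin \<Phi> w b \<beta> n p x z) \<in> borel_measurable (mat_space n p \<Otimes>\<^sub>M vec_space {..<n})"
proof -
  have x: "(\<lambda>xz. fst xz i j) \<in> borel_measurable (mat_space n p \<Otimes>\<^sub>M vec_space {..<n})" if "i < n" "j < p" for i j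
  proof -
    have "(\<lambda>x. x i) \<in> measurable (mat_space n p) (vec_space {..<p})"
      using that by (intro measurable_component_singleton) auto
    moreover have "(\<lambda>x. x j) \<in> borel_measurable (vec_space {..<p})"
      using that by (intro measurable_component_singleton) auto
    ultimately have "(\<lambda>x. x i j) \<in> borel_measurable (mat_space n p)" by (rule measurable_compose)
    then show ?thesis by (rule measurable_compose[OF measurable_fst])
  qed
  have z: "(\<lambda>xz. snd xz i) \<in> borel_measurable (mat_space n p \<Otimes>\<^sub>M vec_space {..<n})" if "i < n" for i
    using that by (intro measurable_compose[OF measurable_snd measurable_component_singleton]) auto
  have e: "(\<lambda>xz. exp (- b * ((\<Sum>j<p. fst xz i j * \<phi> j) - snd xz i)\<^sup>2))
      \<in> borel_measurable (mat_space n p \<Otimes>\<^sub>M vec_space {..<n})" if "i < n" for i \<phi>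
  proof -
    have [measurable]: "(\<lambda>xz. (\<Sum>j<p. fst xz i j * \<phi> j) - snd xz i) \<in> borel_measurable (mat_space n p \<Otimes>\<^sub>M vec_space {..<n})"
      using that by (intro borel_measurable_sum borel_measurable_times borel_measurable_diff borel_measurable_const x z) auto
    show ?thesis by measurable
  qed
  have [measurable]: "(\<lambda>xz. \<Prod>i<n. exp (- b * ((\<Sum>j<p. fst xz i j * \<phi> j) - snd xz i)\<^sup>2))
      \<in> borel_measurable (mat_space n p \<Otimes>\<^sub>M vec_space {..<n})" for \<phi>
    by (intro borel_measurable_prod e) auto
  have "(\<lambda>xz. softmin \<Phi> w b \<beta> n p (fst xz) (snd xz)) \<in> borel_measurable (mat_space n p \<Otimes>\<^sub>M vec_space {..<n})"
    unfolding softmin_def by measurable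
  then show ?thesis by (simp add: case_prod_beta)
qed

lemma measurable_softmin_fixed:
  assumes "z \<in> space (vec_space {..<n})"
  shows "(\<lambda>x. softmin \<Phi> w b \<beta> n p x z) \<in> borel_measurable (mat_space n p)"
  using measurable_compose[OF measurable_Pair2'[OF assms] measurable_softmin] by simp

text \<open>
  When row \<open>i\<close> is exchanged, the factors of the other rows are positive weights.
\<close>

lemma matrix_exchange:
  fixes \<Phi> :: "(nat \<Rightarrow> real) set" and A0 A1 :: "nat \<Rightarrow> nat \<Rightarrow> 'w \<Rightarrow> real"
  assumes R: "\<And>i. i < n \<Longrightarrow> row_regular M p (P i) l \<tau> (A0 i)" "\<And>i. i < n \<Longrightarrow> row_regular M p (P i) l \<tau> (A1 i)"
    and \<tau>: "0 < \<tau>" and P: "\<And>i. i < n \<Longrightarrow> partition_on {..<p} (P i)" and p: "0 < p"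
    and \<Phi>: "finite \<Phi>" "\<Phi> \<noteq> {}" "\<And>\<phi>. \<phi> \<in> \<Phi> \<Longrightarrow> 0 < w \<phi>"
    and sup: "\<And>\<phi> j. \<phi> \<in> \<Phi> \<Longrightarrow> j < p \<Longrightarrow> \<bar>\<phi> j\<bar> \<le> h" and h: "0 < h"
    and norm: "\<And>\<phi>. \<phi> \<in> \<Phi> \<Longrightarrow> 6 * c * (\<Sum>j<p. (\<phi> j)\<^sup>2) \<le> \<tau>"
    and c: "0 < c" "2 * c \<le> \<tau>" and b: "1 \<le> b" and \<beta>: "0 < \<beta>"
    and d: "\<And>i B. i < n \<Longrightarrow> B \<in> P i \<Longrightarrow> card B \<le> d" and small: "sqrt d * h \<le> 1" "6 * (b * (sqrt d * h)) \<le> c"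
    and \<psi>: "C11_bounds \<psi> \<psi>' B0 B1 \<Lambda>" and z: "z \<in> space (vec_space {..<n})"
  defines "law \<equiv> \<lambda>A i. distr M (vec_space {..<p}) (rand_vec {..<p} (A i))"
  shows "\<bar>(\<integral>x. \<psi> (softmin \<Phi> w b \<beta> n p x z) \<partial>PiM {..<n} (law A0)) - (\<integral>x. \<psi> (softmin \<Phi> w b \<beta> n p x z) \<partial>PiM {..<n} (law A1))\<bar>
     \<le> (\<Sum>i<n. (\<Sum>B\<in>P i. step_error B1 \<Lambda> c \<beta> (b * (sqrt (card B) * h)) * (8 * exp (3 * c * (z i)\<^sup>2))))"
proof (rule PiM_telescope[where B = B0])
  have [measurable]: "\<psi> \<in> borel_measurable borel" using \<psi> by (simp add: C11_bounds_def)
  have rv: "rand_vec {..<p} a \<in> measurable M (vec_space {..<p})" if "row_regular M p S l \<tau> a" for a S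
    unfolding rand_vec_def using that by (intro measurable_restrict) (auto simp: row_regular_def)
  note rv0 = rv[OF R(1)] and rv1 = rv[OF R(2)]
  show "prob_space (law A0 i)" if "i \<in> {..<n}" for i
    using that R(1)[of i] unfolding law_def row_regular_def by (intro prob_space.prob_space_distr rv0) auto
  show "prob_space (law A1 i)" if "i \<in> {..<n}" for i
    using that R(2)[of i] unfolding law_def row_regular_def by (intro prob_space.prob_space_distr rv1) auto
  show "sets (law A1 i) = sets (law A0 i)" for i by (simp add: law_def)
  have "sets (PiM {..<n} (law A0)) = sets (mat_space n p)" by (intro sets_PiM_cong) (auto simp: law_def)
  then show "(\<lambda>x. \<psi> (softmin \<Phi> w b \<beta> n p x z)) \<in> borel_measurable (PiM {..<n} (law A0))"
    using measurable_compose[OF measurable_softmin_fixed[OF z] \<open>\<psi> \<in> borel_measurable borel\<close>]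
    by (simp cong: measurable_cong_sets)
  show "\<bar>\<psi> (softmin \<Phi> w b \<beta> n p x z)\<bar> \<le> B0" for x using \<psi> by (simp add: C11_bounds_def)
  fix i J assume "i \<in> {..<n}" "J \<subseteq> {..<n} - {i}"
  then have i: "i < n" by simp
  let ?D = "\<lambda>x. (\<integral>y. \<psi> (softmin \<Phi> w b \<beta> n p (x(i := y)) z) \<partial>law A0 i) - (\<integral>y. \<psi> (softmin \<Phi> w b \<beta> n p (x(i := y)) z) \<partial>law A1 i)"
  let ?e = "\<Sum>B\<in>P i. step_error B1 \<Lambda> c \<beta> (b * (sqrt (card B) * h)) * (8 * exp (3 * c * (z i)\<^sup>2))"
  have pt: "\<bar>?D x\<bar> \<le> ?e" for x
  proof -
    define w' where "w' = (\<lambda>\<phi>. w \<phi> * (\<Prod>i'\<in>{..<n} - {i}. exp (- b * ((\<Sum>j<p. x i' j * \<phi> j) - z i')\<^sup>2)))"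
    define H where "H = (\<lambda>y. \<psi> (- (ln (\<Sum>\<phi>\<in>\<Phi>. w' \<phi> * exp (- b * ((\<Sum>j<p. y j * \<phi> j) - z i)\<^sup>2)) / \<beta>)))"
    have xH: "\<psi> (softmin \<Phi> w b \<beta> n p (x(i := y)) z) = H y" for y
    proof -
      have "(\<Prod>i'<n. exp (- b * ((\<Sum>j<p. (x(i := y)) i' j * \<phi> j) - z i')\<^sup>2))
         = exp (- b * ((\<Sum>j<p. y j * \<phi> j) - z i)\<^sup>2) * (\<Prod>i'\<in>{..<n} - {i}. exp (- b * ((\<Sum>j<p. x i' j * \<phi> j) - z i')\<^sup>2))" for \<phi>
        using i by (subst prod.remove[of _ i]) (auto intro!: prod.cong)
      then show ?thesis unfolding softmin_def H_def w'_def by (simp add: mult_ac)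
    qed
    have Hm: "H \<in> borel_measurable (vec_space {..<p})"
    proof -
      have [measurable]: "(\<lambda>y. \<Sum>j<p. y j * \<phi> j) \<in> borel_measurable (vec_space {..<p})" for \<phi>
        by (intro borel_measurable_sum borel_measurable_times measurable_component_singleton) auto
      show ?thesis unfolding H_def by measurable
    qed
    have Hlaw: "(\<integral>y. H y \<partial>law A i) = (\<integral>\<omega>. H (\<lambda>j. A i j \<omega>) \<partial>M)" if "rand_vec {..<p} (A i) \<in> measurable M (vec_space {..<p})" for A
    proof -
      have "H (rand_vec {..<p} (A i) \<omega>) = H (\<lambda>j. A i j \<omega>)" for \<omega> by (simp add: H_def rand_vec_def)
      then show ?thesis unfolding law_def by (simp add: integral_distr[OF that Hm])
    qed
    have "\<bar>(\<integral>\<omega>. H (\<lambda>j. A0 i j \<omega>) \<partial>M) - (\<integral>\<omega>. H (\<lambda>j. A1 i j \<omega>) \<partial>M)\<bar> \<le> ?e"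
      unfolding H_def
    proof (rule row_exchange_blocks[OF R(1)[OF i] R(2)[OF i] \<tau> P[OF i] p])
      show "C11_bounds \<psi> \<psi>' B0 B1 \<Lambda>" by (rule \<psi>)
      show "0 < w' \<phi>" if "\<phi> \<in> \<Phi>" for \<phi> using \<Phi>(3)[OF that] by (auto simp: w'_def intro!: mult_pos_pos prod_pos)
    qed (use \<Phi> sup h norm c b \<beta> d[OF i] small in auto)
    then show ?thesis unfolding xH by (simp add: Hlaw rv0[OF i] rv1[OF i])
  qed
  have e0: "0 \<le> ?e" using pt[of undefined] by linarith
  interpret H: prob_space "PiM ({..<n} - {i}) (hybrid (law A0) (law A1) J)"
    by (intro prob_space_PiM) (use rv0 rv1 R in \<open>auto simp: hybrid_def law_def row_regular_def intro!: prob_space.prob_space_distr\<close>)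
  have "\<bar>\<integral>x. ?D x \<partial>PiM ({..<n} - {i}) (hybrid (law A0) (law A1) J)\<bar>
     \<le> (\<integral>x. \<bar>?D x\<bar> \<partial>PiM ({..<n} - {i}) (hybrid (law A0) (law A1) J))" by (rule integral_abs_bound)
  also have "\<dots> \<le> (\<integral>x. ?e \<partial>PiM ({..<n} - {i}) (hybrid (law A0) (law A1) J))"
    using pt e0 by (intro integral_mono') auto
  finally show "\<bar>\<integral>x. ?D x \<partial>PiM ({..<n} - {i}) (hybrid (law A0) (law A1) J)\<bar> \<le> ?e" by (simp add: H.prob_space)
qed simp

text \<open>
  Together with the laws of the single rows this determines the joint law of design and noise.
\<close>

definition independent_design ::
  "'w measure \<Rightarrow> nat \<Rightarrow> nat \<Rightarrow> (nat \<Rightarrow> nat \<Rightarrow> 'w \<Rightarrow> real) \<Rightarrow> (nat \<Rightarrow> 'w \<Rightarrow> real) \<Rightarrow> bool" where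
  "independent_design M n p A \<xi> \<longleftrightarrow>
     prob_space.indep_vars M (\<lambda>_. vec_space {..<p}) (\<lambda>i. rand_vec {..<p} (A i)) {..<n} \<and>
     prob_space.indep_set M
        (sets (vimage_algebra (space M) (rand_mat n p A) (mat_space n p)))
        (sets (vimage_algebra (space M) (rand_vec {..<n} \<xi>) (vec_space {..<n})))"

text \<open>
  Each expectation only involves the joint law of one design and the noise, which is a product. Hence the
  exchange can be made for fixed noise, and the noise is integrated last.
\<close>

lemma design_exchange:
  fixes \<Phi> :: "(nat \<Rightarrow> real) set" and A0 A1 :: "nat \<Rightarrow> nat \<Rightarrow> 'w \<Rightarrow> real"
  assumes n: "0 < n"
    and R: "\<And>i. i < n \<Longrightarrow> row_regular M p (P i) l \<tau> (A0 i)" "\<And>i. i < n \<Longrightarrow> row_regular M p (P i) l \<tau> (A1 i)"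
    and ind: "independent_design M n p A0 \<xi>" "independent_design M n p A1 \<xi>"
    and \<xi>: "\<And>i. i < n \<Longrightarrow> sq_exp_bounded M (3 * c) (\<xi> i)"
    and \<tau>: "0 < \<tau>" and P: "\<And>i. i < n \<Longrightarrow> partition_on {..<p} (P i)" and p: "0 < p"
    and \<Phi>: "finite \<Phi>" "\<Phi> \<noteq> {}" "\<And>\<phi>. \<phi> \<in> \<Phi> \<Longrightarrow> 0 < w \<phi>"
    and sup: "\<And>\<phi> j. \<phi> \<in> \<Phi> \<Longrightarrow> j < p \<Longrightarrow> \<bar>\<phi> j\<bar> \<le> h" and h: "0 < h"
    and norm: "\<And>\<phi>. \<phi> \<in> \<Phi> \<Longrightarrow> 6 * c * (\<Sum>j<p. (\<phi> j)\<^sup>2) \<le> \<tau>"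
    and c: "0 < c" "2 * c \<le> \<tau>" and b: "1 \<le> b" and \<beta>: "0 < \<beta>"
    and d: "\<And>i B. i < n \<Longrightarrow> B \<in> P i \<Longrightarrow> card B \<le> d" and small: "sqrt d * h \<le> 1" "6 * (b * (sqrt d * h)) \<le> c"
    and \<psi>: "C11_bounds \<psi> \<psi>' B0 B1 \<Lambda>"
  shows "\<bar>(\<integral>\<omega>. \<psi> (softmin \<Phi> w b \<beta> n p (\<lambda>i j. A0 i j \<omega>) (\<lambda>i. \<xi> i \<omega>)) \<partial>M)
        - (\<integral>\<omega>. \<psi> (softmin \<Phi> w b \<beta> n p (\<lambda>i j. A1 i j \<omega>) (\<lambda>i. \<xi> i \<omega>)) \<partial>M)\<bar>
     \<le> 16 * (\<Sum>i<n. \<Sum>B\<in>P i. step_error B1 \<Lambda> c \<beta> (b * (sqrt (card B) * h)))"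
proof -
  interpret prob_space M using R(1)[OF n] by (simp add: row_regular_def)
  have \<psi>m: "\<psi> \<in> borel_measurable borel" and \<psi>B: "\<And>x. \<bar>\<psi> x\<bar> \<le> B0" using \<psi> by (auto simp: C11_bounds_def)
  define law where "law = (\<lambda>(A :: nat \<Rightarrow> nat \<Rightarrow> 'w \<Rightarrow> real) i. distr M (vec_space {..<p}) (rand_vec {..<p} (A i)))"
  define N where "N = distr M (vec_space {..<n}) (rand_vec {..<n} \<xi>)"
  define G where "G = (\<lambda>x z. \<psi> (softmin \<Phi> w b \<beta> n p x z))"
  have \<xi>m: "\<xi> i \<in> borel_measurable M" if "i < n" for i using sq_exp_boundedD(1)[OF \<xi>[OF that]] .
  have rvx: "rand_vec {..<n} \<xi> \<in> measurable M (vec_space {..<n})"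
    unfolding rand_vec_def using \<xi>m by (intro measurable_restrict) auto
  interpret N: prob_space N unfolding N_def by (rule prob_space_distr[OF rvx])
  have Gm: "(\<lambda>(x, z). G x z) \<in> borel_measurable (mat_space n p \<Otimes>\<^sub>M vec_space {..<n})"
    using measurable_compose[OF measurable_softmin \<psi>m] by (simp add: G_def case_prod_beta)
  have fub: "(\<integral>\<omega>. \<psi> (softmin \<Phi> w b \<beta> n p (\<lambda>i j. A i j \<omega>) (\<lambda>i. \<xi> i \<omega>)) \<partial>M) = (\<integral>z. (\<integral>x. G x z \<partial>PiM {..<n} (law A)) \<partial>N)
      \<and> integrable N (\<lambda>z. \<integral>x. G x z \<partial>PiM {..<n} (law A))"
    if R: "\<And>i. i < n \<Longrightarrow> row_regular M p (P i) l \<tau> (A i)" and ind: "independent_design M n p A \<xi>" for A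
  proof -
    have rv: "rand_vec {..<p} (A i) \<in> measurable M (vec_space {..<p})" if "i < n" for i
      unfolding rand_vec_def using R[OF that] by (intro measurable_restrict) (auto simp: row_regular_def)
    then have rm: "rand_mat n p A \<in> measurable M (mat_space n p)"
      unfolding rand_mat_def by (intro measurable_restrict) auto
    have lawA: "PiM {..<n} (law A) = distr M (mat_space n p) (rand_mat n p A)"
      unfolding law_def rand_mat_def
    proof (rule indep_vars_iff_distr_eq_PiM'[THEN iffD1, symmetric])
      show "{..<n} \<noteq> {}" using n by auto
    qed (use rv ind in \<open>auto simp: independent_design_def\<close>)
    interpret L: prob_space "PiM {..<n} (law A)" unfolding lawA by (rule prob_space_distr[OF rm])
    interpret LN: pair_prob_space "PiM {..<n} (law A)" N by unfold_locales
    have joint: "distr M (mat_space n p \<Otimes>\<^sub>M vec_space {..<n}) (\<lambda>\<omega>. (rand_mat n p A \<omega>, rand_vec {..<n} \<xi> \<omega>))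
        = PiM {..<n} (law A) \<Otimes>\<^sub>M N"
      unfolding lawA N_def using ind by (intro distr_pair_indep_set rm rvx) (simp add: independent_design_def)
    have pm: "(\<lambda>\<omega>. (rand_mat n p A \<omega>, rand_vec {..<n} \<xi> \<omega>)) \<in> measurable M (mat_space n p \<Otimes>\<^sub>M vec_space {..<n})"
      using rm rvx by measurable
    have sets_eq: "sets (PiM {..<n} (law A) \<Otimes>\<^sub>M N) = sets (mat_space n p \<Otimes>\<^sub>M vec_space {..<n})"
      unfolding joint[symmetric] by simp
    have Gm': "(\<lambda>(x, z). G x z) \<in> borel_measurable (PiM {..<n} (law A) \<Otimes>\<^sub>M N)"
      using Gm by (simp cong: measurable_cong_sets add: measurable_cong_sets[OF sets_eq refl])
    have int: "integrable (PiM {..<n} (law A) \<Otimes>\<^sub>M N) (\<lambda>(x, z). G x z)"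
      using \<psi>B by (intro LN.P.integrable_const_bound[of _ B0] Gm') (auto simp: G_def)
    have "(\<integral>\<omega>. \<psi> (softmin \<Phi> w b \<beta> n p (\<lambda>i j. A i j \<omega>) (\<lambda>i. \<xi> i \<omega>)) \<partial>M)
        = (\<integral>\<omega>. G (rand_mat n p A \<omega>) (rand_vec {..<n} \<xi> \<omega>) \<partial>M)"
      unfolding G_def by (intro Bochner_Integration.integral_cong refl arg_cong[where f = \<psi>] softmin_cong)
        (auto simp: rand_mat_apply rand_vec_def)
    also have "\<dots> = (\<integral>xz. (\<lambda>(x, z). G x z) xz \<partial>(PiM {..<n} (law A) \<Otimes>\<^sub>M N))"
      unfolding joint[symmetric] by (subst integral_distr[OF pm Gm]) simp
    also have "\<dots> = (\<integral>z. (\<integral>x. G x z \<partial>PiM {..<n} (law A)) \<partial>N)"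
      using LN.integral_snd[OF int] by simp
    finally show ?thesis using LN.integrable_snd[OF int] by simp
  qed
  let ?S = "\<lambda>i. \<Sum>B\<in>P i. step_error B1 \<Lambda> c \<beta> (b * (sqrt (card B) * h))"
  let ?D = "\<lambda>z. (\<integral>x. G x z \<partial>PiM {..<n} (law A0)) - (\<integral>x. G x z \<partial>PiM {..<n} (law A1))"
  have pt: "\<bar>?D z\<bar> \<le> (\<Sum>i<n. (8 * ?S i) * exp (3 * c * (z i)\<^sup>2))" if "z \<in> space N" for z
  proof -
    have z: "z \<in> space (vec_space {..<n})" using that by (simp add: N_def)
    have "\<bar>?D z\<bar> \<le> (\<Sum>i<n. \<Sum>B\<in>P i. step_error B1 \<Lambda> c \<beta> (b * (sqrt (card B) * h)) * (8 * exp (3 * c * (z i)\<^sup>2)))"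
      unfolding G_def law_def
    proof (rule matrix_exchange[where P = P and l = l and \<tau> = \<tau> and d = d and h = h])
      show "C11_bounds \<psi> \<psi>' B0 B1 \<Lambda>" by (rule \<psi>)
    qed (use R \<tau> P p \<Phi> sup h norm c b \<beta> d small z in auto)
    then show ?thesis unfolding sum_distrib_right[symmetric] by (simp add: mult_ac)
  qed
  have Nint: "integrable N (\<lambda>z. exp (3 * c * (z i)\<^sup>2))" "(\<integral>z. exp (3 * c * (z i)\<^sup>2) \<partial>N) \<le> 2" if "i < n" for i
  proof -
    have "(\<lambda>z. z i) \<in> borel_measurable (vec_space {..<n})" using that by (intro measurable_component_singleton) auto
    then have "sq_exp_bounded N (3 * c) (\<lambda>z. z i)"
      unfolding N_def using \<xi>[OF that] that by (subst sq_exp_bounded_distr[OF rvx]) (auto simp: rand_vec_def)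
    then show "integrable N (\<lambda>z. exp (3 * c * (z i)\<^sup>2))" "(\<integral>z. exp (3 * c * (z i)\<^sup>2) \<partial>N) \<le> 2"
      by (auto dest: sq_exp_boundedD)
  qed
  have S0: "0 \<le> ?S i" if "i < n" for i
  proof (intro sum_nonneg)
    have "0 \<le> B1" "0 \<le> \<Lambda>"
    proof -
      show "0 \<le> B1" using \<psi> abs_ge_zero order_trans unfolding C11_bounds_def by blast
      have "\<bar>\<psi> 1 - \<psi> 0 - \<psi>' 0 * (1 - 0)\<bar> \<le> \<Lambda> * (1 - 0)\<^sup>2" using \<psi> unfolding C11_bounds_def by blast
      then show "0 \<le> \<Lambda>" using abs_ge_zero[of "\<psi> 1 - \<psi> 0 - \<psi>' 0 * (1 - 0)"] by simp
    qed
    then show "0 \<le> step_error B1 \<Lambda> c \<beta> (b * (sqrt (card B) * h))" for B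
      using b h c \<beta> by (auto simp: step_error_def intro!: add_nonneg_nonneg)
  qed
  have "(\<integral>\<omega>. \<psi> (softmin \<Phi> w b \<beta> n p (\<lambda>i j. A0 i j \<omega>) (\<lambda>i. \<xi> i \<omega>)) \<partial>M)
        - (\<integral>\<omega>. \<psi> (softmin \<Phi> w b \<beta> n p (\<lambda>i j. A1 i j \<omega>) (\<lambda>i. \<xi> i \<omega>)) \<partial>M) = (\<integral>z. ?D z \<partial>N)"
    using fub[OF R(1) ind(1)] fub[OF R(2) ind(2)] by simp
  also have "\<bar>\<dots>\<bar> \<le> (\<integral>z. \<bar>?D z\<bar> \<partial>N)" by (rule integral_abs_bound)
  also have "\<dots> \<le> (\<integral>z. (\<Sum>i<n. (8 * ?S i) * exp (3 * c * (z i)\<^sup>2)) \<partial>N)"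
  proof (rule integral_mono')
    show "integrable N (\<lambda>z. \<Sum>i<n. (8 * ?S i) * exp (3 * c * (z i)\<^sup>2))"
      using Nint by (intro Bochner_Integration.integrable_sum Bochner_Integration.integrable_mult_right) auto
    show "0 \<le> (\<Sum>i<n. (8 * ?S i) * exp (3 * c * (z i)\<^sup>2))" for z
    proof (rule sum_nonneg)
      fix i assume "i \<in> {..<n}"
      then have "0 \<le> ?S i" by (intro S0) simp
      then show "0 \<le> 8 * ?S i * exp (3 * c * (z i)\<^sup>2)" by simp
    qed
  qed (rule pt)
  also have "\<dots> = (\<Sum>i<n. (8 * ?S i) * (\<integral>z. exp (3 * c * (z i)\<^sup>2) \<partial>N))"
    using Nint by (subst Bochner_Integration.integral_sum) (auto intro!: Bochner_Integration.integrable_mult_right)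
  also have "\<dots> \<le> (\<Sum>i<n. (8 * ?S i) * 2)"
    using S0 Nint by (intro sum_mono mult_left_mono) auto
  also have "\<dots> = 16 * (\<Sum>i<n. ?S i)" by (simp add: sum_distrib_left mult_ac)
  finally show ?thesis .
qed

section \<open>From the infimum to the soft minimum\<close>

definition emp_risk ::
  "((nat \<Rightarrow> real) \<Rightarrow> real) \<Rightarrow> nat \<Rightarrow> nat \<Rightarrow> (nat \<Rightarrow> nat \<Rightarrow> real) \<Rightarrow> (nat \<Rightarrow> real) \<Rightarrow> (nat \<Rightarrow> real) \<Rightarrow> real" where
  "emp_risk pen n p x z \<phi> = 1 / (2 * real n) * (\<Sum>i<n. ((\<Sum>j<p. x i j * \<phi> j) - z i)\<^sup>2) + pen \<phi>"

lemma risk_eq_emp_risk: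
  "risk f lam n p \<beta>0 \<xi> \<phi> A \<omega> = emp_risk (\<lambda>\<phi>. lam * f n p (\<lambda>j. \<phi> j + \<beta>0 j)) n p (\<lambda>i j. A i j \<omega>) (\<lambda>i. \<xi> i \<omega>) \<phi>"
  by (simp add: risk_def emp_risk_def L2_set_def sum_nonneg)

text \<open>
  A Lipschitz constant of the empirical risk for the sup-norm on \<open>{\<phi>. \<bar>\<phi>\<^sub>j\<bar> \<le> C}\<close>. It is crude, of the order of
  the squared Frobenius norm of the design, but its expectation is polynomial in \<open>p\<close>, and a finer net costs
  only a logarithm.
\<close>

definition risk_modulus :: "real \<Rightarrow> real \<Rightarrow> nat \<Rightarrow> nat \<Rightarrow> (nat \<Rightarrow> nat \<Rightarrow> real) \<Rightarrow> (nat \<Rightarrow> real) \<Rightarrow> real" where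
  "risk_modulus C Lp n p x z = 1 / (2 * real n) * (\<Sum>i<n. (2 * C + 1) * real p * (\<Sum>j<p. (x i j)\<^sup>2) + (z i)\<^sup>2) + Lp"

lemma emp_risk_diff:
  assumes C: "\<And>j. j < p \<Longrightarrow> \<bar>\<phi> j\<bar> \<le> C" "\<And>j. j < p \<Longrightarrow> \<bar>\<phi>' j\<bar> \<le> C" "0 \<le> C"
    and \<delta>: "\<And>j. j < p \<Longrightarrow> \<bar>\<phi> j - \<phi>' j\<bar> \<le> \<delta>" "0 \<le> \<delta>" and pen: "\<bar>pen \<phi> - pen \<phi>'\<bar> \<le> \<delta> * Lp"
  shows "\<bar>emp_risk pen n p x z \<phi> - emp_risk pen n p x z \<phi>'\<bar> \<le> \<delta> * risk_modulus C Lp n p x z"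
proof -
  let ?r = "\<lambda>\<phi> i. (\<Sum>j<p. x i j * \<phi> j) - z i"
  have sq_diff: "u\<^sup>2 - v\<^sup>2 = (u - v) * (u + v)" for u v :: real by (simp add: power2_eq_square algebra_simps)
  have row: "\<bar>(?r \<phi> i)\<^sup>2 - (?r \<phi>' i)\<^sup>2\<bar> \<le> \<delta> * ((2 * C + 1) * real p * (\<Sum>j<p. (x i j)\<^sup>2) + (z i)\<^sup>2)" for i
  proof -
    define S where "S = (\<Sum>j<p. \<bar>x i j\<bar>)"
    have S0: "0 \<le> S" by (simp add: S_def sum_nonneg)
    have lin: "\<bar>\<Sum>j<p. x i j * u j\<bar> \<le> m * S" if "\<And>j. j < p \<Longrightarrow> \<bar>u j\<bar> \<le> m" for u m
    proof -
      have "\<bar>\<Sum>j<p. x i j * u j\<bar> \<le> (\<Sum>j<p. \<bar>x i j * u j\<bar>)" by (rule sum_abs)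
      also have "\<dots> \<le> (\<Sum>j<p. m * \<bar>x i j\<bar>)"
      proof (rule sum_mono)
        fix j assume "j \<in> {..<p}"
        then show "\<bar>x i j * u j\<bar> \<le> m * \<bar>x i j\<bar>"
          using mult_left_mono[OF that[of j], of "\<bar>x i j\<bar>"] by (simp add: abs_mult mult.commute)
      qed
      finally show ?thesis by (simp add: S_def sum_distrib_left)
    qed
    have "?r \<phi> i - ?r \<phi>' i = (\<Sum>j<p. x i j * (\<phi> j - \<phi>' j))" by (simp add: right_diff_distrib sum_subtractf)
    then have 1: "\<bar>?r \<phi> i - ?r \<phi>' i\<bar> \<le> \<delta> * S" using lin[of "\<lambda>j. \<phi> j - \<phi>' j"] \<delta> by simp
    have 2: "\<bar>?r \<phi> i + ?r \<phi>' i\<bar> \<le> 2 * C * S + 2 * \<bar>z i\<bar>"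
      using lin[of \<phi> C] lin[of \<phi>' C] C by (auto simp: abs_if split: if_splits)
    have "(?r \<phi> i)\<^sup>2 - (?r \<phi>' i)\<^sup>2 = (?r \<phi> i - ?r \<phi>' i) * (?r \<phi> i + ?r \<phi>' i)"
      by (rule sq_diff)
    then have "\<bar>(?r \<phi> i)\<^sup>2 - (?r \<phi>' i)\<^sup>2\<bar> \<le> (\<delta> * S) * (2 * C * S + 2 * \<bar>z i\<bar>)"
      unfolding abs_mult using 1 2 S0 \<delta> by (simp only: abs_mult) (intro mult_mono, auto)
    also have "\<dots> \<le> \<delta> * ((2 * C + 1) * S\<^sup>2 + (z i)\<^sup>2)"
    proof -
      have "0 \<le> (S - \<bar>z i\<bar>)\<^sup>2" by simp
      then have "S * (2 * C * S + 2 * \<bar>z i\<bar>) \<le> (2 * C + 1) * S\<^sup>2 + (z i)\<^sup>2"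
        by (simp add: power2_eq_square algebra_simps)
      then show ?thesis using \<delta> by (simp add: mult.assoc mult_left_mono)
    qed
    also have "\<dots> \<le> \<delta> * ((2 * C + 1) * (real p * (\<Sum>j<p. (x i j)\<^sup>2)) + (z i)\<^sup>2)"
    proof -
      have "S\<^sup>2 \<le> real p * (\<Sum>j<p. (x i j)\<^sup>2)"
        using sum_squared_le_sum_of_squares[of "\<lambda>j. \<bar>x i j\<bar>" "{..<p}"] by (simp add: S_def mult.commute)
      then show ?thesis using \<delta> C by (intro mult_left_mono add_right_mono) auto
    qed
    finally show ?thesis by (simp add: mult.assoc)
  qed
  define T where "T = (\<Sum>i<n. (?r \<phi> i)\<^sup>2 - (?r \<phi>' i)\<^sup>2)"
  define U where "U = (\<Sum>i<n. (2 * C + 1) * real p * (\<Sum>j<p. (x i j)\<^sup>2) + (z i)\<^sup>2)"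
  have "\<bar>T\<bar> \<le> (\<Sum>i<n. \<bar>(?r \<phi> i)\<^sup>2 - (?r \<phi>' i)\<^sup>2\<bar>)" unfolding T_def by (rule sum_abs)
  also have "\<dots> \<le> (\<Sum>i<n. \<delta> * ((2 * C + 1) * real p * (\<Sum>j<p. (x i j)\<^sup>2) + (z i)\<^sup>2))"
    by (rule sum_mono) (rule row)
  also have "\<dots> = \<delta> * U" by (simp only: U_def sum_distrib_left)
  finally have "1 / (2 * real n) * \<bar>T\<bar> \<le> 1 / (2 * real n) * (\<delta> * U)" by (rule mult_left_mono) simp
  moreover have "emp_risk pen n p x z \<phi> - emp_risk pen n p x z \<phi>' = 1 / (2 * real n) * T + (pen \<phi> - pen \<phi>')"
    unfolding emp_risk_def T_def sum_subtractf right_diff_distrib by simp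
  moreover have "\<bar>1 / (2 * real n) * T\<bar> = 1 / (2 * real n) * \<bar>T\<bar>" by (simp add: abs_mult)
  moreover have "\<delta> * risk_modulus C Lp n p x z = 1 / (2 * real n) * (\<delta> * U) + \<delta> * Lp"
    unfolding risk_modulus_def U_def[symmetric] by (simp add: distrib_left)
  ultimately show ?thesis using pen by linarith
qed

text \<open>
  One point of \<open>V\<close> is chosen in each nonempty cell of the grid of mesh \<open>\<delta>\<close>, so that the net is a subset of
  \<open>V\<close>.
\<close>

lemma finite_net:
  fixes V :: "(nat \<Rightarrow> real) set"
  assumes V: "V \<noteq> {}" "\<forall>\<phi>\<in>V. \<forall>j<p. \<bar>\<phi> j\<bar> \<le> C" and \<delta>: "0 < \<delta>" and C: "0 \<le> C"
  shows "\<exists>N. N \<subseteq> V \<and> finite N \<and> N \<noteq> {} \<and> real (card N) \<le> (2 * C / \<delta> + 2) ^ p \<and>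
    (\<forall>\<phi>\<in>V. \<exists>\<phi>'\<in>N. \<forall>j<p. \<bar>\<phi> j - \<phi>' j\<bar> \<le> \<delta>)"
proof -
  define cell where "cell = (\<lambda>\<phi> :: nat \<Rightarrow> real. \<lambda>j\<in>{..<p}. \<lfloor>\<phi> j / \<delta>\<rfloor>)"
  define rep where "rep = (\<lambda>k. SOME \<phi>. \<phi> \<in> V \<and> cell \<phi> = k)"
  define J where "J = {\<lfloor>- C / \<delta>\<rfloor>..\<lfloor>C / \<delta>\<rfloor>}"
  have rep: "rep (cell \<phi>) \<in> V \<and> cell (rep (cell \<phi>)) = cell \<phi>" if "\<phi> \<in> V" for \<phi>
    unfolding rep_def using someI[of "\<lambda>\<phi>'. \<phi>' \<in> V \<and> cell \<phi>' = cell \<phi>" \<phi>] that by simp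
  have cells: "cell ` V \<subseteq> {..<p} \<rightarrow>\<^sub>E J"
  proof
    fix k assume "k \<in> cell ` V"
    then obtain \<phi> where \<phi>: "\<phi> \<in> V" "k = cell \<phi>" by auto
    have "\<lfloor>\<phi> j / \<delta>\<rfloor> \<in> J" if "j < p" for j
    proof -
      have "- C \<le> \<phi> j" "\<phi> j \<le> C" using V(2) \<phi>(1) that by fastforce+
      then have "- C / \<delta> \<le> \<phi> j / \<delta>" "\<phi> j / \<delta> \<le> C / \<delta>" 
        using divide_right_mono[OF _ less_imp_le[OF \<delta>]] by blast+
      then show ?thesis unfolding J_def by (auto intro: floor_mono)
    qed
    then show "k \<in> {..<p} \<rightarrow>\<^sub>E J" by (auto simp: \<phi> cell_def)
  qed
  have finJ: "finite ({..<p} \<rightarrow>\<^sub>E J)" by (intro finite_PiE) (auto simp: J_def)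
  have finC: "finite (cell ` V)" using cells finJ by (rule finite_subset)
  have cardJ: "real (card J) \<le> 2 * C / \<delta> + 2"
  proof -
    have le: "\<lfloor>- C / \<delta>\<rfloor> \<le> \<lfloor>C / \<delta>\<rfloor>" using C \<delta> by (intro floor_mono divide_right_mono) auto
    have "real (card J) = real_of_int (\<lfloor>C / \<delta>\<rfloor> - \<lfloor>- C / \<delta>\<rfloor> + 1)" using le by (simp add: J_def)
    also have "\<dots> \<le> C / \<delta> - (- C / \<delta> - 1) + 1" by (simp only: of_int_diff of_int_add of_int_1) linarith
    finally show ?thesis by simp
  qed
  show ?thesis
  proof (intro exI[of _ "rep ` cell ` V"] conjI ballI)
    show "rep ` cell ` V \<subseteq> V" using rep by auto
    show "finite (rep ` cell ` V)" using finC by simp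
    show "rep ` cell ` V \<noteq> {}" using V by simp
    have "card (rep ` cell ` V) \<le> card (cell ` V)" using finC by (rule card_image_le)
    also have "\<dots> \<le> card ({..<p} \<rightarrow>\<^sub>E J)" using finJ cells by (rule card_mono)
    also have "\<dots> = card J ^ p" by (simp add: card_PiE)
    finally have "real (card (rep ` cell ` V)) \<le> real (card J) ^ p" by (metis of_nat_le_iff of_nat_power)
    also have "\<dots> \<le> (2 * C / \<delta> + 2) ^ p" using cardJ by (intro power_mono) auto
    finally show "real (card (rep ` cell ` V)) \<le> (2 * C / \<delta> + 2) ^ p" .
    fix \<phi> assume \<phi>: "\<phi> \<in> V"
    show "\<exists>\<phi>'\<in>rep ` cell ` V. \<forall>j<p. \<bar>\<phi> j - \<phi>' j\<bar> \<le> \<delta>"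
    proof (intro bexI allI impI)
      fix j assume j: "j < p"
      let ?\<phi>' = "rep (cell \<phi>)"
      have "cell ?\<phi>' j = cell \<phi> j" using rep[OF \<phi>] by simp
      then have "\<lfloor>?\<phi>' j / \<delta>\<rfloor> = \<lfloor>\<phi> j / \<delta>\<rfloor>" using j by (simp add: cell_def)
      then have "\<bar>\<phi> j / \<delta> - ?\<phi>' j / \<delta>\<bar> \<le> 1" by linarith
      then have "\<bar>(\<phi> j - ?\<phi>' j) / \<delta>\<bar> \<le> 1" by (simp add: diff_divide_distrib)
      then show "\<bar>\<phi> j - ?\<phi>' j\<bar> \<le> \<delta>" using \<delta> by (simp add: abs_divide)
    qed (use \<phi> in auto)
  qed
qed

lemma INF_net:
  fixes R :: "'v \<Rightarrow> real"
  assumes N: "N \<subseteq> V" "N \<noteq> {}" and nonneg: "\<And>\<phi>. \<phi> \<in> V \<Longrightarrow> 0 \<le> R \<phi>"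
    and close: "\<And>\<phi>. \<phi> \<in> V \<Longrightarrow> \<exists>\<phi>'\<in>N. R \<phi>' \<le> R \<phi> + e"
  shows "(INF \<phi>\<in>V. R \<phi>) \<le> (INF \<phi>\<in>N. R \<phi>)" "(INF \<phi>\<in>N. R \<phi>) \<le> (INF \<phi>\<in>V. R \<phi>) + e"
proof -
  have bV: "bdd_below (R ` V)" using nonneg by (rule bdd_belowI2)
  have bN: "bdd_below (R ` N)" using bV image_mono[OF N(1)] by (rule bdd_below_mono)
  show "(INF \<phi>\<in>V. R \<phi>) \<le> (INF \<phi>\<in>N. R \<phi>)" using N bV by (intro cINF_superset_mono) auto
  have "(INF \<phi>\<in>N. R \<phi>) - e \<le> (INF \<phi>\<in>V. R \<phi>)"
  proof (rule cINF_greatest)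
    show "V \<noteq> {}" using N by auto
    fix \<phi> assume "\<phi> \<in> V"
    then obtain \<phi>' where "\<phi>' \<in> N" "R \<phi>' \<le> R \<phi> + e" using close by blast
    then show "(INF \<phi>\<in>N. R \<phi>) - e \<le> R \<phi>" using cINF_lower[OF bN, of \<phi>'] by linarith
  qed
  then show "(INF \<phi>\<in>N. R \<phi>) \<le> (INF \<phi>\<in>V. R \<phi>) + e" by linarith
qed

lemma softmin_INF:
  fixes pen :: "(nat \<Rightarrow> real) \<Rightarrow> real" and p :: nat and x :: "nat \<Rightarrow> nat \<Rightarrow> real" and z :: "nat \<Rightarrow> real"
  assumes N: "finite N" "N \<noteq> {}" and b: "0 < b" and n: "0 < n"
  defines "\<beta> \<equiv> 2 * real n * b"
  defines "s \<equiv> softmin N (\<lambda>\<phi>. exp (- \<beta> * pen \<phi>)) b \<beta> n p x z"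
  shows "s \<le> (INF \<phi>\<in>N. emp_risk pen n p x z \<phi>)"
    and "(INF \<phi>\<in>N. emp_risk pen n p x z \<phi>) \<le> s + ln (card N) / \<beta>"
proof -
  let ?R = "emp_risk pen n p x z"
  have \<beta>: "0 < \<beta>" using b n by (simp add: \<beta>_def)
  define Z where "Z = (\<Sum>\<phi>\<in>N. exp (- \<beta> * ?R \<phi>))"
  have s: "s = - (ln Z / \<beta>)"
  proof -
    have "exp (- \<beta> * pen \<phi>) * (\<Prod>i<n. exp (- b * ((\<Sum>j<p. x i j * \<phi> j) - z i)\<^sup>2)) = exp (- \<beta> * ?R \<phi>)" for \<phi>
    proof -
      have "\<beta> * (1 / (2 * real n)) = b" using n by (simp add: \<beta>_def)
      then have "\<beta> * ?R \<phi> = b * (\<Sum>i<n. ((\<Sum>j<p. x i j * \<phi> j) - z i)\<^sup>2) + \<beta> * pen \<phi>"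
        unfolding emp_risk_def distrib_left mult.assoc[symmetric] by simp
      then show ?thesis by (simp add: sum_distrib_left sum_negf flip: exp_sum exp_add)
    qed
    then show ?thesis unfolding s_def softmin_def Z_def by simp
  qed
  obtain \<phi>0 where \<phi>0: "\<phi>0 \<in> N" "\<And>\<phi>. \<phi> \<in> N \<Longrightarrow> ?R \<phi>0 \<le> ?R \<phi>"
    using ex_min_if_finite[of "?R ` N"] N by (metis (no_types, lifting) arg_min_if_finite(1) arg_min_least)
  have I: "(INF \<phi>\<in>N. ?R \<phi>) = ?R \<phi>0" using \<phi>0 by (intro cInf_eq_minimum) auto
  have lo: "exp (- \<beta> * ?R \<phi>0) \<le> Z" unfolding Z_def using N \<phi>0 by (intro member_le_sum) auto
  have Z0: "0 < Z" using lo exp_gt_zero[of "- \<beta> * ?R \<phi>0"] by linarith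
  have "Z \<le> (\<Sum>\<phi>\<in>N. exp (- \<beta> * ?R \<phi>0))" unfolding Z_def using \<phi>0 \<beta> by (intro sum_mono) auto
  then have hi: "Z \<le> card N * exp (- \<beta> * ?R \<phi>0)" by simp
  have "- \<beta> * ?R \<phi>0 \<le> ln Z" using lo Z0 by (simp add: ln_ge_iff)
  then show "s \<le> (INF \<phi>\<in>N. ?R \<phi>)" unfolding s I using \<beta> by (simp add: field_simps)
  have cN: "0 < real (card N)" using N by (simp add: card_gt_0_iff)
  have "ln Z \<le> ln (card N * exp (- \<beta> * ?R \<phi>0))" using hi Z0 by (rule ln_mono[rotated 2])
  also have "\<dots> = ln (card N) - \<beta> * ?R \<phi>0" using cN by (simp add: ln_mult)
  finally show "(INF \<phi>\<in>N. ?R \<phi>) \<le> s + ln (card N) / \<beta>" unfolding s I using \<beta> by (simp add: field_simps)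
qed

text \<open>
  The infimum over an arbitrary set \<open>V\<close> is measurable because it is the limit of minima over finite nets.
\<close>

lemma (in prob_space) expectation_INF_softmin:
  fixes A :: "nat \<Rightarrow> nat \<Rightarrow> 'a \<Rightarrow> real"
  assumes n: "0 < n" and b: "0 < b"
    and A: "\<And>i j. i < n \<Longrightarrow> j < p \<Longrightarrow> A i j \<in> borel_measurable M"
      "\<And>i j. i < n \<Longrightarrow> j < p \<Longrightarrow> integrable M (\<lambda>\<omega>. (A i j \<omega>)\<^sup>2)" "\<And>i j. i < n \<Longrightarrow> j < p \<Longrightarrow> (\<integral>\<omega>. (A i j \<omega>)\<^sup>2 \<partial>M) \<le> C'"
    and \<xi>: "\<And>i. i < n \<Longrightarrow> \<xi> i \<in> borel_measurable M"
      "\<And>i. i < n \<Longrightarrow> integrable M (\<lambda>\<omega>. (\<xi> i \<omega>)\<^sup>2)" "\<And>i. i < n \<Longrightarrow> (\<integral>\<omega>. (\<xi> i \<omega>)\<^sup>2 \<partial>M) \<le> \<sigma>2"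
    and V: "V \<noteq> {}" "\<And>\<phi> j. \<phi> \<in> V \<Longrightarrow> j < p \<Longrightarrow> \<bar>\<phi> j\<bar> \<le> C" and C: "0 \<le> C"
    and pen: "\<And>\<phi>. \<phi> \<in> V \<Longrightarrow> 0 \<le> pen \<phi>"
      "\<And>\<phi> \<phi>' \<delta>. \<phi> \<in> V \<Longrightarrow> \<phi>' \<in> V \<Longrightarrow> (\<And>j. j < p \<Longrightarrow> \<bar>\<phi> j - \<phi>' j\<bar> \<le> \<delta>) \<Longrightarrow> 0 \<le> \<delta> \<Longrightarrow> \<bar>pen \<phi> - pen \<phi>'\<bar> \<le> \<delta> * Lp" "0 \<le> Lp"
    and N: "N \<subseteq> V" "finite N" "N \<noteq> {}" "\<And>\<phi>. \<phi> \<in> V \<Longrightarrow> \<exists>\<phi>'\<in>N. \<forall>j<p. \<bar>\<phi> j - \<phi>' j\<bar> \<le> \<delta>" and \<delta>: "0 \<le> \<delta>"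
    and \<psi>: "\<psi> \<in> borel_measurable borel" "\<And>x. \<bar>\<psi> x\<bar> \<le> B0" "\<And>x y. \<bar>\<psi> y - \<psi> x\<bar> \<le> B1 * \<bar>y - x\<bar>" "0 \<le> B1"
  defines "\<beta> \<equiv> 2 * real n * b"
  shows "\<bar>(\<integral>\<omega>. \<psi> (INF \<phi>\<in>V. emp_risk pen n p (\<lambda>i j. A i j \<omega>) (\<lambda>i. \<xi> i \<omega>) \<phi>) \<partial>M)
       - (\<integral>\<omega>. \<psi> (softmin N (\<lambda>\<phi>. exp (- \<beta> * pen \<phi>)) b \<beta> n p (\<lambda>i j. A i j \<omega>) (\<lambda>i. \<xi> i \<omega>)) \<partial>M)\<bar>
     \<le> B1 * (\<delta> * (((2 * C + 1) * (real p)\<^sup>2 * C' + \<sigma>2) / 2 + Lp) + ln (card N) / \<beta>)"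
proof -
  let ?R = "\<lambda>\<phi> \<omega>. emp_risk pen n p (\<lambda>i j. A i j \<omega>) (\<lambda>i. \<xi> i \<omega>) \<phi>"
  let ?s = "\<lambda>\<omega>. softmin N (\<lambda>\<phi>. exp (- \<beta> * pen \<phi>)) b \<beta> n p (\<lambda>i j. A i j \<omega>) (\<lambda>i. \<xi> i \<omega>)"
  define K where "K = (\<lambda>\<omega>. risk_modulus C Lp n p (\<lambda>i j. A i j \<omega>) (\<lambda>i. \<xi> i \<omega>))"
  have \<beta>: "0 < \<beta>" using b n by (simp add: \<beta>_def)
  have lin: "(\<lambda>\<omega>. (\<Sum>j<p. A i j \<omega> * \<phi> j) - \<xi> i \<omega>) \<in> borel_measurable M" if "i < n" for i \<phi>
    using that A(1) \<xi>(1) by (intro borel_measurable_diff borel_measurable_sum borel_measurable_times) auto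
  have Rm: "?R \<phi> \<in> borel_measurable M" for \<phi>
    unfolding emp_risk_def
    by (intro borel_measurable_add borel_measurable_times borel_measurable_sum borel_measurable_power lin borel_measurable_const) auto
  have R0: "0 \<le> ?R \<phi> \<omega>" if "\<phi> \<in> V" for \<phi> \<omega>
    unfolding emp_risk_def by (intro add_nonneg_nonneg mult_nonneg_nonneg sum_nonneg pen(1) that) auto
  have Rd: "\<exists>\<phi>'\<in>N'. ?R \<phi>' \<omega> \<le> ?R \<phi> \<omega> + \<delta>' * K \<omega>"
    if N': "N' \<subseteq> V" and net: "\<And>\<phi>. \<phi> \<in> V \<Longrightarrow> \<exists>\<phi>'\<in>N'. \<forall>j<p. \<bar>\<phi> j - \<phi>' j\<bar> \<le> \<delta>'" and \<delta>': "0 \<le> \<delta>'" and \<phi>: "\<phi> \<in> V" for N' \<delta>' \<phi> \<omega>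
  proof -
    obtain \<phi>' where \<phi>': "\<phi>' \<in> N'" "\<forall>j<p. \<bar>\<phi> j - \<phi>' j\<bar> \<le> \<delta>'" using net[OF \<phi>] by blast
    have "\<bar>?R \<phi> \<omega> - ?R \<phi>' \<omega>\<bar> \<le> \<delta>' * K \<omega>"
      unfolding K_def using \<phi>' N' \<phi> V C \<delta>' by (intro emp_risk_diff pen(2)) auto
    then show ?thesis using \<phi>' by (intro bexI[of _ \<phi>']) auto
  qed
  have net_INF: "(INF \<phi>\<in>V. ?R \<phi> \<omega>) \<le> (INF \<phi>\<in>N'. ?R \<phi> \<omega>) \<and> (INF \<phi>\<in>N'. ?R \<phi> \<omega>) \<le> (INF \<phi>\<in>V. ?R \<phi> \<omega>) + \<delta>' * K \<omega>"
    if N': "N' \<subseteq> V" "N' \<noteq> {}" and net: "\<forall>\<phi>\<in>V. \<exists>\<phi>'\<in>N'. \<forall>j<p. \<bar>\<phi> j - \<phi>' j\<bar> \<le> \<delta>'" and \<delta>': "0 \<le> \<delta>'" for N' \<delta>' \<omega>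
  proof (rule conjI)
    have c: "\<exists>\<phi>'\<in>N'. ?R \<phi>' \<omega> \<le> ?R \<phi> \<omega> + \<delta>' * K \<omega>" if "\<phi> \<in> V" for \<phi>
      using net by (intro Rd[OF N'(1) _ \<delta>' that]) blast
    show "(INF \<phi>\<in>V. ?R \<phi> \<omega>) \<le> (INF \<phi>\<in>N'. ?R \<phi> \<omega>)"
      by (rule INF_net(1)[where e = "\<delta>' * K \<omega>"]) (fact N' R0 c)+
    show "(INF \<phi>\<in>N'. ?R \<phi> \<omega>) \<le> (INF \<phi>\<in>V. ?R \<phi> \<omega>) + \<delta>' * K \<omega>"
      by (rule INF_net(2)) (fact N' R0 c)+
  qed
  have INFm: "(\<lambda>\<omega>. INF \<phi>\<in>V. ?R \<phi> \<omega>) \<in> borel_measurable M"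
  proof -
    have "\<exists>N'. N' \<subseteq> V \<and> finite N' \<and> N' \<noteq> {} \<and> (\<forall>\<phi>\<in>V. \<exists>\<phi>'\<in>N'. \<forall>j<p. \<bar>\<phi> j - \<phi>' j\<bar> \<le> 1 / real (Suc k))" for k
    proof -
      have "\<forall>\<phi>\<in>V. \<forall>j<p. \<bar>\<phi> j\<bar> \<le> C" using V(2) by blast
      from finite_net[OF V(1) this _ C, of "1 / real (Suc k)"] show ?thesis by auto
    qed
    then obtain N' where N': "\<And>k. N' k \<subseteq> V" "\<And>k. finite (N' k)" "\<And>k. N' k \<noteq> {}"
        "\<And>k. \<forall>\<phi>\<in>V. \<exists>\<phi>'\<in>N' k. \<forall>j<p. \<bar>\<phi> j - \<phi>' j\<bar> \<le> 1 / real (Suc k)" by metis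
    show ?thesis
    proof (rule borel_measurable_LIMSEQ_real)
      show "(\<lambda>\<omega>. INF \<phi>\<in>N' k. ?R \<phi> \<omega>) \<in> borel_measurable M" for k
        using N'(2)[of k] by (intro borel_measurable_cINF Rm) (auto intro: countable_finite)
      fix \<omega>
      have near: "norm ((INF \<phi>\<in>N' k. ?R \<phi> \<omega>) - (INF \<phi>\<in>V. ?R \<phi> \<omega>)) \<le> K \<omega> * (1 / real (Suc k))" for k
        using net_INF[OF N'(1)[of k] N'(3)[of k] N'(4)[of k], of \<omega>] by (simp add: mult.commute)
      have lim0: "(\<lambda>k. K \<omega> * (1 / real (Suc k))) \<longlonglongrightarrow> 0"
        using tendsto_mult_right_zero[OF LIMSEQ_inverse_real_of_nat, of "K \<omega>"] by (simp only: inverse_eq_divide)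
      have "(\<lambda>k. (INF \<phi>\<in>N' k. ?R \<phi> \<omega>) - (INF \<phi>\<in>V. ?R \<phi> \<omega>)) \<longlonglongrightarrow> 0"
        by (rule Lim_null_comparison[OF _ lim0]) (rule always_eventually, rule allI, rule near)
      then show "(\<lambda>k. INF \<phi>\<in>N' k. ?R \<phi> \<omega>) \<longlonglongrightarrow> (INF \<phi>\<in>V. ?R \<phi> \<omega>)" by (rule LIM_zero_cancel)
    qed
  qed
  have sm: "?s \<in> borel_measurable M"
  proof -
    have e: "(\<lambda>\<omega>. exp (- b * ((\<Sum>j<p. A i j \<omega> * \<phi> j) - \<xi> i \<omega>)\<^sup>2)) \<in> borel_measurable M" if "i < n" for i \<phi>
    proof -
      note [measurable] = lin[OF that, of \<phi>]
      show ?thesis by measurable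
    qed
    have [measurable]: "(\<lambda>\<omega>. \<Prod>i<n. exp (- b * ((\<Sum>j<p. A i j \<omega> * \<phi> j) - \<xi> i \<omega>)\<^sup>2)) \<in> borel_measurable M" for \<phi>
      by (intro borel_measurable_prod e) auto
    show ?thesis unfolding softmin_def by measurable
  qed
  have intK: "integrable M K"
    unfolding K_def risk_modulus_def using A(2) \<xi>(2)
    by (intro Bochner_Integration.integrable_add Bochner_Integration.integrable_mult_right Bochner_Integration.integrable_sum integrable_const) auto
  have EK: "(\<integral>\<omega>. K \<omega> \<partial>M) \<le> ((2 * C + 1) * (real p)\<^sup>2 * C' + \<sigma>2) / 2 + Lp"
  proof -
    have ia: "integrable M (\<lambda>\<omega>. \<Sum>j<p. (A i j \<omega>)\<^sup>2)" if "i < n" for i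
      using that A(2) by (intro Bochner_Integration.integrable_sum) auto
    have ir: "integrable M (\<lambda>\<omega>. (2 * C + 1) * real p * (\<Sum>j<p. (A i j \<omega>)\<^sup>2) + (\<xi> i \<omega>)\<^sup>2)" if "i < n" for i
      using that ia[OF that] \<xi>(2)[OF that] by (intro Bochner_Integration.integrable_add Bochner_Integration.integrable_mult_right) auto
    have "(\<integral>\<omega>. (2 * C + 1) * real p * (\<Sum>j<p. (A i j \<omega>)\<^sup>2) + (\<xi> i \<omega>)\<^sup>2 \<partial>M) \<le> (2 * C + 1) * (real p)\<^sup>2 * C' + \<sigma>2" if i: "i < n" for i
    proof -
      have "(\<integral>\<omega>. (2 * C + 1) * real p * (\<Sum>j<p. (A i j \<omega>)\<^sup>2) + (\<xi> i \<omega>)\<^sup>2 \<partial>M)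
          = (2 * C + 1) * real p * (\<Sum>j<p. \<integral>\<omega>. (A i j \<omega>)\<^sup>2 \<partial>M) + (\<integral>\<omega>. (\<xi> i \<omega>)\<^sup>2 \<partial>M)"
        using ia[OF i] \<xi>(2)[OF i] A(2)[OF i] by (simp add: Bochner_Integration.integral_sum)
      also have "\<dots> \<le> (2 * C + 1) * real p * (\<Sum>j<p. C') + \<sigma>2"
        using A(3)[OF i] \<xi>(3)[OF i] C by (intro add_mono mult_left_mono sum_mono) auto
      finally show ?thesis by (simp add: power2_eq_square mult_ac)
    qed
    note row = this
    have "(\<integral>\<omega>. K \<omega> \<partial>M) = 1 / (2 * real n) * (\<Sum>i<n. \<integral>\<omega>. (2 * C + 1) * real p * (\<Sum>j<p. (A i j \<omega>)\<^sup>2) + (\<xi> i \<omega>)\<^sup>2 \<partial>M) + Lp"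
    proof -
      have isum: "integrable M (\<lambda>\<omega>. \<Sum>i<n. (2 * C + 1) * real p * (\<Sum>j<p. (A i j \<omega>)\<^sup>2) + (\<xi> i \<omega>)\<^sup>2)"
        using ir by (intro Bochner_Integration.integrable_sum) auto
      have "(\<integral>\<omega>. (\<Sum>i<n. (2 * C + 1) * real p * (\<Sum>j<p. (A i j \<omega>)\<^sup>2) + (\<xi> i \<omega>)\<^sup>2) \<partial>M)
          = (\<Sum>i<n. \<integral>\<omega>. (2 * C + 1) * real p * (\<Sum>j<p. (A i j \<omega>)\<^sup>2) + (\<xi> i \<omega>)\<^sup>2 \<partial>M)"
        by (rule Bochner_Integration.integral_sum) (use ir in auto)
      then show ?thesis unfolding K_def risk_modulus_def
        using Bochner_Integration.integral_add[OF integrable_mult_right[OF isum] integrable_const, of "1 / (2 * real n)" Lp]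
        by (simp add: prob_space)
    qed
    also have "\<dots> \<le> 1 / (2 * real n) * (\<Sum>i<n. (2 * C + 1) * (real p)\<^sup>2 * C' + \<sigma>2) + Lp"
      using row by (intro add_right_mono mult_left_mono sum_mono) auto
    also have "\<dots> = ((2 * C + 1) * (real p)\<^sup>2 * C' + \<sigma>2) / 2 + Lp" using n by simp
    finally show ?thesis .
  qed
  have pt: "\<bar>\<psi> (INF \<phi>\<in>V. ?R \<phi> \<omega>) - \<psi> (?s \<omega>)\<bar> \<le> B1 * (\<delta> * K \<omega> + ln (card N) / \<beta>)" for \<omega>
  proof -
    have a: "(INF \<phi>\<in>V. ?R \<phi> \<omega>) \<le> (INF \<phi>\<in>N. ?R \<phi> \<omega>)" "(INF \<phi>\<in>N. ?R \<phi> \<omega>) \<le> (INF \<phi>\<in>V. ?R \<phi> \<omega>) + \<delta> * K \<omega>"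
      using net_INF[of N \<delta> \<omega>] N \<delta> by blast+
    have bb: "?s \<omega> \<le> (INF \<phi>\<in>N. ?R \<phi> \<omega>)" "(INF \<phi>\<in>N. ?R \<phi> \<omega>) \<le> ?s \<omega> + ln (card N) / \<beta>"
      unfolding \<beta>_def by (rule softmin_INF[OF N(2,3) b n])+
    have cN: "0 \<le> ln (real (card N))" using N by (simp add: card_gt_0_iff Suc_le_eq ln_ge_zero)
    have K0: "0 \<le> K \<omega>" unfolding K_def risk_modulus_def using C pen(3)
      by (intro add_nonneg_nonneg mult_nonneg_nonneg sum_nonneg) auto
    have "\<bar>(INF \<phi>\<in>V. ?R \<phi> \<omega>) - ?s \<omega>\<bar> \<le> \<delta> * K \<omega> + ln (card N) / \<beta>"
      using a bb mult_nonneg_nonneg[OF \<delta> K0] divide_nonneg_pos[OF cN \<beta>] by linarith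
    then have "B1 * \<bar>(INF \<phi>\<in>V. ?R \<phi> \<omega>) - ?s \<omega>\<bar> \<le> B1 * (\<delta> * K \<omega> + ln (card N) / \<beta>)"
      using \<psi>(4) by (rule mult_left_mono)
    then show ?thesis using \<psi>(3) order_trans by blast
  qed
  have i1: "integrable M (\<lambda>\<omega>. \<psi> (INF \<phi>\<in>V. ?R \<phi> \<omega>))"
    by (rule integrable_const_bound[of _ B0]) (use \<psi>(2) measurable_compose[OF INFm \<psi>(1)] in auto)
  have i2: "integrable M (\<lambda>\<omega>. \<psi> (?s \<omega>))"
    by (rule integrable_const_bound[of _ B0]) (use \<psi>(2) measurable_compose[OF sm \<psi>(1)] in auto)
  have "\<bar>(\<integral>\<omega>. \<psi> (INF \<phi>\<in>V. ?R \<phi> \<omega>) \<partial>M) - (\<integral>\<omega>. \<psi> (?s \<omega>) \<partial>M)\<bar>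
      = \<bar>\<integral>\<omega>. \<psi> (INF \<phi>\<in>V. ?R \<phi> \<omega>) - \<psi> (?s \<omega>) \<partial>M\<bar>"
    using i1 i2 by simp
  also have "\<dots> \<le> (\<integral>\<omega>. \<bar>\<psi> (INF \<phi>\<in>V. ?R \<phi> \<omega>) - \<psi> (?s \<omega>)\<bar> \<partial>M)" by (rule integral_abs_bound)
  also have "\<dots> \<le> (\<integral>\<omega>. B1 * (\<delta> * K \<omega> + ln (card N) / \<beta>) \<partial>M)"
  proof (rule integral_mono)
    show "integrable M (\<lambda>\<omega>. \<bar>\<psi> (INF \<phi>\<in>V. ?R \<phi> \<omega>) - \<psi> (?s \<omega>)\<bar>)" using i1 i2 by simp
    show "integrable M (\<lambda>\<omega>. B1 * (\<delta> * K \<omega> + ln (card N) / \<beta>))" using intK by simp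
  qed (rule pt)
  also have "\<dots> = B1 * (\<delta> * (\<integral>\<omega>. K \<omega> \<partial>M) + ln (card N) / \<beta>)" using intK by (simp add: prob_space)
  also have "\<dots> \<le> B1 * (\<delta> * (((2 * C + 1) * (real p)\<^sup>2 * C' + \<sigma>2) / 2 + Lp) + ln (card N) / \<beta>)"
    using EK \<delta> \<psi>(4) by (intro mult_left_mono add_right_mono) auto
  finally show ?thesis .
qed

section \<open>The two designs of the model\<close>

lemma row_regular_col_scale:
  assumes M: "prob_space M"
    and ind: "prob_space.indep_vars M (\<lambda>B. vec_space B) (\<lambda>B. rand_vec B (col_scale l X i)) P"
    and X: "\<And>j. j < p \<Longrightarrow> X i j \<in> borel_measurable M" "\<And>j. j < p \<Longrightarrow> (\<integral>\<omega>. X i j \<omega> \<partial>M) = 0"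
      "\<And>j k. j < p \<Longrightarrow> k < p \<Longrightarrow> (\<integral>\<omega>. X i j \<omega> * X i k \<omega> \<partial>M) = (if j = k then 1 else 0)"
    and sg: "\<And>v s. s * (\<Sum>j<p. (v j)\<^sup>2) * q \<le> 1 \<Longrightarrow> sq_exp_bounded M s (\<lambda>\<omega>. \<Sum>j<p. v j * X i j \<omega>)"
    and l: "\<And>j. j < p \<Longrightarrow> 0 \<le> l j" "\<And>j. j < p \<Longrightarrow> l j \<le> C'" and C': "0 < C'" and q: "0 \<le> q"
    and \<tau>: "\<tau> * (C' * q) \<le> 1"
  shows "row_regular M p P l \<tau> (col_scale l X i)"
  unfolding row_regular_def
proof (intro conjI allI impI)
  show "col_scale l X i j \<in> borel_measurable M" if "j < p" for j
    unfolding col_scale_def[abs_def] using X(1)[OF that] by simp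
  show "(\<integral>\<omega>. col_scale l X i j \<omega> \<partial>M) = 0" if "j < p" for j
    using X(2)[OF that] by (simp add: col_scale_def)
  show "(\<integral>\<omega>. col_scale l X i j \<omega> * col_scale l X i k \<omega> \<partial>M) = (if j = k then l j else 0)" if "j < p" "k < p" for j k
  proof -
    have "(\<lambda>\<omega>. col_scale l X i j \<omega> * col_scale l X i k \<omega>) = (\<lambda>\<omega>. sqrt (l j) * sqrt (l k) * (X i j \<omega> * X i k \<omega>))"
      by (simp add: col_scale_def mult_ac)
    then show ?thesis using X(3)[OF that] l(1)[OF that(1)] l(1)[OF that(2)] by simp
  qed
  show "sq_exp_bounded M s (\<lambda>\<omega>. \<Sum>j<p. v j * col_scale l X i j \<omega>)" if s: "0 \<le> s" "s * (\<Sum>j<p. (v j)\<^sup>2) \<le> \<tau>" for v s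
  proof -
    have "(\<Sum>j<p. (v j * sqrt (l j))\<^sup>2) \<le> (\<Sum>j<p. (v j)\<^sup>2 * C')"
      using l by (intro sum_mono) (auto simp: power_mult_distrib intro!: mult_left_mono)
    then have "s * (\<Sum>j<p. (v j * sqrt (l j))\<^sup>2) * q \<le> s * ((\<Sum>j<p. (v j)\<^sup>2) * C') * q"
      unfolding sum_distrib_right using s q by (intro mult_right_mono mult_left_mono) auto
    also have "\<dots> = (s * (\<Sum>j<p. (v j)\<^sup>2)) * (C' * q)" by (simp add: mult_ac)
    also have "\<dots> \<le> \<tau> * (C' * q)" using s(2) C' q by (intro mult_right_mono) auto
    finally have "sq_exp_bounded M s (\<lambda>\<omega>. \<Sum>j<p. (v j * sqrt (l j)) * X i j \<omega>)"
      using \<tau> by (intro sg) linarith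
    then show ?thesis by (simp add: col_scale_def mult_ac)
  qed
qed (use M ind in auto)

lemma row_regular_block_design:
  assumes M: "prob_space M" and bd: "block_dependent M p d (col_scale l X i)"
    and X: "\<And>j. j < p \<Longrightarrow> X i j \<in> borel_measurable M" "\<And>j. j < p \<Longrightarrow> (\<integral>\<omega>. X i j \<omega> \<partial>M) = 0"
      "\<And>j k. j < p \<Longrightarrow> k < p \<Longrightarrow> (\<integral>\<omega>. X i j \<omega> * X i k \<omega> \<partial>M) = (if j = k then 1 else 0)"
    and L: "subgaussian_vec_norm M p (X i) \<le> ennreal L"
    and l: "\<And>j. j < p \<Longrightarrow> 0 \<le> l j" "\<And>j. j < p \<Longrightarrow> l j \<le> C'" and C': "0 < C'"
    and \<tau>: "\<tau> * (C' * (\<bar>L\<bar> + 1)\<^sup>2) \<le> 1"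
  shows "\<exists>P. partition_on {..<p} P \<and> (\<forall>B\<in>P. card B \<le> d) \<and> row_regular M p P l \<tau> (col_scale l X i)"
proof -
  interpret prob_space M by (rule M)
  obtain P where P: "partition_on {..<p} P" "\<forall>B\<in>P. card B \<le> d"
      "indep_vars (\<lambda>B. vec_space B) (\<lambda>B. rand_vec B (col_scale l X i)) P"
    using bd unfolding block_dependent_def by blast
  have "row_regular M p P l \<tau> (col_scale l X i)"
    by (rule row_regular_col_scale[where q = "(\<bar>L\<bar> + 1)\<^sup>2" and C' = C'])
      (use M P X L l C' \<tau> in \<open>auto intro!: sq_exp_bounded_subgaussian_vec_norm[where L = L]\<close>)
  then show ?thesis using P by blast
qed

text \<open>
  Independent entries give independent blocks for every partition; the partition used is that of the
  corresponding row of the other design.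
\<close>

lemma row_regular_gaussian_design:
  fixes n p :: nat
  assumes M: "prob_space M"
    and ind: "prob_space.indep_vars M (\<lambda>_. borel) (\<lambda>(i, j). G i j) ({..<n} \<times> {..<p})"
    and G: "\<And>i j. i < n \<Longrightarrow> j < p \<Longrightarrow> distributed M lborel (G i j) (\<lambda>x. ennreal (std_normal_density x))"
    and l: "\<And>j. j < p \<Longrightarrow> 0 \<le> l j" "\<And>j. j < p \<Longrightarrow> l j \<le> C'" and C': "0 < C'"
    and \<tau>: "\<tau> * (C' * 4) \<le> 1" and P: "partition_on {..<p} P" and i: "i < n"
  shows "row_regular M p P l \<tau> (col_scale l G i)"
proof -
  interpret prob_space M by (rule M)
  have PB: "B \<subseteq> {..<p}" if "B \<in> P" for B using P that by (auto simp: partition_on_def)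
  have disj: "A \<inter> B = {}" if "A \<in> P" "B \<in> P" "A \<noteq> B" for A B
    using P that unfolding partition_on_def disjoint_def by blast
  have Gm: "G i j \<in> borel_measurable M" if "j < p" for j using distributed_measurable[OF G[OF i that]] by simp
  have sgG: "sq_exp_bounded M (1/4) (G i j)" if "j < p" for j
    using G[OF i that] by (intro sq_exp_bounded_normal[of _ 1]) auto
  have intG: "integrable M (G i j)" if "j < p" for j by (rule sq_exp_bounded_integrable[OF sgG[OF that]]) simp
  have EG: "(\<integral>\<omega>. G i j \<omega> \<partial>M) = 0" if "j < p" for j by (rule standard_normal_distributed_expectation[OF G[OF i that]])
  have EGG: "(\<integral>\<omega>. G i j \<omega> * G i k \<omega> \<partial>M) = (if j = k then 1 else 0)" if jk: "j < p" "k < p" for j k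
  proof (cases "j = k")
    case True
    have "variance (G i j) = 1" by (rule standard_normal_distributed_variance[OF G[OF i jk(1)]])
    then show ?thesis using EG[OF jk(1)] True by (simp add: power2_eq_square)
  next
    case False
    let ?H = "\<lambda>ij. case ij of (i, j) \<Rightarrow> G i j"
    have "(\<integral>\<omega>. (\<Prod>ij\<in>{(i, j), (i, k)}. ?H ij \<omega>) \<partial>M) = (\<Prod>ij\<in>{(i, j), (i, k)}. \<integral>\<omega>. ?H ij \<omega> \<partial>M)"
    proof (rule indep_vars_lebesgue_integral)
      show "indep_vars (\<lambda>_. borel) ?H {(i, j), (i, k)}" using jk i by (intro indep_vars_subset[OF ind]) auto
    qed (use intG jk in auto)
    then show ?thesis using False EG[OF jk(1)] by simp
  qed
  have row_ind: "indep_vars (\<lambda>_. borel) (G i) {..<p}"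
  proof -
    have "indep_vars (\<lambda>j. PiM {(i, j)} (\<lambda>_. borel)) (\<lambda>j \<omega>. restrict (\<lambda>ij. (case ij of (i, j) \<Rightarrow> G i j) \<omega>) {(i, j)}) {..<p}"
      using i by (intro indep_vars_restrict[OF ind]) (auto simp: disjoint_family_on_def)
    from indep_vars_compose2[OF this, of "\<lambda>j f. f (i, j)" "\<lambda>_. borel"]
    show ?thesis by (simp add: measurable_component_singleton)
  qed
  have blocks: "indep_vars (\<lambda>B. vec_space B) (\<lambda>B. rand_vec B (col_scale l G i)) P"
  proof -
    have 1: "indep_vars (\<lambda>B. PiM ({i} \<times> B) (\<lambda>_. borel)) (\<lambda>B \<omega>. restrict (\<lambda>ij. (case ij of (i, j) \<Rightarrow> G i j) \<omega>) ({i} \<times> B)) P"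
      using i PB disj by (intro indep_vars_restrict[OF ind]) (fastforce simp: disjoint_family_on_def)+
    have 2: "(\<lambda>f. \<lambda>j\<in>B. f (i, j) * sqrt (l j)) \<in> measurable (PiM ({i} \<times> B) (\<lambda>_. borel)) (vec_space B)" for B
      by (intro measurable_restrict borel_measurable_times measurable_component_singleton borel_measurable_const) auto
    have "indep_vars (\<lambda>B. vec_space B) (\<lambda>B \<omega>. \<lambda>j\<in>B. restrict (\<lambda>ij. (case ij of (i, j) \<Rightarrow> G i j) \<omega>) ({i} \<times> B) (i, j) * sqrt (l j)) P"
      by (rule indep_vars_compose2[OF 1, of "\<lambda>B f. \<lambda>j\<in>B. f (i, j) * sqrt (l j)"]) (rule 2)
    moreover have "(\<lambda>B \<omega>. \<lambda>j\<in>B. restrict (\<lambda>ij. (case ij of (i, j) \<Rightarrow> G i j) \<omega>) ({i} \<times> B) (i, j) * sqrt (l j))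
        = (\<lambda>B. rand_vec B (col_scale l G i))"
      by (intro ext) (simp add: rand_vec_def col_scale_def restrict_def)
    ultimately show ?thesis by simp
  qed
  show ?thesis
  proof (rule row_regular_col_scale[where q = 4 and C' = C'])
    show "sq_exp_bounded M s (\<lambda>\<omega>. \<Sum>j<p. v j * G i j \<omega>)" if "s * (\<Sum>j<p. (v j)\<^sup>2) * 4 \<le> 1" for v s
      using that G i by (intro sq_exp_bounded_gaussian_vector row_ind) (auto simp: mult_ac)
  qed (use M blocks Gm EG EGG l C' \<tau> in auto)
qed

lemma (in prob_space) indep_rows_gaussian_design:
  fixes n p :: nat
  assumes ind: "indep_vars (\<lambda>_. borel) (\<lambda>(i, j). G i j) ({..<n} \<times> {..<p})"
  shows "indep_vars (\<lambda>_. vec_space {..<p}) (\<lambda>i. rand_vec {..<p} (col_scale l G i)) {..<n}"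
proof -
  have 1: "indep_vars (\<lambda>i. PiM ({i} \<times> {..<p}) (\<lambda>_. borel)) (\<lambda>i \<omega>. restrict (\<lambda>ij. (case ij of (i, j) \<Rightarrow> G i j) \<omega>) ({i} \<times> {..<p})) {..<n}"
    by (intro indep_vars_restrict[OF ind]) (auto simp: disjoint_family_on_def)
  have 2: "(\<lambda>f. \<lambda>j\<in>{..<p}. f (i, j) * sqrt (l j)) \<in> measurable (PiM ({i} \<times> {..<p}) (\<lambda>_. borel)) (vec_space {..<p})" for i
    by (intro measurable_restrict borel_measurable_times measurable_component_singleton borel_measurable_const) auto
  have "indep_vars (\<lambda>_. vec_space {..<p}) (\<lambda>i \<omega>. \<lambda>j\<in>{..<p}. restrict (\<lambda>ij. (case ij of (i, j) \<Rightarrow> G i j) \<omega>) ({i} \<times> {..<p}) (i, j) * sqrt (l j)) {..<n}"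
    by (rule indep_vars_compose2[OF 1, of "\<lambda>i f. \<lambda>j\<in>{..<p}. f (i, j) * sqrt (l j)"]) (rule 2)
  moreover have "(\<lambda>i \<omega>. \<lambda>j\<in>{..<p}. restrict (\<lambda>ij. (case ij of (i, j) \<Rightarrow> G i j) \<omega>) ({i} \<times> {..<p}) (i, j) * sqrt (l j))
      = (\<lambda>i. rand_vec {..<p} (col_scale l G i))"
    by (intro ext) (simp add: rand_vec_def col_scale_def restrict_def)
  ultimately show ?thesis by simp
qed

section \<open>The error bound in a fixed dimension\<close>

text \<open>
  The cubic term of a block is proportional to \<open>|B|\<^sup>3\<^sup>/\<^sup>2 \<le> \<surd>d |B|\<close>, the quadratic one to \<open>|B|\<close>, and the
  blocks have \<open>p\<close> elements in total.
\<close>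

lemma sum_step_error_le:
  assumes P: "partition_on {..<p} P" and d: "\<And>B. B \<in> P \<Longrightarrow> card B \<le> d"
    and nonneg: "0 \<le> B1" "0 \<le> \<Lambda>" "0 < c" "0 < \<beta>" "0 \<le> b" "0 \<le> h"
  shows "(\<Sum>B\<in>P. step_error B1 \<Lambda> c \<beta> (b * (sqrt (card B) * h)))
     \<le> B1 * (1296 / c^3 + 10 / c\<^sup>2) * (b * h)^3 * (sqrt d * real p) / \<beta> + \<Lambda> * (8 / c\<^sup>2) * (b * h)\<^sup>2 * real p / \<beta>\<^sup>2"
proof -
  let ?k1 = "B1 * (1296 / c^3 + 10 / c\<^sup>2) * (b * h)^3 / \<beta>" and ?k2 = "\<Lambda> * (8 / c\<^sup>2) * (b * h)\<^sup>2 / \<beta>\<^sup>2"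
  have k: "0 \<le> ?k1" "0 \<le> ?k2" using nonneg by auto
  have cards: "(\<Sum>B\<in>P. real (card B)) = real p"
  proof -
    have "card (\<Union>P) = (\<Sum>B\<in>P. card B)"
      using P by (intro card_Union_disjoint) (auto simp: partition_on_def intro: finite_subset[of _ "{..<p}"])
    then show ?thesis using P by (simp add: partition_on_def flip: of_nat_sum)
  qed
  have "(\<Sum>B\<in>P. step_error B1 \<Lambda> c \<beta> (b * (sqrt (card B) * h))) \<le> (\<Sum>B\<in>P. (?k1 * sqrt d + ?k2) * real (card B))"
  proof (rule sum_mono)
    fix B assume B: "B \<in> P"
    let ?r = "sqrt (real (card B))"
    have r2: "?r\<^sup>2 = real (card B)" by simp
    have "?r^3 = ?r * real (card B)" by (simp add: power3_eq_cube)
    also have "\<dots> \<le> sqrt d * real (card B)" using d[OF B] by (intro mult_right_mono) auto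
    finally have r3: "?r^3 \<le> sqrt d * real (card B)" .
    have "step_error B1 \<Lambda> c \<beta> (b * (?r * h)) = ?k1 * ?r^3 + ?k2 * ?r\<^sup>2"
      by (simp add: step_error_def power_mult_distrib mult_ac)
    also have "\<dots> \<le> ?k1 * (sqrt d * real (card B)) + ?k2 * real (card B)"
      using mult_left_mono[OF r3 k(1)] r2 by simp
    finally show "step_error B1 \<Lambda> c \<beta> (b * (?r * h)) \<le> (?k1 * sqrt d + ?k2) * real (card B)"
      by (simp add: algebra_simps)
  qed
  also have "\<dots> = (?k1 * sqrt d + ?k2) * real p" by (simp only: sum_distrib_left[symmetric] cards)
  finally show ?thesis by (simp add: algebra_simps)
qed

text \<open>
  The three summands: the net and the soft minimum, once for each design; the third-order remainders;
  the squared increments.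
\<close>

lemma universality_fixed_dimension:
  fixes A0 A1 :: "nat \<Rightarrow> nat \<Rightarrow> 'w \<Rightarrow> real"
  assumes n: "0 < n" and p: "0 < p"
    and R: "\<And>i. i < n \<Longrightarrow> row_regular M p (P i) l \<tau> (A0 i)" "\<And>i. i < n \<Longrightarrow> row_regular M p (P i) l \<tau> (A1 i)"
    and ind: "independent_design M n p A0 \<xi>" "independent_design M n p A1 \<xi>"
    and l: "\<And>j. j < p \<Longrightarrow> l j \<le> C'"
    and \<xi>: "\<And>i. i < n \<Longrightarrow> sq_exp_bounded M (3 * c) (\<xi> i)" "\<And>i. i < n \<Longrightarrow> (\<integral>\<omega>. (\<xi> i \<omega>)\<^sup>2 \<partial>M) \<le> \<sigma>2"
    and \<tau>: "0 < \<tau>" and P: "\<And>i. i < n \<Longrightarrow> partition_on {..<p} (P i)"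
    and d: "\<And>i B. i < n \<Longrightarrow> B \<in> P i \<Longrightarrow> card B \<le> d"
    and V: "\<And>\<phi> j. \<phi> \<in> V \<Longrightarrow> j < p \<Longrightarrow> \<bar>\<phi> j\<bar> \<le> h" "\<And>\<phi>. \<phi> \<in> V \<Longrightarrow> (\<Sum>j<p. (\<phi> j)\<^sup>2) \<le> C\<^sup>2" and h: "0 < h" and C: "0 < C"
    and pen: "\<And>\<phi>. \<phi> \<in> V \<Longrightarrow> 0 \<le> pen \<phi>"
      "\<And>\<phi> \<phi>' \<delta>. \<phi> \<in> V \<Longrightarrow> \<phi>' \<in> V \<Longrightarrow> (\<And>j. j < p \<Longrightarrow> \<bar>\<phi> j - \<phi>' j\<bar> \<le> \<delta>) \<Longrightarrow> 0 \<le> \<delta> \<Longrightarrow> \<bar>pen \<phi> - pen \<phi>'\<bar> \<le> \<delta> * Lp" "0 \<le> Lp"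
    and c: "0 < c" "2 * c \<le> \<tau>" "6 * c * C\<^sup>2 \<le> \<tau>" and b: "1 \<le> b"
    and small: "sqrt d * h \<le> 1" "6 * (b * (sqrt d * h)) \<le> c" and \<delta>: "0 < \<delta>"
    and \<psi>: "C11_bounds \<psi> \<psi>' B0 B1 \<Lambda>" "\<And>x y. \<bar>\<psi> y - \<psi> x\<bar> \<le> B1 * \<bar>y - x\<bar>" "0 \<le> B1" "0 \<le> \<Lambda>"
  defines "risk_of \<equiv> \<lambda>A \<omega>. INF \<phi>\<in>V. emp_risk pen n p (\<lambda>i j. A i j \<omega>) (\<lambda>i. \<xi> i \<omega>) \<phi>"
  shows "\<bar>(\<integral>\<omega>. \<psi> (risk_of A0 \<omega>) \<partial>M) - (\<integral>\<omega>. \<psi> (risk_of A1 \<omega>) \<partial>M)\<bar>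
     \<le> 2 * B1 * (\<delta> * (((2 * C + 1) * (real p)\<^sup>2 * C' + \<sigma>2) / 2 + Lp) + real p * ln (2 * C / \<delta> + 2) / (2 * real n * b))
       + 8 * B1 * (1296 / c^3 + 10 / c\<^sup>2) * (b\<^sup>2 * h^3 * sqrt d * real p) + 4 * \<Lambda> * (8 / c\<^sup>2) * (h\<^sup>2 * (real p / real n))"
proof (cases "V = {}")
  case True
  \<comment> \<open>Both infima are then the same constant; it remains to see that the bound is nonnegative.\<close>
  have "(0::real) \<le> C'" 
  proof -
    interpret prob_space M using R(1)[OF n] by (simp add: row_regular_def)
    have "(\<integral>\<omega>. A0 0 0 \<omega> * A0 0 0 \<omega> \<partial>M) = l 0" using R(1)[OF n] p by (simp add: row_regular_def)
    moreover have "0 \<le> (\<integral>\<omega>. A0 0 0 \<omega> * A0 0 0 \<omega> \<partial>M)" by (intro integral_nonneg_AE) auto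
    ultimately show ?thesis using l[OF p] by linarith
  qed
  moreover have "0 \<le> (\<integral>\<omega>. (\<xi> 0 \<omega>)\<^sup>2 \<partial>M)" by simp
  then have "0 \<le> \<sigma>2" using \<xi>(2)[OF n] by (rule order_trans)
  moreover have "0 \<le> ln (2 * C / \<delta> + 2)" using C \<delta> by (intro ln_ge_zero) (simp add: add_increasing)
  ultimately show ?thesis
    using True C \<delta> pen(3) b c h \<psi>(3,4) by (simp add: risk_of_def)
next
  case False
  interpret prob_space M using R(1)[OF n] by (simp add: row_regular_def)
  define \<beta> where "\<beta> = 2 * real n * b"
  have \<beta>: "0 < \<beta>" using n b by (simp add: \<beta>_def)
  have VC: "\<bar>\<phi> j\<bar> \<le> C" if "\<phi> \<in> V" "j < p" for \<phi> j
  proof -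
    have "(\<phi> j)\<^sup>2 \<le> (\<Sum>j<p. (\<phi> j)\<^sup>2)" using that(2) by (intro member_le_sum) auto
    also have "\<dots> \<le> C\<^sup>2" by (rule V(2)[OF that(1)])
    finally show ?thesis using C by (simp add: abs_le_square_iff[symmetric])
  qed
  obtain N where N: "N \<subseteq> V" "finite N" "N \<noteq> {}" "real (card N) \<le> (2 * C / \<delta> + 2) ^ p"
      "\<forall>\<phi>\<in>V. \<exists>\<phi>'\<in>N. \<forall>j<p. \<bar>\<phi> j - \<phi>' j\<bar> \<le> \<delta>"
    using finite_net[OF False _ \<delta>, of p C] VC C by auto
  let ?s = "\<lambda>A \<omega>. softmin N (\<lambda>\<phi>. exp (- \<beta> * pen \<phi>)) b \<beta> n p (\<lambda>i j. A i j \<omega>) (\<lambda>i. \<xi> i \<omega>)"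
  let ?K = "((2 * C + 1) * (real p)\<^sup>2 * C' + \<sigma>2) / 2 + Lp"
  have net: "\<bar>(\<integral>\<omega>. \<psi> (risk_of A \<omega>) \<partial>M) - (\<integral>\<omega>. \<psi> (?s A \<omega>) \<partial>M)\<bar> \<le> B1 * (\<delta> * ?K + ln (card N) / \<beta>)"
    if RA: "\<And>i. i < n \<Longrightarrow> row_regular M p (P i) l \<tau> (A i)" for A
    unfolding risk_of_def \<beta>_def
  proof (rule expectation_INF_softmin[OF n])
    show "0 < b" using b by simp
    show "A i j \<in> borel_measurable M" if "i < n" "j < p" for i j using RA[OF that(1)] that by (simp add: row_regular_def)
    show "integrable M (\<lambda>\<omega>. (A i j \<omega>)\<^sup>2)" if "i < n" "j < p" for i j
      using row_regular_integrable(2)[OF RA[OF that(1)] \<tau> that(2,2)] by (simp add: power2_eq_square)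
    show "(\<integral>\<omega>. (A i j \<omega>)\<^sup>2 \<partial>M) \<le> C'" if "i < n" "j < p" for i j
      using RA[OF that(1)] l[OF that(2)] that by (simp add: row_regular_def power2_eq_square)
    show "\<xi> i \<in> borel_measurable M" if "i < n" for i by (rule sq_exp_boundedD(1)[OF \<xi>(1)[OF that]])
    show "integrable M (\<lambda>\<omega>. (\<xi> i \<omega>)\<^sup>2)" if "i < n" for i
      using sq_exp_bounded_integrable_mult[OF \<xi>(1)[OF that] \<xi>(1)[OF that]] c by (simp add: power2_eq_square)
    show "\<exists>\<phi>'\<in>N. \<forall>j<p. \<bar>\<phi> j - \<phi>' j\<bar> \<le> \<delta>" if "\<phi> \<in> V" for \<phi> using N(5) that by blast
    show "\<bar>pen \<phi> - pen \<phi>'\<bar> \<le> \<delta>' * Lp" if "\<phi> \<in> V" "\<phi>' \<in> V" "\<And>j. j < p \<Longrightarrow> \<bar>\<phi> j - \<phi>' j\<bar> \<le> \<delta>'" "0 \<le> \<delta>'" for \<phi> \<phi>' \<delta>'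
      by (rule pen(2)[OF that])
    show "\<psi> \<in> borel_measurable borel" "\<bar>\<psi> x\<bar> \<le> B0" for x using \<psi>(1) by (auto simp: C11_bounds_def)
    show "\<bar>\<phi> j\<bar> \<le> C" if "\<phi> \<in> V" "j < p" for \<phi> j by (rule VC[OF that])
  qed (use False \<xi>(2) pen N \<delta> \<psi> C in auto)
  have exch: "\<bar>(\<integral>\<omega>. \<psi> (?s A0 \<omega>) \<partial>M) - (\<integral>\<omega>. \<psi> (?s A1 \<omega>) \<partial>M)\<bar>
      \<le> 16 * (\<Sum>i<n. \<Sum>B\<in>P i. step_error B1 \<Lambda> c \<beta> (b * (sqrt (card B) * h)))"
  proof (rule design_exchange[where P = P and l = l and \<tau> = \<tau> and d = d and h = h])
    show "C11_bounds \<psi> \<psi>' B0 B1 \<Lambda>" by (rule \<psi>(1))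
    show "\<bar>\<phi> j\<bar> \<le> h" if "\<phi> \<in> N" "j < p" for \<phi> j using N(1) that by (intro V(1)) auto
    show "6 * c * (\<Sum>j<p. (\<phi> j)\<^sup>2) \<le> \<tau>" if "\<phi> \<in> N" for \<phi>
    proof -
      have "6 * c * (\<Sum>j<p. (\<phi> j)\<^sup>2) \<le> 6 * c * C\<^sup>2" using V(2)[of \<phi>] N(1) that c by (intro mult_left_mono) auto
      then show ?thesis using c by linarith
    qed
    show "0 < exp (- \<beta> * pen \<phi>)" for \<phi> by simp
  qed (fact n R ind \<xi> \<tau> P p N h c b \<beta> d small)+
  have "(\<Sum>i<n. \<Sum>B\<in>P i. step_error B1 \<Lambda> c \<beta> (b * (sqrt (card B) * h)))
    \<le> (\<Sum>i<n. B1 * (1296 / c^3 + 10 / c\<^sup>2) * (b * h)^3 * (sqrt d * real p) / \<beta> + \<Lambda> * (8 / c\<^sup>2) * (b * h)\<^sup>2 * real p / \<beta>\<^sup>2)"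
  proof (rule sum_mono)
    fix i assume "i \<in> {..<n}"
    then have i: "i < n" by simp
    show "(\<Sum>B\<in>P i. step_error B1 \<Lambda> c \<beta> (b * (sqrt (card B) * h)))
       \<le> B1 * (1296 / c^3 + 10 / c\<^sup>2) * (b * h)^3 * (sqrt d * real p) / \<beta> + \<Lambda> * (8 / c\<^sup>2) * (b * h)\<^sup>2 * real p / \<beta>\<^sup>2"
      by (rule sum_step_error_le[OF P[OF i] d[OF i]]) (use \<psi> c \<beta> b h in auto)
  qed
  also have "\<dots> = B1 * (1296 / c^3 + 10 / c\<^sup>2) * (b\<^sup>2 * h^3 * sqrt d * real p) / 2 + \<Lambda> * (8 / c\<^sup>2) * (h\<^sup>2 * (real p / real n)) / 4"
  proof -
    have b0: "b \<noteq> 0" "real n \<noteq> 0" using b n by auto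
    define k1 where "k1 = B1 * (1296 / c^3 + 10 / c\<^sup>2)"
    define k2 where "k2 = \<Lambda> * (8 / c\<^sup>2)"
    have "real n * (k1 * (b * h)^3 * (sqrt d * real p) / \<beta>) = k1 * (b\<^sup>2 * h^3 * sqrt d * real p) / 2"
      using b0 by (simp add: \<beta>_def power_mult_distrib power2_eq_square power3_eq_cube field_simps)
    moreover have "real n * (k2 * (b * h)\<^sup>2 * real p / \<beta>\<^sup>2) = k2 * (h\<^sup>2 * (real p / real n)) / 4"
      using b0 by (simp add: \<beta>_def power_mult_distrib power2_eq_square field_simps)
    ultimately show ?thesis unfolding k1_def k2_def by (simp add: distrib_left)
  qed
  finally have sum_err: "(\<Sum>i<n. \<Sum>B\<in>P i. step_error B1 \<Lambda> c \<beta> (b * (sqrt (card B) * h)))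
     \<le> B1 * (1296 / c^3 + 10 / c\<^sup>2) * (b\<^sup>2 * h^3 * sqrt d * real p) / 2 + \<Lambda> * (8 / c\<^sup>2) * (h\<^sup>2 * (real p / real n)) / 4" .
  have lnN: "ln (card N) \<le> real p * ln (2 * C / \<delta> + 2)"
  proof -
    have cN: "0 < real (card N)" using N by (simp add: card_gt_0_iff)
    have "ln (card N) \<le> ln ((2 * C / \<delta> + 2) ^ p)" using cN N(4) by (subst ln_le_cancel_iff) auto
    also have "\<dots> = real p * ln (2 * C / \<delta> + 2)" by (rule ln_realpow)
    finally show ?thesis .
  qed
  have le: "B1 * (\<delta> * ?K + ln (card N) / \<beta>) \<le> B1 * (\<delta> * ?K + real p * ln (2 * C / \<delta> + 2) / \<beta>)"
    using lnN \<beta> \<psi>(3) by (intro mult_left_mono add_left_mono divide_right_mono) auto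
  define T0 where "T0 = B1 * (\<delta> * ?K + real p * ln (2 * C / \<delta> + 2) / \<beta>)"
  define T1 where "T1 = B1 * (1296 / c^3 + 10 / c\<^sup>2) * (b\<^sup>2 * h^3 * sqrt d * real p)"
  define T2 where "T2 = \<Lambda> * (8 / c\<^sup>2) * (h\<^sup>2 * (real p / real n))"
  have net0: "\<bar>(\<integral>\<omega>. \<psi> (risk_of A0 \<omega>) \<partial>M) - (\<integral>\<omega>. \<psi> (?s A0 \<omega>) \<partial>M)\<bar> \<le> T0"
    unfolding T0_def by (rule order_trans[OF net le]) (rule R(1))
  have net1: "\<bar>(\<integral>\<omega>. \<psi> (risk_of A1 \<omega>) \<partial>M) - (\<integral>\<omega>. \<psi> (?s A1 \<omega>) \<partial>M)\<bar> \<le> T0"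
    unfolding T0_def by (rule order_trans[OF net le]) (rule R(2))
  have "\<bar>(\<integral>\<omega>. \<psi> (?s A0 \<omega>) \<partial>M) - (\<integral>\<omega>. \<psi> (?s A1 \<omega>) \<partial>M)\<bar> \<le> 8 * T1 + 4 * T2"
  proof -
    have "16 * (T1 / 2 + T2 / 4) = 8 * T1 + 4 * T2" by simp
    moreover have "\<bar>(\<integral>\<omega>. \<psi> (?s A0 \<omega>) \<partial>M) - (\<integral>\<omega>. \<psi> (?s A1 \<omega>) \<partial>M)\<bar> \<le> 16 * (T1 / 2 + T2 / 4)"
      unfolding T1_def T2_def by (rule order_trans[OF exch mult_left_mono[OF sum_err]]) simp
    ultimately show ?thesis by simp
  qed
  note mid = this
  have tri: "\<bar>u - v\<bar> \<le> 2 * T0 + 8 * T1 + 4 * T2"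
    if "\<bar>u - u'\<bar> \<le> T0" "\<bar>v - v'\<bar> \<le> T0" "\<bar>u' - v'\<bar> \<le> 8 * T1 + 4 * T2" for u u' v v' :: real
    using that by linarith
  have "\<bar>(\<integral>\<omega>. \<psi> (risk_of A0 \<omega>) \<partial>M) - (\<integral>\<omega>. \<psi> (risk_of A1 \<omega>) \<partial>M)\<bar> \<le> 2 * T0 + 8 * T1 + 4 * T2"
    by (rule tri[OF net0 net1 mid])
  then show ?thesis by (simp only: T0_def T1_def T2_def \<beta>_def mult.assoc)
qed

section \<open>The limit\<close>

text \<open>
  \<open>D\<close> bounds the block size \<open>d\<close>, and \<open>C \<eta>\<close> bounds the sup-norm \<open>h\<close> of the vectors in \<open>T\<close>.
\<close>

lemma asymptotics:
  assumes D: "D = (\<lambda>n::nat. (real n / ln (real n)) powr (1/5))"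
    and \<eta>: "\<eta> = (\<lambda>n. sqrt (D n * ln (real n) / real n))"
  shows "(\<lambda>n. ((ln (real n))\<^sup>2)\<^sup>2 * \<eta> n ^ 3 * sqrt (D n) * real n) \<longlonglongrightarrow> 0"
    and "(\<lambda>n. (\<eta> n)\<^sup>2) \<longlonglongrightarrow> 0"
    and "(\<lambda>n. sqrt (D n) * \<eta> n) \<longlonglongrightarrow> 0"
    and "(\<lambda>n. (ln (real n))\<^sup>2 * (sqrt (D n) * \<eta> n)) \<longlonglongrightarrow> 0"
    and "(\<lambda>n. 1 / real n ^ 3) \<longlonglongrightarrow> 0" "(\<lambda>n. 1 / real n ^ 3 * (real n)\<^sup>2) \<longlonglongrightarrow> 0" "(\<lambda>n. 1 / real n ^ 3 * real n) \<longlonglongrightarrow> 0"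
  unfolding \<eta> D by real_asymp+
lemma asymptotics_net: 
  assumes "C > 0" shows "(\<lambda>n::nat. real n * ln (2 * C / (1 / real n ^ 3) + 2) / (2 * real n * (ln (real n))\<^sup>2)) \<longlonglongrightarrow> 0"
  using assms by real_asymp

text \<open>
  The mean value theorem, used twice; the Lipschitz constant of \<open>\<psi>'\<close> serves as \<open>\<Lambda>\<close>.
\<close>

lemma test_function_C11:
  assumes "test_function \<psi>"
  shows "\<exists>B0 B1 \<Lambda>. C11_bounds \<psi> (deriv \<psi>) B0 B1 \<Lambda> \<and> (\<forall>x y. \<bar>\<psi> y - \<psi> x\<bar> \<le> B1 * \<bar>y - x\<bar>) \<and> 0 \<le> B1 \<and> 0 \<le> \<Lambda>"
proof -
  have D: "(\<psi> has_real_derivative deriv \<psi> x) (at x)" for x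
    using assms unfolding test_function_def
    by (simp add: DERIV_deriv_iff_real_differentiable differentiable_on_def)
  obtain B0 where B0: "\<And>x. \<bar>\<psi> x\<bar> \<le> B0"
    using assms unfolding test_function_def bounded_iff by (metis rangeI real_norm_def)
  obtain B1 where B1: "\<And>x. \<bar>deriv \<psi> x\<bar> \<le> B1"
    using assms unfolding test_function_def bounded_iff by (metis rangeI real_norm_def)
  obtain \<Lambda> where \<Lambda>: "\<Lambda>-lipschitz_on UNIV (deriv \<psi>)" using assms unfolding test_function_def by blast
  have \<Lambda>0: "0 \<le> \<Lambda>" by (rule lipschitz_on_nonneg[OF \<Lambda>])
  have mvt: "\<exists>z. \<bar>z - x\<bar> \<le> \<bar>y - x\<bar> \<and> \<psi> y - \<psi> x = (y - x) * deriv \<psi> z" for x y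
  proof (rule linorder_cases[of x y])
    assume "x < y"
    from MVT2[OF this, of \<psi> "deriv \<psi>"] D obtain z where "x < z" "z < y" "\<psi> y - \<psi> x = (y - x) * deriv \<psi> z" by blast
    then show ?thesis by (intro exI[of _ z]) auto
  next
    assume "y < x"
    from MVT2[OF this, of \<psi> "deriv \<psi>"] D obtain z where z: "y < z" "z < x" "\<psi> x - \<psi> y = (x - y) * deriv \<psi> z" by blast
    have "\<psi> y - \<psi> x = (y - x) * deriv \<psi> z" using z(3) by (simp add: left_diff_distrib)
    then show ?thesis using z(1,2) by (intro exI[of _ z]) auto
  qed auto
  have lip: "\<bar>\<psi> y - \<psi> x\<bar> \<le> B1 * \<bar>y - x\<bar>" for x y
  proof -
    obtain z where "\<psi> y - \<psi> x = (y - x) * deriv \<psi> z" using mvt[where x = x and y = y] by blast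
    then show ?thesis using mult_right_mono[OF B1[of z], of "\<bar>y - x\<bar>"] by (simp add: abs_mult mult.commute)
  qed
  have tay: "\<bar>\<psi> y - \<psi> x - deriv \<psi> x * (y - x)\<bar> \<le> \<Lambda> * (y - x)\<^sup>2" for x y
  proof -
    obtain z where z: "\<bar>z - x\<bar> \<le> \<bar>y - x\<bar>" "\<psi> y - \<psi> x = (y - x) * deriv \<psi> z" using mvt[where x = x and y = y] by blast
    have "\<bar>deriv \<psi> z - deriv \<psi> x\<bar> \<le> \<Lambda> * \<bar>z - x\<bar>" using lipschitz_onD[OF \<Lambda>, of z x] by (simp add: dist_real_def)
    also have "\<dots> \<le> \<Lambda> * \<bar>y - x\<bar>" using z(1) \<Lambda>0 by (rule mult_left_mono)
    finally have "\<bar>y - x\<bar> * \<bar>deriv \<psi> z - deriv \<psi> x\<bar> \<le> \<bar>y - x\<bar> * (\<Lambda> * \<bar>y - x\<bar>)" by (rule mult_left_mono) simp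
    moreover have "\<psi> y - \<psi> x - deriv \<psi> x * (y - x) = (y - x) * (deriv \<psi> z - deriv \<psi> x)"
      using z(2) by (simp add: right_diff_distrib mult.commute)
    moreover have "\<bar>y - x\<bar> * (\<Lambda> * \<bar>y - x\<bar>) = \<Lambda> * (y - x)\<^sup>2" by (simp add: power2_eq_square mult.left_commute)
    ultimately show ?thesis by (simp add: abs_mult)
  qed
  have "continuous_on UNIV \<psi>" using D by (auto intro!: continuous_at_imp_continuous_on DERIV_isCont)
  then have "\<psi> \<in> borel_measurable borel" by (rule borel_measurable_continuous_onI)
  moreover have "0 \<le> B1" using order_trans[OF abs_ge_zero B1] .
  ultimately show ?thesis using B0 B1 tay lip \<Lambda>0 unfolding C11_bounds_def by blast
qed

text \<open>
  Ridge and Lasso are treated together: the penalty is a common factor of the weights for the two designs,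
  and only its sign and its modulus of continuity on \<open>T\<close> matter.
\<close>

lemma universality_penalty:
  fixes M :: "nat \<Rightarrow> 'w measure" and X G :: "nat \<Rightarrow> nat \<Rightarrow> nat \<Rightarrow> 'w \<Rightarrow> real" and d p :: "nat \<Rightarrow> nat"
  assumes pos: "0 < \<kappa>" "0 < c" "0 < C'" "0 < C" "0 < lam"
    and model: "block_dependent_linear_model \<kappa> \<sigma> K L L\<^sub>\<xi> c C' M p d l \<beta>0 \<mu> X G \<xi>"
    and test: "test_function \<psi>"
    and f0: "\<And>n p \<beta>. 0 \<le> f n p \<beta>" and Lp: "0 \<le> Lp"
    and fL: "\<And>n \<phi> \<phi>' \<delta>. 1 \<le> n \<Longrightarrow> \<forall>j<p n. \<bar>\<phi> j\<bar> \<le> C \<Longrightarrow> \<forall>j<p n. \<bar>\<phi>' j\<bar> \<le> C \<Longrightarrow> \<forall>j<p n. \<bar>\<phi> j - \<phi>' j\<bar> \<le> \<delta> \<Longrightarrow>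
       \<bar>f n (p n) (\<lambda>j. \<phi> j + \<beta>0 n j) - f n (p n) (\<lambda>j. \<phi>' j + \<beta>0 n j)\<bar> \<le> \<delta> * (Lp * real (p n))"
  shows "universality f lam \<psi> C M p d \<beta>0 \<xi> (\<lambda>n. col_scale (l n) (X n)) (\<lambda>n. col_scale (l n) (G n))"
proof -
  obtain B0 B1 \<Lambda> where \<psi>: "C11_bounds \<psi> (deriv \<psi>) B0 B1 \<Lambda>" and lip: "\<And>x y. \<bar>\<psi> y - \<psi> x\<bar> \<le> B1 * \<bar>y - x\<bar>"
      and B1: "0 \<le> B1" and \<Lambda>: "0 \<le> \<Lambda>"
    using test_function_C11[OF test] by blast
  \<comment> \<open>Small enough for the rows of both designs.\<close>
  define \<tau> where "\<tau> = 1 / (C' * ((\<bar>L\<bar> + 1)\<^sup>2 + 4))"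
  have \<tau>: "0 < \<tau>" "\<tau> * (C' * (\<bar>L\<bar> + 1)\<^sup>2) \<le> 1" "\<tau> * (C' * 4) \<le> 1"
  proof -
    have q: "0 < (\<bar>L\<bar> + 1)\<^sup>2 + 4" by (simp add: add_nonneg_pos)
    show "0 < \<tau>" using q pos by (simp add: \<tau>_def)
    have "C' * (\<bar>L\<bar> + 1)\<^sup>2 \<le> C' * ((\<bar>L\<bar> + 1)\<^sup>2 + 4)" "C' * 4 \<le> C' * ((\<bar>L\<bar> + 1)\<^sup>2 + 4)"
      using pos by (auto intro!: mult_left_mono)
    moreover have "0 < C' * ((\<bar>L\<bar> + 1)\<^sup>2 + 4)" using q pos by simp
    ultimately show "\<tau> * (C' * (\<bar>L\<bar> + 1)\<^sup>2) \<le> 1" "\<tau> * (C' * 4) \<le> 1" unfolding \<tau>_def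
      by (simp_all only: times_divide_eq_left mult_1 divide_le_eq_1_pos)
  qed
  \<comment> \<open>\<open>e\<close> plays the role of \<open>c\<close> in the exchange: it serves the blocks, the rows and the noise.\<close>
  define e where "e = min (\<tau> / 2) (min (\<tau> / (6 * C\<^sup>2)) (1 / (3 * (\<bar>L\<^sub>\<xi>\<bar> + 1)\<^sup>2)))"
  have e: "0 < e" "2 * e \<le> \<tau>" "6 * e * C\<^sup>2 \<le> \<tau>" "(3 * e) * (\<bar>L\<^sub>\<xi>\<bar> + 1)\<^sup>2 \<le> 1"
  proof -
    have q: "0 < (\<bar>L\<^sub>\<xi>\<bar> + 1)\<^sup>2" "0 < C\<^sup>2" using pos by (simp_all add: add_nonneg_pos)
    show "0 < e" using \<tau> q by (simp add: e_def)
    show "2 * e \<le> \<tau>" by (simp add: e_def)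
    have "e \<le> \<tau> / (6 * C\<^sup>2)" "e \<le> 1 / (3 * (\<bar>L\<^sub>\<xi>\<bar> + 1)\<^sup>2)" by (simp_all add: e_def)
    then show "6 * e * C\<^sup>2 \<le> \<tau>" "(3 * e) * (\<bar>L\<^sub>\<xi>\<bar> + 1)\<^sup>2 \<le> 1" using q by (simp_all add: field_simps)
  qed
  define D where "D = (\<lambda>n::nat. (real n / ln (real n)) powr (1/5))"
  define \<eta> where "\<eta> = (\<lambda>n. sqrt (D n * ln (real n) / real n))"
  define b where "b = (\<lambda>n::nat. (ln (real n))\<^sup>2)"
  define k1 where "k1 = 8 * B1 * (1296 / e^3 + 10 / e\<^sup>2)"
  define k2 where "k2 = 4 * \<Lambda> * (8 / e\<^sup>2)"
  have k: "0 \<le> k1" "0 \<le> k2" using B1 \<Lambda> e by (auto simp: k1_def k2_def)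
  define bound where "bound = (\<lambda>n::nat. 2 * B1 * ((2 * C + 1) * (\<kappa> + 1)\<^sup>2 * C' / 2 * (1 / real n ^ 3 * (real n)\<^sup>2) + \<sigma>\<^sup>2 / 2 * (1 / real n ^ 3)
      + lam * Lp * (\<kappa> + 1) * (1 / real n ^ 3 * real n) + (\<kappa> + 1) * (real n * ln (2 * C / (1 / real n ^ 3) + 2) / (2 * real n * (ln (real n))\<^sup>2)))
      + k1 * (C^3 * (\<kappa> + 1)) * (((ln (real n))\<^sup>2)\<^sup>2 * \<eta> n ^ 3 * sqrt (D n) * real n) + k2 * (C\<^sup>2 * (\<kappa> + 1)) * (\<eta> n)\<^sup>2)"
  note asym = asymptotics[OF D_def \<eta>_def]
  have bound0: "bound \<longlonglongrightarrow> 0"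
    unfolding bound_def
    by (intro tendsto_add_zero tendsto_mult_right_zero asym asymptotics_net pos)
  \<comment> \<open>Deterministic conditions that hold for all large \<open>n\<close>; for the others \<open>2 B0\<close> is a trivial bound.\<close>
  define good where "good = (\<lambda>n. 3 \<le> n \<and> 0 < p n \<and> real (p n) \<le> (\<kappa> + 1) * real n \<and> real (d n) \<le> D n \<and>
      sqrt (D n) * (C * \<eta> n) \<le> 1 \<and> 6 * (b n * (sqrt (D n) * (C * \<eta> n))) \<le> e)"
  have model': "\<And>n. 1 \<le> n \<Longrightarrow> prob_space (M n)" "(\<lambda>n. real (p n) / real n) \<longlonglongrightarrow> \<kappa>"
      "noise_assumption \<sigma> L\<^sub>\<xi> M \<xi>" "assumption1 K L c C' M p d l X"
      "indep_of_noise M p (\<lambda>n. col_scale (l n) (X n)) \<xi>" "std_gaussian_design M p G"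
      "indep_of_noise M p (\<lambda>n. col_scale (l n) (G n)) \<xi>"
    using model unfolding block_dependent_linear_model_def by blast+
  have good: "eventually good sequentially"
    unfolding good_def
  proof (intro eventually_conj)
    have *: "eventually (\<lambda>n. real (p n) / real n < \<kappa> + 1) sequentially" "eventually (\<lambda>n. 0 < real (p n) / real n) sequentially"
      using order_tendstoD[OF model'(2)] pos by auto
    show "eventually (\<lambda>n. 3 \<le> n) sequentially" by (rule eventually_ge_at_top)
    show "eventually (\<lambda>n. 0 < p n) sequentially" using *(2) by eventually_elim (simp add: zero_less_divide_iff)
    show "eventually (\<lambda>n. real (p n) \<le> (\<kappa> + 1) * real n) sequentially"
      using *(1) eventually_gt_at_top[of 0] by eventually_elim (simp add: field_simps)
    have "(\<lambda>n. real (d n)) \<in> o(D)" using model'(4) by (simp add: assumption1_def D_def)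
    from landau_o.smallD[OF this zero_less_one]
    show "eventually (\<lambda>n. real (d n) \<le> D n) sequentially" by eventually_elim (simp add: D_def)
    have "(\<lambda>n. C * (sqrt (D n) * \<eta> n)) \<longlonglongrightarrow> 0" by (intro tendsto_mult_right_zero asym)
    then have "eventually (\<lambda>n. C * (sqrt (D n) * \<eta> n) < 1) sequentially" by (rule order_tendstoD) simp
    then show "eventually (\<lambda>n. sqrt (D n) * (C * \<eta> n) \<le> 1) sequentially" by eventually_elim (simp add: mult_ac)
    have "(\<lambda>n. 6 * C * ((ln (real n))\<^sup>2 * (sqrt (D n) * \<eta> n))) \<longlonglongrightarrow> 0" by (intro tendsto_mult_right_zero asym)
    then have "eventually (\<lambda>n. 6 * C * ((ln (real n))\<^sup>2 * (sqrt (D n) * \<eta> n)) < e) sequentially" using e(1) by (rule order_tendstoD)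
    then show "eventually (\<lambda>n. 6 * (b n * (sqrt (D n) * (C * \<eta> n))) \<le> e) sequentially" by eventually_elim (simp add: b_def mult_ac)
  qed
  have main: "\<bar>(\<integral>\<omega>. \<psi> (INF \<phi> \<in> S \<inter> T_set C (d n) n (p n). risk f lam n (p n) (\<beta>0 n) (\<xi> n) \<phi> (col_scale (l n) (X n)) \<omega>) \<partial>M n)
      - (\<integral>\<omega>. \<psi> (INF \<phi> \<in> S \<inter> T_set C (d n) n (p n). risk f lam n (p n) (\<beta>0 n) (\<xi> n) \<phi> (col_scale (l n) (G n)) \<omega>) \<partial>M n)\<bar> \<le> bound n"
    if n: "good n" for n S
  proof -
    have n3: "3 \<le> n" and p: "0 < p n" "real (p n) \<le> (\<kappa> + 1) * real n" and d: "real (d n) \<le> D n"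
      and sm: "sqrt (D n) * (C * \<eta> n) \<le> 1" "6 * (b n * (sqrt (D n) * (C * \<eta> n))) \<le> e"
      using n unfolding good_def by auto
    have n1: "1 \<le> n" "0 < n" using n3 by auto
    interpret prob_space "M n" by (rule model'(1)[OF n1(1)])
    have lnn: "1 \<le> ln (real n)"
    proof -
      have "exp 1 \<le> real n" using exp_le n3 by linarith
      then show ?thesis using n1 by (simp add: ln_ge_iff)
    qed
    have b1: "1 \<le> b n" using lnn by (simp add: b_def one_le_power)
    define h where "h = C * sqrt (real (d n) * ln (real n) / real n)"
    define pen where "pen = (\<lambda>\<phi>. lam * f n (p n) (\<lambda>j. \<phi> j + \<beta>0 n j))"
    define V where "V = S \<inter> T_set C (d n) n (p n)"
    note A = model'(4)[unfolded assumption1_def, THEN conjunct2, THEN spec, THEN mp, OF n1(1)]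
    have A1: "iid_rows (M n) n (p n) (col_scale (l n) (X n))"
        "\<And>i. i < n \<Longrightarrow> block_dependent (M n) (p n) (d n) (col_scale (l n) (X n) i)"
        "\<And>i j. i < n \<Longrightarrow> j < p n \<Longrightarrow> X n i j \<in> borel_measurable (M n) \<and> (\<integral>\<omega>. X n i j \<omega> \<partial>M n) = 0"
        "\<And>i j k. i < n \<Longrightarrow> j < p n \<Longrightarrow> k < p n \<Longrightarrow> (\<integral>\<omega>. X n i j \<omega> * X n i k \<omega> \<partial>M n) = (if j = k then 1 else 0)"
        "\<And>i. i < n \<Longrightarrow> subgaussian_vec_norm (M n) (p n) (X n i) \<le> ennreal L"
        "\<And>j. j < p n \<Longrightarrow> c \<le> l n j \<and> l n j \<le> C'"
      using A by simp_all
    have l: "\<And>j. j < p n \<Longrightarrow> 0 \<le> l n j" "\<And>j. j < p n \<Longrightarrow> l n j \<le> C'" using A1(6) pos(2) by fastforce+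
    have "\<forall>i. \<exists>P. i < n \<longrightarrow> partition_on {..<p n} P \<and> (\<forall>B\<in>P. card B \<le> d n) \<and> row_regular (M n) (p n) P (l n) \<tau> (col_scale (l n) (X n) i)"
    proof
      fix i
      show "\<exists>P. i < n \<longrightarrow> partition_on {..<p n} P \<and> (\<forall>B\<in>P. card B \<le> d n) \<and> row_regular (M n) (p n) P (l n) \<tau> (col_scale (l n) (X n) i)"
      proof (cases "i < n")
        case True
        have "\<exists>P. partition_on {..<p n} P \<and> (\<forall>B\<in>P. card B \<le> d n) \<and> row_regular (M n) (p n) P (l n) \<tau> (col_scale (l n) (X n) i)"
          by (rule row_regular_block_design[where L = L and C' = C'])
            (use A1 True l pos \<tau> prob_space_axioms in auto)
        then show ?thesis by blast
      qed blast
    qed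
    then obtain P where P: "\<And>i. i < n \<Longrightarrow> partition_on {..<p n} (P i)" "\<And>i B. i < n \<Longrightarrow> B \<in> P i \<Longrightarrow> card B \<le> d n"
        "\<And>i. i < n \<Longrightarrow> row_regular (M n) (p n) (P i) (l n) \<tau> (col_scale (l n) (X n) i)"
      by metis
    have Gd: "indep_vars (\<lambda>_. borel) (\<lambda>(i, j). G n i j) ({..<n} \<times> {..<p n})"
        "\<And>i j. i < n \<Longrightarrow> j < p n \<Longrightarrow> distributed (M n) lborel (G n i j) (\<lambda>x. ennreal (std_normal_density x))"
      using model'(6)[unfolded std_gaussian_design_def, THEN spec, THEN mp, OF n1(1)] by simp_all
    have RG: "row_regular (M n) (p n) (P i) (l n) \<tau> (col_scale (l n) (G n) i)" if "i < n" for i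
      by (rule row_regular_gaussian_design[where n = n and C' = C']) (fact prob_space_axioms Gd l pos \<tau> P(1)[OF that] that)+
    have d1: "1 \<le> d n"
    proof -
      have "\<Union>(P 0) = {..<p n}" "{} \<notin> P 0" using P(1)[OF n1(2)] by (auto simp: partition_on_def)
      then obtain B where B: "B \<in> P 0" "B \<noteq> {}" using p(1) by blast
      have "B \<subseteq> {..<p n}" using P(1)[OF n1(2)] B(1) by (auto simp: partition_on_def)
      then have "finite B" by (rule finite_subset) simp
      then have "1 \<le> card B" using B(2) by (simp add: Suc_le_eq card_gt_0_iff)
      then show ?thesis using P(2)[OF n1(2) B(1)] by simp
    qed
    have indX: "independent_design (M n) n (p n) (col_scale (l n) (X n)) (\<xi> n)"
      using A1(1) model'(5)[unfolded indep_of_noise_def, THEN spec, THEN mp, OF n1(1)]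
      by (simp add: independent_design_def iid_rows_def)
    have indG: "independent_design (M n) n (p n) (col_scale (l n) (G n)) (\<xi> n)"
      using indep_rows_gaussian_design[OF Gd(1)] model'(7)[unfolded indep_of_noise_def, THEN spec, THEN mp, OF n1(1)]
      by (simp add: independent_design_def)
    have \<xi>: "sq_exp_bounded (M n) (3 * e) (\<xi> n i)" "(\<integral>\<omega>. (\<xi> n i \<omega>)\<^sup>2 \<partial>M n) \<le> \<sigma>\<^sup>2" if "i < n" for i
    proof -
      have N: "indep_vars (\<lambda>_. borel) (\<xi> n) {..<n}" "subgaussian_norm (M n) (\<xi> n i) \<le> ennreal L\<^sub>\<xi>" "(\<integral>\<omega>. (\<xi> n i \<omega>)\<^sup>2 \<partial>M n) = \<sigma>\<^sup>2"
        using model'(3)[unfolded noise_assumption_def, THEN spec, THEN mp, OF n1(1)] that by simp_all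
      have "\<xi> n i \<in> borel_measurable (M n)" using N(1) that by (auto simp: indep_vars_def)
      then show "sq_exp_bounded (M n) (3 * e) (\<xi> n i)" by (rule sq_exp_bounded_subgaussian_norm[OF _ N(2) e(4)])
      show "(\<integral>\<omega>. (\<xi> n i \<omega>)\<^sup>2 \<partial>M n) \<le> \<sigma>\<^sup>2" using N(3) by simp
    qed
    have V1: "\<bar>\<phi> j\<bar> \<le> h" if "\<phi> \<in> V" "j < p n" for \<phi> j using that by (simp add: V_def T_set_def h_def)
    have V2: "(\<Sum>j<p n. (\<phi> j)\<^sup>2) \<le> C\<^sup>2" if "\<phi> \<in> V" for \<phi>
    proof -
      have "(L2_set \<phi> {..<p n})\<^sup>2 \<le> C\<^sup>2" using that by (intro power_mono) (auto simp: V_def T_set_def L2_set_nonneg)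
      then show ?thesis by (simp add: L2_set_def sum_nonneg)
    qed
    have V3: "\<forall>j<p n. \<bar>\<phi> j\<bar> \<le> C" if "\<phi> \<in> V" for \<phi>
    proof (intro allI impI)
      fix j assume "j < p n"
      then have "(\<phi> j)\<^sup>2 \<le> (\<Sum>j<p n. (\<phi> j)\<^sup>2)" by (intro member_le_sum) auto
      also have "\<dots> \<le> C\<^sup>2" by (rule V2[OF that])
      finally show "\<bar>\<phi> j\<bar> \<le> C" using pos by (simp add: abs_le_square_iff[symmetric])
    qed
    have "0 < real (d n) * ln (real n) / real n" using d1 lnn n1 n3 by (intro divide_pos_pos mult_pos_pos) auto
    then have h0: "0 < h" using pos(4) by (simp add: h_def)
    have hle: "h \<le> C * \<eta> n"
      unfolding h_def \<eta>_def using pos d lnn n1 by (intro mult_left_mono) (auto intro!: divide_right_mono mult_right_mono)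
    have sd: "sqrt (d n) \<le> sqrt (D n)" using d by simp
    have \<eta>0: "0 \<le> \<eta> n" unfolding \<eta>_def using lnn by (auto simp: D_def)
    have sdh: "sqrt (d n) * h \<le> sqrt (D n) * (C * \<eta> n)" using sd hle h0 by (intro mult_mono) (auto simp: D_def)
    have bsdh: "6 * (b n * (sqrt (d n) * h)) \<le> e"
    proof -
      have "6 * (b n * (sqrt (d n) * h)) \<le> 6 * (b n * (sqrt (D n) * (C * \<eta> n)))" using sdh b1 by (intro mult_left_mono) auto
      then show ?thesis using sm(2) by linarith
    qed
    have fixed: "\<bar>(\<integral>\<omega>. \<psi> (INF \<phi>\<in>V. emp_risk pen n (p n) (\<lambda>i j. col_scale (l n) (X n) i j \<omega>) (\<lambda>i. \<xi> n i \<omega>) \<phi>) \<partial>M n)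
        - (\<integral>\<omega>. \<psi> (INF \<phi>\<in>V. emp_risk pen n (p n) (\<lambda>i j. col_scale (l n) (G n) i j \<omega>) (\<lambda>i. \<xi> n i \<omega>) \<phi>) \<partial>M n)\<bar>
      \<le> 2 * B1 * (1 / real n ^ 3 * (((2 * C + 1) * (real (p n))\<^sup>2 * C' + \<sigma>\<^sup>2) / 2 + lam * Lp * real (p n)) + real (p n) * ln (2 * C / (1 / real n ^ 3) + 2) / (2 * real n * b n))
       + 8 * B1 * (1296 / e^3 + 10 / e\<^sup>2) * ((b n)\<^sup>2 * h^3 * sqrt (d n) * real (p n)) + 4 * \<Lambda> * (8 / e\<^sup>2) * (h\<^sup>2 * (real (p n) / real n))"
    proof (rule universality_fixed_dimension[where P = P and \<tau> = \<tau> and l = "l n"])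
      show "0 \<le> pen \<phi>" for \<phi> unfolding pen_def using pos f0 by (intro mult_nonneg_nonneg) auto
      show "\<bar>pen \<phi> - pen \<phi>'\<bar> \<le> \<delta> * (lam * Lp * real (p n))"
        if "\<phi> \<in> V" "\<phi>' \<in> V" "\<And>j. j < p n \<Longrightarrow> \<bar>\<phi> j - \<phi>' j\<bar> \<le> \<delta>" "0 \<le> \<delta>" for \<phi> \<phi>' \<delta>
      proof -
        let ?f = "\<lambda>\<phi>. f n (p n) (\<lambda>j. \<phi> j + \<beta>0 n j)"
        have "\<forall>j<p n. \<bar>\<phi> j - \<phi>' j\<bar> \<le> \<delta>" using that(3) by blast
        from fL[OF n1(1) V3[OF that(1)] V3[OF that(2)] this]
        have "lam * \<bar>?f \<phi> - ?f \<phi>'\<bar> \<le> lam * (\<delta> * (Lp * real (p n)))" using pos by (intro mult_left_mono) auto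
        moreover have "\<bar>pen \<phi> - pen \<phi>'\<bar> = lam * \<bar>?f \<phi> - ?f \<phi>'\<bar>"
          using pos by (simp add: pen_def abs_mult flip: right_diff_distrib)
        ultimately show ?thesis by (simp add: mult_ac)
      qed
      show "0 \<le> lam * Lp * real (p n)" using pos Lp by simp
      show "sqrt (d n) * h \<le> 1" using sdh sm(1) by linarith
      show "0 < 1 / real n ^ 3" using n1 by simp
      show "C11_bounds \<psi> (deriv \<psi>) B0 B1 \<Lambda>" by (rule \<psi>)
    qed (fact n1 p P RG indX indG l \<xi> \<tau> V1 V2 h0 pos e b1 bsdh lip B1 \<Lambda>)+
    also have "\<dots> \<le> bound n"
    proof -
      let ?p = "real (p n)" and ?q = "(\<kappa> + 1) * real n"
      have q0: "0 \<le> ?q" using pos by simp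
      have p2: "?p\<^sup>2 \<le> ?q\<^sup>2" using p by (intro power_mono) auto
      have ln0: "0 \<le> ln (2 * C / (1 / real n ^ 3) + 2)" using pos by (intro ln_ge_zero) (simp add: add_increasing)
      have i1: "1 / real n ^ 3 * (((2 * C + 1) * ?p\<^sup>2 * C' + \<sigma>\<^sup>2) / 2 + lam * Lp * ?p)
          \<le> 1 / real n ^ 3 * (((2 * C + 1) * ?q\<^sup>2 * C' + \<sigma>\<^sup>2) / 2 + lam * Lp * ?q)"
        using p2 p(2) pos Lp by (intro mult_left_mono add_mono divide_right_mono mult_right_mono) auto
      have i2: "?p * ln (2 * C / (1 / real n ^ 3) + 2) / (2 * real n * b n) \<le> ?q * ln (2 * C / (1 / real n ^ 3) + 2) / (2 * real n * b n)"
        using p(2) ln0 b1 by (intro divide_right_mono mult_right_mono) auto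
      have h3: "h^3 \<le> (C * \<eta> n)^3" and h2: "h\<^sup>2 \<le> (C * \<eta> n)\<^sup>2" using hle h0 by (auto intro!: power_mono)
      have i3: "(b n)\<^sup>2 * h^3 * sqrt (d n) * ?p \<le> (b n)\<^sup>2 * (C * \<eta> n)^3 * sqrt (D n) * ?q"
        using h3 sd p(2) h0 pos \<eta>0 by (intro mult_mono mult_nonneg_nonneg) (auto simp: D_def)
      have i4: "h\<^sup>2 * (?p / real n) \<le> (C * \<eta> n)\<^sup>2 * (\<kappa> + 1)"
        using h2 p(2) n1 pos by (intro mult_mono) (auto simp: field_simps)
      have comb: "2 * B1 * (x1 + x2) + k1 * x3 + k2 * x4 \<le> 2 * B1 * (y1 + y2) + k1 * y3 + k2 * y4"
        if "x1 \<le> y1" "x2 \<le> y2" "x3 \<le> y3" "x4 \<le> y4" for x1 x2 x3 x4 y1 y2 y3 y4 :: real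
        using that k B1 by (intro add_mono mult_left_mono) auto
      have "2 * B1 * (1 / real n ^ 3 * (((2 * C + 1) * ?p\<^sup>2 * C' + \<sigma>\<^sup>2) / 2 + lam * Lp * ?p) + ?p * ln (2 * C / (1 / real n ^ 3) + 2) / (2 * real n * b n))
       + k1 * ((b n)\<^sup>2 * h^3 * sqrt (d n) * ?p) + k2 * (h\<^sup>2 * (?p / real n))
        \<le> 2 * B1 * (1 / real n ^ 3 * (((2 * C + 1) * ?q\<^sup>2 * C' + \<sigma>\<^sup>2) / 2 + lam * Lp * ?q) + ?q * ln (2 * C / (1 / real n ^ 3) + 2) / (2 * real n * b n))
       + k1 * ((b n)\<^sup>2 * (C * \<eta> n)^3 * sqrt (D n) * ?q) + k2 * ((C * \<eta> n)\<^sup>2 * (\<kappa> + 1))"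
        by (rule comb[OF i1 i2 i3 i4])
      also have "\<dots> = bound n"
        unfolding bound_def b_def power_mult_distrib
        by (simp add: algebra_simps add_divide_distrib)
      finally show ?thesis unfolding k1_def k2_def .
    qed
    finally show ?thesis unfolding V_def pen_def risk_eq_emp_risk .
  qed
  define \<gamma> where "\<gamma> = (\<lambda>n. if good n then bound n else 2 * B0)"
  have "\<gamma> \<longlonglongrightarrow> 0"
  proof (rule Lim_transform_eventually[OF bound0])
    show "eventually (\<lambda>n. bound n = \<gamma> n) sequentially" using good by eventually_elim (simp add: \<gamma>_def)
  qed
  moreover have "\<bar>(\<integral>\<omega>. \<psi> (INF \<phi> \<in> S \<inter> T_set C (d n) n (p n). risk f lam n (p n) (\<beta>0 n) (\<xi> n) \<phi> (col_scale (l n) (X n)) \<omega>) \<partial>M n)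
      - (\<integral>\<omega>. \<psi> (INF \<phi> \<in> S \<inter> T_set C (d n) n (p n). risk f lam n (p n) (\<beta>0 n) (\<xi> n) \<phi> (col_scale (l n) (G n)) \<omega>) \<partial>M n)\<bar> \<le> \<gamma> n"
    if "1 \<le> n" for n S
  proof (cases "good n")
    case True
    then show ?thesis using main by (simp add: \<gamma>_def)
  next
    case False
    interpret prob_space "M n" by (rule model'(1)[OF that])
    have \<psi>B: "\<bar>\<psi> x\<bar> \<le> B0" for x using \<psi> by (simp add: C11_bounds_def)
    have B0: "0 \<le> B0" using order_trans[OF abs_ge_zero \<psi>B] .
    have "\<bar>\<integral>\<omega>. \<psi> (g \<omega>) \<partial>M n\<bar> \<le> B0" for g
    proof -
      have "\<bar>\<integral>\<omega>. \<psi> (g \<omega>) \<partial>M n\<bar> \<le> (\<integral>\<omega>. \<bar>\<psi> (g \<omega>)\<bar> \<partial>M n)" by (rule integral_abs_bound)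
      also have "\<dots> \<le> (\<integral>\<omega>. B0 \<partial>M n)" by (rule integral_mono') (use \<psi>B B0 in auto)
      finally show ?thesis by (simp add: prob_space)
    qed
    note B = this
    show ?thesis using False B by (simp add: \<gamma>_def) (rule order_trans[OF abs_triangle_ineq4], rule order_trans[OF add_mono[OF B B]], simp)
  qed
  ultimately show ?thesis unfolding universality_def by blast
qed

theorem theorem4p1:
  fixes \<kappa> \<sigma> K L L\<^sub>\<xi> c C' :: real
  assumes "\<kappa> > 0" "c > 0" "C' > 0"
  shows "\<exists>lam0 > 0.
    \<forall>(M :: nat \<Rightarrow> 'w measure) (p :: nat \<Rightarrow> nat) (d :: nat \<Rightarrow> nat) (l :: nat \<Rightarrow> nat \<Rightarrow> real)
      (\<beta>0 :: nat \<Rightarrow> nat \<Rightarrow> real) (\<mu> :: (real \<times> real) measure)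
      (X :: nat \<Rightarrow> nat \<Rightarrow> nat \<Rightarrow> 'w \<Rightarrow> real) (G :: nat \<Rightarrow> nat \<Rightarrow> nat \<Rightarrow> 'w \<Rightarrow> real)
      (\<xi> :: nat \<Rightarrow> nat \<Rightarrow> 'w \<Rightarrow> real) (\<psi> :: real \<Rightarrow> real) (C :: real).
      block_dependent_linear_model \<kappa> \<sigma> K L L\<^sub>\<xi> c C' M p d l \<beta>0 \<mu> X G \<xi> \<longrightarrow>
      test_function \<psi> \<longrightarrow> C > 0 \<longrightarrow>
      (\<forall>lam>0. universality ridge_penalty lam \<psi> C M p d \<beta>0 \<xi>
                (\<lambda>n. col_scale (l n) (X n)) (\<lambda>n. col_scale (l n) (G n))) \<and>
      (\<forall>lam\<ge>lam0. universality lasso_penalty lam \<psi> C M p d \<beta>0 \<xi>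
                (\<lambda>n. col_scale (l n) (X n)) (\<lambda>n. col_scale (l n) (G n)))"
proof (intro exI[of _ 1] conjI allI impI)
  show "(0::real) < 1" by simp
  fix M :: "nat \<Rightarrow> 'w measure" and p d :: "nat \<Rightarrow> nat" and l \<beta>0 :: "nat \<Rightarrow> nat \<Rightarrow> real" and \<mu> :: "(real \<times> real) measure"
    and X G :: "nat \<Rightarrow> nat \<Rightarrow> nat \<Rightarrow> 'w \<Rightarrow> real" and \<xi> :: "nat \<Rightarrow> nat \<Rightarrow> 'w \<Rightarrow> real" and \<psi> :: "real \<Rightarrow> real" and C lam :: real
  assume model: "block_dependent_linear_model \<kappa> \<sigma> K L L\<^sub>\<xi> c C' M p d l \<beta>0 \<mu> X G \<xi>" and test: "test_function \<psi>" and C: "C > 0"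
  have \<beta>: "\<bar>\<beta>0 n j\<bar> \<le> C' / sqrt c" if "1 \<le> n" "j < p n" for n j
  proof -
    have "\<bar>sqrt (real n * l n j) * \<beta>0 n j\<bar> \<le> C'" and "c \<le> l n j"
      using model that unfolding block_dependent_linear_model_def assumption2_def assumption1_def Let_def by blast+
    then have "sqrt c \<le> sqrt (real n * l n j)" using that assms mult_mono[of 1 "real n" c "l n j"] by simp
    then have "sqrt c * \<bar>\<beta>0 n j\<bar> \<le> sqrt (real n * l n j) * \<bar>\<beta>0 n j\<bar>" by (rule mult_right_mono) simp
    also have "\<dots> = \<bar>sqrt (real n * l n j) * \<beta>0 n j\<bar>" using \<open>c \<le> l n j\<close> assms by (simp add: abs_mult)
    also have "\<dots> \<le> C'" by fact
    finally show ?thesis using assms by (simp add: field_simps)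
  qed
  show "universality ridge_penalty lam \<psi> C M p d \<beta>0 \<xi> (\<lambda>n. col_scale (l n) (X n)) (\<lambda>n. col_scale (l n) (G n))" if "0 < lam"
  proof (rule universality_penalty[OF assms C that model test])
    show "0 \<le> ridge_penalty n p \<beta>" for n p \<beta> by (simp add: ridge_penalty_def)
    show "0 \<le> C + C' / sqrt c" using C assms by simp
    fix n :: nat and \<phi> \<phi>' :: "nat \<Rightarrow> real" and \<delta> :: real
    assume n: "1 \<le> n" and \<phi>: "\<forall>j<p n. \<bar>\<phi> j\<bar> \<le> C" "\<forall>j<p n. \<bar>\<phi>' j\<bar> \<le> C" "\<forall>j<p n. \<bar>\<phi> j - \<phi>' j\<bar> \<le> \<delta>"
    have "ridge_penalty n (p n) (\<lambda>j. \<phi> j + \<beta>0 n j) - ridge_penalty n (p n) (\<lambda>j. \<phi>' j + \<beta>0 n j)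
        = (\<Sum>j<p n. (\<phi> j - \<phi>' j) * ((\<phi> j + \<phi>' j) / 2 + \<beta>0 n j))"
      by (simp add: ridge_penalty_def L2_set_def sum_nonneg sum_divide_distrib flip: sum_subtractf)
        (intro sum.cong refl, simp add: power2_eq_square field_simps)
    also have "\<bar>\<dots>\<bar> \<le> (\<Sum>j<p n. \<delta> * (C + C' / sqrt c))"
    proof (rule order_trans[OF sum_abs], rule sum_mono)
      fix j assume "j \<in> {..<p n}"
      then have j: "j < p n" by simp
      have "\<bar>(\<phi> j + \<phi>' j) / 2 + \<beta>0 n j\<bar> \<le> C + C' / sqrt c"
      proof -
        have "\<bar>\<phi> j\<bar> \<le> C" "\<bar>\<phi>' j\<bar> \<le> C" using \<phi>(1,2) j by auto
        then have "\<bar>\<phi> j + \<phi>' j\<bar> \<le> 2 * C" by linarith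
        then have "\<bar>(\<phi> j + \<phi>' j) / 2\<bar> \<le> C" by simp
        then show ?thesis using \<beta>[OF n j] abs_triangle_ineq[of "(\<phi> j + \<phi>' j) / 2" "\<beta>0 n j"] by linarith
      qed
      moreover have "\<bar>\<phi> j - \<phi>' j\<bar> \<le> \<delta>" using \<phi>(3) j by blast
      ultimately show "\<bar>(\<phi> j - \<phi>' j) * ((\<phi> j + \<phi>' j) / 2 + \<beta>0 n j)\<bar> \<le> \<delta> * (C + C' / sqrt c)"
        unfolding abs_mult by (intro mult_mono) auto
    qed
    finally show "\<bar>ridge_penalty n (p n) (\<lambda>j. \<phi> j + \<beta>0 n j) - ridge_penalty n (p n) (\<lambda>j. \<phi>' j + \<beta>0 n j)\<bar> \<le> \<delta> * ((C + C' / sqrt c) * real (p n))"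
      by (simp add: mult_ac)
  qed
  show "universality lasso_penalty lam \<psi> C M p d \<beta>0 \<xi> (\<lambda>n. col_scale (l n) (X n)) (\<lambda>n. col_scale (l n) (G n))" if "1 \<le> lam"
  proof (rule universality_penalty[OF assms C _ model test])
    show "0 < lam" using that by simp
    show "0 \<le> lasso_penalty n p \<beta>" for n p \<beta> by (simp add: lasso_penalty_def sum_nonneg)
    show "(0::real) \<le> 1" by simp
    fix n :: nat and \<phi> \<phi>' :: "nat \<Rightarrow> real" and \<delta> :: real
    assume n: "1 \<le> n" and \<phi>: "\<forall>j<p n. \<bar>\<phi> j - \<phi>' j\<bar> \<le> \<delta>"
    let ?D = "(\<Sum>j<p n. \<bar>\<phi> j + \<beta>0 n j\<bar>) - (\<Sum>j<p n. \<bar>\<phi>' j + \<beta>0 n j\<bar>)"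
    have "\<bar>?D\<bar> \<le> (\<Sum>j<p n. \<delta>)"
      unfolding sum_subtractf[symmetric]
    proof (rule order_trans[OF sum_abs], rule sum_mono)
      fix j assume "j \<in> {..<p n}"
      then have "\<bar>\<phi> j - \<phi>' j\<bar> \<le> \<delta>" using \<phi> by blast
      then show "\<bar>\<bar>\<phi> j + \<beta>0 n j\<bar> - \<bar>\<phi>' j + \<beta>0 n j\<bar>\<bar> \<le> \<delta>"
        using abs_triangle_ineq3[of "\<phi> j + \<beta>0 n j" "\<phi>' j + \<beta>0 n j"] by simp
    qed
    then have D: "\<bar>?D\<bar> \<le> real (p n) * \<delta>" by simp
    have "\<bar>lasso_penalty n (p n) (\<lambda>j. \<phi> j + \<beta>0 n j) - lasso_penalty n (p n) (\<lambda>j. \<phi>' j + \<beta>0 n j)\<bar> = 1 / sqrt (real n) * \<bar>?D\<bar>"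
      by (simp add: lasso_penalty_def flip: diff_divide_distrib)
    also have "\<dots> \<le> 1 * \<bar>?D\<bar>" using n by (intro mult_right_mono) auto
    finally show "\<bar>lasso_penalty n (p n) (\<lambda>j. \<phi> j + \<beta>0 n j) - lasso_penalty n (p n) (\<lambda>j. \<phi>' j + \<beta>0 n j)\<bar> \<le> \<delta> * (1 * real (p n))"
      using D by (simp add: mult.commute)
  qed
qed

end
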